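(* Let $\Omega\subset\mathbb{R}^n$, $n\ge 2$, be a bounded domain, let $m\in(1,n]$, and let $\ell$ be as in the context. Assume: (i) (uniform $P$-thickness) there exist $P\in(1,m)$ and constants $A_\Omega>0$, $r_0>0$ such that $$\mathrm{Cap}_P\big((\mathbb{R}^n\setminus\Omega)\cap\overline{B}_r(x),B_{2r}(x)\big)\ge A_\Omega\,\mathrm{Cap}_P\big(\overline{B}_r(x),B_{2r}(x)\big)$$ for all $x\in\mathbb{R}^n\setminus\Omega$ and all $r\in(0,r_0)$; (ii) (controlled growth) $\mathbf{a}\colon\Omega\times\mathbb{R}\times\mathbb{R}^n\to\mathbb{R}^n$ and $b\colon\Omega\times\mathbb{R}\times\mathbb{R}^n\to\mathbb{R}$ are Carath\'eodory maps, and there exist a constant $\Lambda>0$ and non-negative functions $\varphi\in L^{p,\lambda}(\Omega)$ with $p>\frac{m}{m-1}$, $\lambda\in(0,n)$, $(m-1)p+\lambda>n$, and $\psi\in L^{q,\mu}(\Omega)$ with $q>\frac{mn}{mn+m-n}$, $\mu\in(0,n)$, $mq+\mu>n$, such that $$|\mathbf{a}(x,z,\xi)|\le\Lambda\big(\varphi(x)+|z|^{\frac{\ell(m-1)}{m}}+|\xi|^{m-1}\big),\qquad |b(x,z,\xi)|\le\Lambda\big(\psi(x)+|z|^{\ell-1}+|\xi|^{\frac{m(\ell-1)}{\ell}}\big)$$ for a.a. $x\in\Omega$ and all $(z,\xi)\in\mathbb{R}\times\mathbb{R}^n$; (iii) (coercivity) there is $\gamma>0$ with $\mathbf{a}(x,z,\xi)\cdot\xi\ge\gamma|\xi|^m-\Lambda|z|^\ell-\Lambda\varphi(x)^{\frac{m}{m-1}}$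 for a.a. $x\in\Omega$ and all $(z,\xi)\in\mathbb{R}\times\mathbb{R}^n$. Then every weak solution $u\in W^{1,m}_0(\Omega)$ of the Dirichlet problem $\mathrm{div}\,\mathbf{a}(x,u,Du)=b(x,u,Du)$ in $\Omega$, $u=0$ on $\partial\Omega$, is essentially bounded: there exists a constant $M$, depending on the known quantities, on $\|Du\|_{L^m(\Omega)}$ and on the uniform integrability of $|Du|^m$, such that $\|u\|_{L^\infty(\Omega)}\le M$.
   Context: $\ell$ denotes the Sobolev conjugate of $m$: $\ell=\frac{nm}{n-m}$ if $m<n$, and $\ell$ is an arbitrary fixed exponent $\ell>n$ if $m=n$. For $s\in[1,\infty)$, $\theta\in[0,n]$ and a domain $D$, the Morrey space $L^{s,\theta}(D)$ consists of $u\in L^s(D)$ with $\|u\|_{L^{s,\theta}(D)}:=\sup_{x_0\in D,\rho>0}\big(\rho^{-\theta}\int_{B_\rho(x_0)\cap D}|u|^s\,dx\big)^{1/s}<\infty$. Variational $p$-capacity ($1<p<\infty$) relative to an open set $D$: for compact $C\subset D$, $\mathrm{Cap}_p(C,D)=\inf\int_D|Dg|^p\,dx$ over $g\in C_0^\infty(D)$ with $g=1$ on $C$; for open $U\subset D$, $\mathrm{Cap}_p(U,D)=\sup\{\mathrm{Cap}_p(C,D): C\subset U\text{ compact}\}$; for arbitrary $E\subset D$, $\mathrm{Cap}_p(E,D)=\inf\{\mathrm{Cap}_p(U,D): E\subset U\subset D,\ U\text{ open}\}$. Carath\'eodory means measurable in $x$ for all $(z,\xi)$ and continuous in $(z,\xi)$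 for a.a. $x$. A weak solution is $u\in W^{1,m}_0(\Omega)$ with $\int_\Omega\mathbf{a}(x,u,Du)\cdot Dv\,dx+\int_\Omega b(x,u,Du)v\,dx=0$ for all $v\in W^{1,m}_0(\Omega)$. "Known quantities" means $n,m,\ell,\gamma,\Lambda,p,\lambda,q,\mu,\|\varphi\|_{L^{p,\lambda}(\Omega)},\|\psi\|_{L^{q,\mu}(\Omega)},P,\mathrm{diam}\,\Omega,A_\Omega,r_0$. *)

theory Defs
  imports "HOL-Analysis.Analysis"
begin

definition pd :: "'n::finite \<Rightarrow> (real^'n \<Rightarrow> real) \<Rightarrow> real^'n \<Rightarrow> real" where
  "pd i f x = frechet_derivative f (at x) (axis i 1)"

definition grad :: "(real^'n::finite \<Rightarrow> real) \<Rightarrow> real^'n \<Rightarrow> real^'n" where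
  "grad f x = (\<chi> i. pd i f x)"

primrec Ck :: "nat \<Rightarrow> (real^'n::finite \<Rightarrow> real) \<Rightarrow> bool" where
  "Ck 0 f = continuous_on UNIV f"
| "Ck (Suc k) f = (f differentiable_on UNIV \<and> (\<forall>i. Ck k (pd i f)))"

definition tsupport :: "(real^'n::finite \<Rightarrow> real) \<Rightarrow> (real^'n) set" where
  "tsupport g = closure {x. g x \<noteq> 0}"

definition test_fun :: "(real^'n::finite) set \<Rightarrow> (real^'n \<Rightarrow> real) \<Rightarrow> bool" where
  "test_fun D g \<longleftrightarrow> (\<forall>k. Ck k g) \<and> compact (tsupport g) \<and> tsupport g \<subseteq> D"

definition lp_on :: "real \<Rightarrow> (real^'n::finite) set \<Rightarrow> (real^'n \<Rightarrow> real) \<Rightarrow> bool" where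
  "lp_on s D u \<longleftrightarrow> u \<in> borel_measurable (lebesgue_on D) \<and>
     (\<integral>\<^sup>+ x\<in>D. ennreal (\<bar>u x\<bar> powr s) \<partial>lebesgue) < \<infinity>"

definition has_weak_gradient :: "(real^'n::finite) set \<Rightarrow> (real^'n \<Rightarrow> real) \<Rightarrow> (real^'n \<Rightarrow> real^'n) \<Rightarrow> bool" where
  "has_weak_gradient D u Du \<longleftrightarrow>
     (\<forall>g i. test_fun D g \<longrightarrow>
        (LINT x:D|lebesgue. u x * pd i g x) = - (LINT x:D|lebesgue. Du x $ i * g x))"

definition sobolev_W10 :: "real \<Rightarrow> (real^'n::finite) set \<Rightarrow> (real^'n \<Rightarrow> real) \<Rightarrow> (real^'n \<Rightarrow> real^'n) \<Rightarrow> bool" where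
  "sobolev_W10 s D u Du \<longleftrightarrow> lp_on s D u \<and> (\<forall>i. lp_on s D (\<lambda>x. Du x $ i)) \<and>
     has_weak_gradient D u Du \<and>
     (\<exists>f :: nat \<Rightarrow> real^'n \<Rightarrow> real. (\<forall>k. test_fun D (f k)) \<and>
        (\<lambda>k. \<integral>\<^sup>+ x\<in>D. ennreal (\<bar>f k x - u x\<bar> powr s) \<partial>lebesgue) \<longlonglongrightarrow> 0 \<and>
        (\<lambda>k. \<integral>\<^sup>+ x\<in>D. ennreal (norm (grad (f k) x - Du x) powr s) \<partial>lebesgue) \<longlonglongrightarrow> 0)"

definition morrey_vals :: "real \<Rightarrow> real \<Rightarrow> (real^'n::finite) set \<Rightarrow> (real^'n \<Rightarrow> real) \<Rightarrow> real set" where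
  "morrey_vals s \<theta> D u = {(\<rho> powr (-\<theta>) *
       enn2real (\<integral>\<^sup>+ x\<in>ball x0 \<rho> \<inter> D. ennreal (\<bar>u x\<bar> powr s) \<partial>lebesgue)) powr (1/s)
     | x0 \<rho>. x0 \<in> D \<and> \<rho> > 0}"

definition in_morrey :: "real \<Rightarrow> real \<Rightarrow> (real^'n::finite) set \<Rightarrow> (real^'n \<Rightarrow> real) \<Rightarrow> bool" where
  "in_morrey s \<theta> D u \<longleftrightarrow> lp_on s D u \<and> bdd_above (morrey_vals s \<theta> D u)"

definition morrey_norm :: "real \<Rightarrow> real \<Rightarrow> (real^'n::finite) set \<Rightarrow> (real^'n \<Rightarrow> real) \<Rightarrow> real" where
  "morrey_norm s \<theta> D u = Sup (morrey_vals s \<theta> D u)"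

definition cap_compact :: "real \<Rightarrow> (real^'n::finite) set \<Rightarrow> (real^'n) set \<Rightarrow> ennreal" where
  "cap_compact p C D = (INF g \<in> {g. test_fun D g \<and> (\<forall>x\<in>C. g x = 1)}.
      \<integral>\<^sup>+ x\<in>D. ennreal (norm (grad g x) powr p) \<partial>lebesgue)"

definition cap_open :: "real \<Rightarrow> (real^'n::finite) set \<Rightarrow> (real^'n) set \<Rightarrow> ennreal" where
  "cap_open p U D = (SUP C \<in> {C. compact C \<and> C \<subseteq> U}. cap_compact p C D)"

definition capacity :: "real \<Rightarrow> (real^'n::finite) set \<Rightarrow> (real^'n) set \<Rightarrow> ennreal" where
  "capacity p E D = (INF U \<in> {U. open U \<and> E \<subseteq> U \<and> U \<subseteq> D}. cap_open p U D)"

definition caratheodory :: "(real^'n::finite) set \<Rightarrow> (real^'n \<Rightarrow> real \<Rightarrow> real^'n \<Rightarrow> 'c::{real_normed_vector}) \<Rightarrow> bool" where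
  "caratheodory D f \<longleftrightarrow> (\<forall>z \<xi>. (\<lambda>x. f x z \<xi>) \<in> borel_measurable (lebesgue_on D)) \<and>
     (AE x in lebesgue_on D. continuous_on UNIV (\<lambda>(z, \<xi>). f x z \<xi>))"

definition weak_solution :: "real \<Rightarrow> (real^'n::finite) set \<Rightarrow> (real^'n \<Rightarrow> real \<Rightarrow> real^'n \<Rightarrow> real^'n)
     \<Rightarrow> (real^'n \<Rightarrow> real \<Rightarrow> real^'n \<Rightarrow> real) \<Rightarrow> (real^'n \<Rightarrow> real) \<Rightarrow> (real^'n \<Rightarrow> real^'n) \<Rightarrow> bool" where
  "weak_solution m D a b u Du \<longleftrightarrow> sobolev_W10 m D u Du \<and>
     (\<forall>v Dv. sobolev_W10 m D v Dv \<longrightarrow>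
        (LINT x:D|lebesgue. a x (u x) (Du x) \<bullet> Dv x) + (LINT x:D|lebesgue. b x (u x) (Du x) * v x) = 0)"

end

theory Submission
  imports Defs
begin

text \<open>
  Let \<open>v = sgn u * max 0 (\<bar>u\<bar> - k)\<close> and let \<open>F(k)\<close> be the integral of \<open>\<bar>Du\<bar> powr m\<close> over the
  superlevel set \<open>A(k) = {\<bar>u\<bar> > k}\<close>. By Hoelder's inequality the weights \<open>\<phi> powr (m/(m-1))\<close> and
  \<open>\<psi>\<close> have mass at most \<open>C * \<rho> powr \<beta>\<close> in balls of radius \<open>\<rho>\<close>, with \<open>\<beta> > n - m\<close>; this is the
  meaning of the conditions on the Morrey exponents. Adams' trace inequality then bounds the integral of
  \<open>\<bar>v\<bar> powr s\<close> against these weights by \<open>C * F(k) powr (s/m)\<close> for some \<open>s > m\<close>, and the same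
  inequality for Lebesgue measure is Sobolev's inequality with \<open>s = l\<close>. Testing the equation with
  \<open>v\<close>, the terms of critical growth are absorbed as soon as \<open>F(k)\<close> is small, which holds for
  \<open>k \<ge> k0\<close> by uniform integrability, and
  \<open>F(k) \<le> C * (k powr l * \<bar>A(k)\<bar> + mass of A(k))\<close> remains. Bounding the right-hand side at a level
  \<open>h > k\<close> by Chebyshev's inequality and the trace inequalities at level \<open>k\<close> gives
  \<open>F(h) \<le> C(h,k) * F(k) powr (s/m)\<close>, and De Giorgi's iteration yields \<open>F(2 * k0) = 0\<close>.
\<close>

subsection \<open>Hoelder's inequality and Riesz potentials of measures with lower growth\<close>

text \<open>The constant has to be fixed before the domain, the coefficients and the solution. Hence
  every inequality is proved with an explicit bound that depends only on exponents, growth constants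
  and a diameter bound, and real upper bounds take the place of norms. One inequality serves three
  weights, the two Morrey weights and Lebesgue measure. The condition \<beta> > n - m says that the
  trace exponent m\<beta>/(n - m) exceeds m, and s > m is used twice: it lets the dyadic levels of
  the trace inequality be summed, and it makes the recursion for F superlinear, which gives both
  absorption and decay. The obstacle is critical growth: the lower order terms scale like the energy
  itself, so a bound on the norm of Du gives no level at which they are small. Sobolev's inequality
  and Chebyshev make A(k) small for large k, and uniform integrability turns this into F(k0) below a
  threshold computed beforehand from the constants. The sharp truncation maps test functions to
  functions with kinks, so its smooth approximants are used throughout and their limits are taken
  only in integral inequalities.\<close>

lemma nn_integral_Holder:
  fixes f g :: "'a \<Rightarrow> real"
  assumes [measurable]: "f \<in> borel_measurable M" "g \<in> borel_measurable M"
    and f0: "\<And>x. 0 \<le> f x" and g0: "\<And>x. 0 \<le> g x"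
    and a: "a > 1" and b: "b > 1" and ab: "1 / a + 1 / b = 1" and A: "A \<ge> 0" and B: "B \<ge> 0"
    and fA: "(\<integral>\<^sup>+ x. ennreal (f x powr a) \<partial>M) \<le> ennreal A"
    and gB: "(\<integral>\<^sup>+ x. ennreal (g x powr b) \<partial>M) \<le> ennreal B"
  shows "(\<integral>\<^sup>+ x. ennreal (f x * g x) \<partial>M) \<le> ennreal (A powr (1/a) * B powr (1/b))"
proof (cases "A = 0 \<or> B = 0")
  case True
  have "AE x in M. ennreal (f x * g x) = 0"
    using True
  proof
    assume "A = 0"
    then have "(\<integral>\<^sup>+ x. ennreal (f x powr a) \<partial>M) = 0" using fA by simp
    then have "AE x in M. ennreal (f x powr a) = 0"
      by (subst (asm) nn_integral_0_iff_AE) auto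
    then show ?thesis
      by eventually_elim (use f0 in \<open>auto simp: ennreal_eq_0_iff\<close>)
  next
    assume "B = 0"
    then have "(\<integral>\<^sup>+ x. ennreal (g x powr b) \<partial>M) = 0" using gB by simp
    then have "AE x in M. ennreal (g x powr b) = 0"
      by (subst (asm) nn_integral_0_iff_AE) auto
    then show ?thesis
      by eventually_elim (use g0 in \<open>auto simp: ennreal_eq_0_iff\<close>)
  qed
  then have "(\<integral>\<^sup>+ x. ennreal (f x * g x) \<partial>M) = (\<integral>\<^sup>+ x. 0 \<partial>M)"
    by (rule nn_integral_cong_AE)
  then show ?thesis by simp
next
  case False
  with A B have A': "A > 0" and B': "B > 0" by auto
  \<comment> \<open>Young's inequality is applied to \<open>f x / \<alpha>\<close> and
    \<open>g x / \<beta>\<close>. Zero bounds had to be treated before this division; there one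
    factor vanishes almost everywhere.\<close>
  define \<alpha> where "\<alpha> = A powr (1/a)"
  define \<beta> where "\<beta> = B powr (1/b)"
  have \<alpha>: "\<alpha> > 0" "\<alpha> powr a = A" and \<beta>: "\<beta> > 0" "\<beta> powr b = B"
    using A' B' a b by (auto simp: \<alpha>_def \<beta>_def powr_powr)
  have young: "f x * g x \<le> \<alpha> * \<beta> / (a * A) * f x powr a + \<alpha> * \<beta> / (b * B) * g x powr b" for x
  proof -
    have "(f x / \<alpha>) * (g x / \<beta>) \<le> (f x / \<alpha>) powr a / a + (g x / \<beta>) powr b / b"
      using f0 g0 \<alpha> \<beta> a b ab by (intro Youngs_inequality) auto
    then have "\<alpha> * \<beta> * ((f x / \<alpha>) * (g x / \<beta>)) \<le> \<alpha> * \<beta> * ((f x / \<alpha>) powr a / a + (g x / \<beta>) powr b / b)"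
      using \<alpha> \<beta> by (intro mult_left_mono) auto
    moreover have "(f x / \<alpha>) powr a = f x powr a / A" "(g x / \<beta>) powr b = g x powr b / B"
      using \<alpha> \<beta> f0 g0 by (auto simp: powr_divide)
    ultimately show ?thesis
      using \<alpha> \<beta> by (simp add: field_simps)
  qed
  have "(\<integral>\<^sup>+ x. ennreal (f x * g x) \<partial>M)
      \<le> (\<integral>\<^sup>+ x. ennreal (\<alpha> * \<beta> / (a * A)) * ennreal (f x powr a)
             + ennreal (\<alpha> * \<beta> / (b * B)) * ennreal (g x powr b) \<partial>M)"
    using young \<alpha> \<beta> A' B' a b
    by (intro nn_integral_mono) (simp add: ennreal_mult'[symmetric] ennreal_plus[symmetric] del: ennreal_plus)
  also have "\<dots> = ennreal (\<alpha> * \<beta> / (a * A)) * (\<integral>\<^sup>+ x. ennreal (f x powr a) \<partial>M)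
             + ennreal (\<alpha> * \<beta> / (b * B)) * (\<integral>\<^sup>+ x. ennreal (g x powr b) \<partial>M)"
    by (subst nn_integral_add) (auto simp: nn_integral_cmult)
  also have "\<dots> \<le> ennreal (\<alpha> * \<beta> / (a * A)) * ennreal A + ennreal (\<alpha> * \<beta> / (b * B)) * ennreal B"
    by (intro add_mono mult_left_mono fA gB) auto
  also have "\<dots> = ennreal (\<alpha> * \<beta> / (a * A) * A + \<alpha> * \<beta> / (b * B) * B)"
    using \<alpha> \<beta> A' B' a b by (simp add: ennreal_mult'[symmetric] ennreal_plus[symmetric] del: ennreal_plus)
  also have "\<alpha> * \<beta> / (a * A) * A + \<alpha> * \<beta> / (b * B) * B = \<alpha> * \<beta> * (1 / a + 1 / b)"
    using A' B' a b by (simp add: field_simps)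
  finally show ?thesis using ab by (simp add: \<alpha>_def \<beta>_def)
qed

lemma nn_integral_Holder_finite:
  fixes f :: "'a \<Rightarrow> real"
  assumes [measurable]: "f \<in> borel_measurable M"
    and f0: "\<And>x. 0 \<le> f x"
    and a: "a \<ge> 1" and A: "A \<ge> 0" and B: "B \<ge> 0"
    and fA: "(\<integral>\<^sup>+ x. ennreal (f x powr a) \<partial>M) \<le> ennreal A"
    and MB: "emeasure M (space M) \<le> ennreal B"
  shows "(\<integral>\<^sup>+ x. ennreal (f x) \<partial>M) \<le> ennreal (A powr (1/a) * B powr (1 - 1/a))"
proof (cases "a = 1")
  case True
  \<comment> \<open>For \<open>a = 1\<close> the second factor is \<open>B powr 0\<close>, whose
    value at \<open>B = 0\<close> is 0 and not 1. The measure is then null, so the left side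
    vanishes too.\<close>
  show ?thesis
  proof (cases "B = 0")
    case True
    then have "emeasure M (space M) = 0" using MB by simp
    then have "M = M \<and> (\<integral>\<^sup>+ x. ennreal (f x) \<partial>M) = 0"
      by (subst nn_integral_0_iff_AE) (auto intro!: AE_I[where N="space M"])
    then show ?thesis by simp
  next
    case False
    then show ?thesis using fA \<open>a = 1\<close> f0 A by simp
  qed
next
  case False
  with a have a1: "a > 1" by simp
  define b where "b = a / (a - 1)"
  have b: "b > 1" "1/a + 1/b = 1" "1/b = 1 - 1/a" using a1 by (auto simp: b_def field_simps)
  have "(\<integral>\<^sup>+ x. ennreal (f x * 1) \<partial>M) \<le> ennreal (A powr (1/a) * B powr (1/b))"
    using a1 b A B f0 fA MB by (intro nn_integral_Holder) (auto simp: max_def)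
  then show ?thesis using b by simp
qed

section \<open>Power integrals in the radius and Riesz potentials against a weight\<close>

lemma nn_integral_powr_from_0:
  fixes c e :: real
  assumes "e > -1" "c \<ge> 0"
  shows "(\<integral>\<^sup>+ r. ennreal (r powr e) * indicator {0..c} r \<partial>lborel) = ennreal (c powr (e+1) / (e+1))"
  using has_integral_powr_from_0[OF assms] by (intro nn_integral_has_integral_lebesgue') auto

lemma nn_integral_powr_to_inf:
  fixes a e :: real
  assumes "e < -1" "a > 0"
  shows "(\<integral>\<^sup>+ r. ennreal (r powr e) * indicator {a..} r \<partial>lborel) = ennreal (- (a powr (e+1)) / (e+1))"
  using has_integral_powr_to_inf[OF assms] by (intro nn_integral_has_integral_lebesgue') auto

text \<open>After exchanging the integrals, the mass \<open>g y\<close> of \<open>ball y r\<close> becomes a weight in Hoelder's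
  inequality; it is bounded by \<open>G\<close> and has total mass \<open>W\<close> times the volume of a ball.\<close>
lemma potential_slice_bound:
  fixes w :: "real^'n::finite \<Rightarrow> ennreal" and f :: "real^'n \<Rightarrow> real"
  assumes w[measurable]: "w \<in> borel_measurable borel" and f[measurable]: "f \<in> borel_measurable borel"
    and f0: "\<And>x. 0 \<le> f x" and m: "m \<ge> 1" and F: "F \<ge> 0" and G: "G \<ge> 0" and W: "W \<ge> 0" and r: "r > 0"
    and fF: "(\<integral>\<^sup>+ x. ennreal (f x powr m) \<partial>lborel) \<le> ennreal F"
    and wG: "\<And>y. (\<integral>\<^sup>+ x. w x * indicator (ball y r) x \<partial>lborel) \<le> ennreal G"
    and wW: "(\<integral>\<^sup>+ x. w x \<partial>lborel) \<le> ennreal W"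
  shows "(\<integral>\<^sup>+ x. w x * (\<integral>\<^sup>+ y. ennreal (f y) * indicator (ball x r) y \<partial>lborel) \<partial>lborel)
     \<le> ennreal ((G * F) powr (1/m) * (W * (unit_ball_vol (real CARD('n)) * r ^ CARD('n))) powr (1 - 1/m))"
proof -
  \<comment> \<open>Written as a condition on \<open>dist x y\<close>, the indicator of the ball is
    visibly measurable jointly in both variables, as Fubini requires.\<close>
  define I :: "real^'n \<Rightarrow> real^'n \<Rightarrow> ennreal" where "I = (\<lambda>x y. if dist x y < r then 1 else 0 :: ennreal)"
  have I[measurable]: "(\<lambda>(x::real^'n,y). I x y) \<in> borel_measurable (lborel \<Otimes>\<^sub>M lborel)"
    unfolding I_def by measurable
  have Ib: "indicator (ball x r) y = I x y" "indicator (ball y r) x = I x y" for x y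
    by (auto simp: I_def indicator_def dist_commute)
  have Ibint: "integral\<^sup>N lborel (I x) = emeasure lborel (ball x r)" for x
  proof -
    have "I x = indicator (ball x r)" by (auto simp: Ib(1))
    then show ?thesis by simp
  qed
  define g where "g = (\<lambda>y. \<integral>\<^sup>+ x. w x * I x y \<partial>lborel)"
  have g[measurable]: "g \<in> borel_measurable borel"
    unfolding g_def by measurable
  have "(\<integral>\<^sup>+ x. w x * (\<integral>\<^sup>+ y. ennreal (f y) * indicator (ball x r) y \<partial>lborel) \<partial>lborel)
      = (\<integral>\<^sup>+ x. (\<integral>\<^sup>+ y. w x * (ennreal (f y) * I x y) \<partial>lborel) \<partial>lborel)"
    unfolding Ib by (intro nn_integral_cong nn_integral_cmult[symmetric]) measurable
  also have "\<dots> = (\<integral>\<^sup>+ y. (\<integral>\<^sup>+ x. w x * (ennreal (f y) * I x y) \<partial>lborel) \<partial>lborel)"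
    by (rule lborel_pair.Fubini') measurable
  also have "\<dots> = (\<integral>\<^sup>+ y. g y * ennreal (f y) \<partial>lborel)"
    unfolding g_def by (intro nn_integral_cong, subst nn_integral_multc[symmetric]) (auto simp: mult_ac)
  also have "\<dots> = (\<integral>\<^sup>+ y. ennreal (f y) \<partial>density lborel g)"
    by (subst nn_integral_density) auto
  also have "\<dots> \<le> ennreal ((G * F) powr (1/m) * (W * (unit_ball_vol (real CARD('n)) * r ^ CARD('n))) powr (1 - 1/m))"
  proof (rule nn_integral_Holder_finite)
    have "(\<integral>\<^sup>+ x. ennreal (f x powr m) \<partial>density lborel g) = (\<integral>\<^sup>+ x. g x * ennreal (f x powr m) \<partial>lborel)"
      by (subst nn_integral_density) auto
    also have "\<dots> \<le> (\<integral>\<^sup>+ x. ennreal G * ennreal (f x powr m) \<partial>lborel)"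
      using wG unfolding g_def Ib(2) by (intro nn_integral_mono mult_right_mono) auto
    also have "\<dots> = ennreal G * (\<integral>\<^sup>+ x. ennreal (f x powr m) \<partial>lborel)"
      by (intro nn_integral_cmult) auto
    also have "\<dots> \<le> ennreal (G * F)"
      using fF G by (auto simp: ennreal_mult' intro: mult_left_mono)
    finally show "(\<integral>\<^sup>+ x. ennreal (f x powr m) \<partial>density lborel g) \<le> ennreal (G * F)" .
    have "emeasure (density lborel g) (space (density lborel g)) = (\<integral>\<^sup>+ y. g y \<partial>lborel)"
      by (subst emeasure_density) auto
    also have "\<dots> = (\<integral>\<^sup>+ x. (\<integral>\<^sup>+ y. w x * I x y \<partial>lborel) \<partial>lborel)"
      unfolding g_def by (rule lborel_pair.Fubini') measurable
    also have "\<dots> = (\<integral>\<^sup>+ x. w x * emeasure lborel (ball x r) \<partial>lborel)"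
      by (intro nn_integral_cong, subst nn_integral_cmult) (auto simp: Ibint)
    also have "\<dots> = (\<integral>\<^sup>+ x. w x \<partial>lborel) * ennreal (unit_ball_vol (real CARD('n)) * r ^ CARD('n))"
      using r by (simp add: emeasure_ball nn_integral_multc)
    also have "\<dots> \<le> ennreal W * ennreal (unit_ball_vol (real CARD('n)) * r ^ CARD('n))"
      by (intro mult_right_mono wW) auto
    finally show "emeasure (density lborel g) (space (density lborel g))
        \<le> ennreal (W * (unit_ball_vol (real CARD('n)) * r ^ CARD('n)))"
      using W by (simp add: ennreal_mult')
  qed (use m F G W r f0 in auto)
  finally show ?thesis .
qed

text \<open>Adams' estimate: the radii are split at \<open>R = W powr (1/\<beta>)\<close>, where the growth bound
  \<open>C * r powr \<beta>\<close> meets the trivial bound \<open>W\<close>.\<close>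
lemma potential_bound:
  fixes w :: "real^'n::finite \<Rightarrow> ennreal" and f :: "real^'n \<Rightarrow> real" and C m \<beta> W F :: real
  defines "n \<equiv> real CARD('n)"
  defines "K \<equiv> unit_ball_vol n powr (1 - 1/m) * (C powr (1/m) / ((\<beta> - n) / m + 1) + 1 / (n/m - 1))"
  assumes w[measurable]: "w \<in> borel_measurable borel" and f[measurable]: "f \<in> borel_measurable borel"
    and f0: "\<And>x. 0 \<le> f x" and m: "m \<ge> 1" "m < n" and \<beta>: "\<beta> > n - m" and F: "F \<ge> 0" and C: "C \<ge> 0" and W: "W > 0"
    and fF: "(\<integral>\<^sup>+ x. ennreal (f x powr m) \<partial>lborel) \<le> ennreal F"
    and growth: "\<And>y r. r > 0 \<Longrightarrow> (\<integral>\<^sup>+ x. w x * indicator (ball y r) x \<partial>lborel) \<le> ennreal (C * r powr \<beta>)"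
    and wW: "(\<integral>\<^sup>+ x. w x \<partial>lborel) \<le> ennreal W"
  shows "(\<integral>\<^sup>+ r. ennreal (r powr (-n)) * indicator {0<..} r *
            (\<integral>\<^sup>+ x. w x * (\<integral>\<^sup>+ y. ennreal (f y) * indicator (ball x r) y \<partial>lborel) \<partial>lborel) \<partial>lborel)
     \<le> ennreal (K * F powr (1/m) * W powr (1 - (n - m) / (m * \<beta>)))"
proof -
  define V where "V = unit_ball_vol n"
  have V: "V > 0" unfolding V_def n_def by (rule unit_ball_vol_pos) simp
  define R where "R = W powr (1/\<beta>)"
  have b0: "\<beta> > 0" using \<beta> m by simp
  have R: "R > 0" using W by (simp add: R_def)
  define D where "D = F powr (1/m) * (W * V) powr (1 - 1/m)"
  have D: "D \<ge> 0" by (simp add: D_def)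
  define J where "J = (\<lambda>r::real. \<integral>\<^sup>+ x. w x * (\<integral>\<^sup>+ y. ennreal (f y) * indicator (ball x r) y \<partial>lborel) \<partial>lborel)"
  have wbW: "(\<integral>\<^sup>+ x. w x * indicator (ball y r) x \<partial>lborel) \<le> ennreal W" for y r
    by (rule order_trans[OF nn_integral_mono wW]) (auto simp: indicator_def)
  have Jr: "J r \<le> ennreal ((G * F) powr (1/m) * (W * (V * r ^ CARD('n))) powr (1 - 1/m))"
    if r: "r > 0" and G: "G \<ge> 0" "\<And>y. (\<integral>\<^sup>+ x. w x * indicator (ball y r) x \<partial>lborel) \<le> ennreal G" for r G
    unfolding J_def V_def n_def using m F W r fF wW f0
    by (intro potential_slice_bound G w f) auto
  \<comment> \<open>Holder keeps the power \<open>1 - 1/m\<close> of the volume, so the kernel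
    \<open>r powr (-n)\<close> is reduced to \<open>r powr (- n / m)\<close>. The identity is kept
    general in the mass bound \<open>G\<close>, which is \<open>C * r powr \<beta>\<close> for small
    radii and \<open>W\<close> for large ones.\<close>
  have eq: "r powr (-n) * ((G * F) powr (1/m) * (W * (V * r ^ CARD('n))) powr (1 - 1/m))
      = D * (G powr (1/m) * r powr (- n / m))" if r: "r > 0" and G: "G \<ge> 0" for r G
  proof -
    have "r ^ CARD('n) = r powr n" using r by (simp add: n_def powr_realpow)
    then have "(W * (V * r ^ CARD('n))) powr (1 - 1/m) = (W * V) powr (1 - 1/m) * r powr (n * (1 - 1/m))"
      using W V r by (simp add: powr_mult powr_powr)
    moreover have "r powr (-n) * r powr (n * (1 - 1/m)) = r powr (- n / m)"
      by (simp add: powr_add[symmetric] algebra_simps)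
    ultimately show ?thesis
      using F G V W by (simp add: D_def powr_mult mult_ac)
  qed
  have pw: "ennreal (r powr (-n)) * indicator {0<..} r * J r \<le>
      ennreal (D * C powr (1/m)) * (ennreal (r powr ((\<beta> - n)/m)) * indicator {0..R} r)
      + ennreal (D * W powr (1/m)) * (ennreal (r powr (- n/m)) * indicator {R..} r)" for r
  proof (cases "r > 0")
    case False
    then show ?thesis by simp
  next
    case r: True
    show ?thesis
    proof (cases "r \<le> R")
      case True
      have "ennreal (r powr (-n)) * J r \<le> ennreal (r powr (-n)) * ennreal (((C * r powr \<beta>) * F) powr (1/m) * (W * (V * r ^ CARD('n))) powr (1 - 1/m))"
        using C r by (intro mult_left_mono Jr growth) auto
      also have "\<dots> = ennreal (D * ((C * r powr \<beta>) powr (1/m) * r powr (- n / m)))"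
        using r C by (subst ennreal_mult'[symmetric]) (auto simp: eq)
      also have "(C * r powr \<beta>) powr (1/m) * r powr (- n / m) = C powr (1/m) * r powr ((\<beta> - n) / m)"
        using C r by (simp add: powr_mult powr_powr powr_add[symmetric] diff_divide_distrib)
      finally show ?thesis
        using True r D by (auto simp: ennreal_mult' mult_ac intro: order_trans)
    next
      case False
      have "ennreal (r powr (-n)) * J r \<le> ennreal (r powr (-n)) * ennreal ((W * F) powr (1/m) * (W * (V * r ^ CARD('n))) powr (1 - 1/m))"
        using W r by (intro mult_left_mono Jr wbW) auto
      also have "\<dots> = ennreal (D * (W powr (1/m) * r powr (- n / m)))"
        using r W by (subst ennreal_mult'[symmetric]) (auto simp: eq)
      finally show ?thesis
        using False r D by (auto simp: ennreal_mult' mult_ac intro: order_trans)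
    qed
  qed
  have "(\<integral>\<^sup>+ r. ennreal (r powr (-n)) * indicator {0<..} r * J r \<partial>lborel)
     \<le> (\<integral>\<^sup>+ r. ennreal (D * C powr (1/m)) * (ennreal (r powr ((\<beta> - n)/m)) * indicator {0..R} r)
      + ennreal (D * W powr (1/m)) * (ennreal (r powr (- n/m)) * indicator {R..} r) \<partial>lborel)"
    by (intro nn_integral_mono pw)
  also have "\<dots> = ennreal (D * C powr (1/m)) * (\<integral>\<^sup>+ r. ennreal (r powr ((\<beta> - n)/m)) * indicator {0..R} r \<partial>lborel)
      + ennreal (D * W powr (1/m)) * (\<integral>\<^sup>+ r. ennreal (r powr (- n/m)) * indicator {R..} r \<partial>lborel)"
    by (subst nn_integral_add) (auto simp: nn_integral_cmult)
  \<comment> \<open>Integrability at 0 is exactly \<open>\<beta> > n - m\<close>, integrability at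
    infinity exactly \<open>m < n\<close>.\<close>
  also have "(\<integral>\<^sup>+ r. ennreal (r powr ((\<beta> - n)/m)) * indicator {0..R} r \<partial>lborel)
      = ennreal (R powr ((\<beta> - n)/m + 1) / ((\<beta> - n)/m + 1))"
    using \<beta> m R by (intro nn_integral_powr_from_0) (auto simp: field_simps)
  also have "(\<integral>\<^sup>+ r. ennreal (r powr (- n/m)) * indicator {R..} r \<partial>lborel)
      = ennreal (- (R powr (- n/m + 1)) / (- n/m + 1))"
    using m R by (intro nn_integral_powr_to_inf) (auto simp: field_simps)
  also have "ennreal (D * C powr (1/m)) * ennreal (R powr ((\<beta> - n)/m + 1) / ((\<beta> - n)/m + 1))
     + ennreal (D * W powr (1/m)) * ennreal (- (R powr (- n/m + 1)) / (- n/m + 1))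
     = ennreal (D * C powr (1/m) * (R powr ((\<beta> - n)/m + 1) / ((\<beta> - n)/m + 1))
        + D * W powr (1/m) * (- (R powr (- n/m + 1)) / (- n/m + 1)))"
  proof -
    have "0 < (\<beta> - n)/m + 1" "- n/m + 1 < 0" using \<beta> m by (auto simp: field_simps)
    then show ?thesis
      using D by (subst ennreal_plus) (auto simp: ennreal_mult'[symmetric] intro!: divide_nonneg_neg divide_nonpos_neg)
  qed
  also have "D * C powr (1/m) * (R powr ((\<beta> - n)/m + 1) / ((\<beta> - n)/m + 1))
        + D * W powr (1/m) * (- (R powr (- n/m + 1)) / (- n/m + 1))
      = K * F powr (1/m) * W powr (1 - (n - m) / (m * \<beta>))"
  proof -
    \<comment> \<open>Because \<open>R powr \<beta> = W\<close>, both radial integrals produce the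
      same power of \<open>W\<close>. Its defect \<open>1 - e\<close> is the reciprocal of the trace
      exponent \<open>m * \<beta> / (n - m)\<close>.\<close>
    define e where "e = 1 - (n - m) / (m * \<beta>)"
    have "(1 - 1/m) + (1/\<beta>) * ((\<beta> - n)/m + 1) = e" "(1 - 1/m) + 1/m + (1/\<beta>) * (- n/m + 1) = e"
      using b0 m by (auto simp: e_def field_simps)
    then have 1: "W powr (1 - 1/m) * R powr ((\<beta> - n)/m + 1) = W powr e"
        "W powr (1 - 1/m) * W powr (1/m) * R powr (- n/m + 1) = W powr e"
      unfolding R_def powr_powr powr_add[symmetric] by simp_all
    have D': "D = F powr (1/m) * V powr (1 - 1/m) * W powr (1 - 1/m)"
      using W V by (simp add: D_def powr_mult)
    have 2: "- (x::real) / (- n/m + 1) = x / (n/m - 1)" for x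
      by (metis minus_diff_eq minus_divide_left minus_divide_right minus_minus uminus_add_conv_diff)
    have "D * C powr (1/m) * (R powr ((\<beta> - n)/m + 1) / ((\<beta> - n)/m + 1))
        + D * W powr (1/m) * (- (R powr (- n/m + 1)) / (- n/m + 1))
        = F powr (1/m) * V powr (1 - 1/m) * (C powr (1/m) * (W powr (1 - 1/m) * R powr ((\<beta> - n)/m + 1)) / ((\<beta> - n)/m + 1)
           + (W powr (1 - 1/m) * W powr (1/m) * R powr (- n/m + 1)) / (n/m - 1))"
      unfolding D' 2 by (simp add: algebra_simps)
    also have "\<dots> = K * F powr (1/m) * W powr e"
      unfolding 1 K_def V_def by (simp add: algebra_simps)
    finally show ?thesis by (simp add: e_def)
  qed
  finally show ?thesis unfolding J_def .
qed

subsection \<open>The trace inequality for test functions\<close>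

lemma abs_diff_le_nn_integral_deriv:
  fixes h h' :: "real \<Rightarrow> real"
  assumes h: "\<And>r. (h has_real_derivative h' r) (at r)" and h': "continuous_on UNIV h'" and st: "s \<le> t"
  shows "ennreal \<bar>h t - h s\<bar> \<le> (\<integral>\<^sup>+ r. ennreal \<bar>h' r\<bar> * indicator {s..t} r \<partial>lborel)"
proof -
  have c: "continuous_on {s..t} (\<lambda>r. \<bar>h' r\<bar>)"
    by (intro continuous_intros continuous_on_subset[OF h']) auto
  have i: "(h' has_integral (h t - h s)) {s..t}"
    using h st by (intro fundamental_theorem_of_calculus)
      (auto simp: has_real_derivative_iff_has_vector_derivative intro: has_vector_derivative_at_within)
  have "\<bar>h t - h s\<bar> = norm (integral {s..t} h')"
    using i by (simp add: integral_unique)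
  also have "\<dots> \<le> integral {s..t} (\<lambda>r. \<bar>h' r\<bar>)"
    using c i by (intro integral_norm_bound_integral) (auto intro: integrable_continuous_real)
  finally have "ennreal \<bar>h t - h s\<bar> \<le> ennreal (integral {s..t} (\<lambda>r. \<bar>h' r\<bar>))"
    by (rule ennreal_leI)
  also have "\<dots> = (\<integral>\<^sup>+ r. ennreal \<bar>h' r\<bar> * indicator {s..t} r \<partial>lborel)"
    using c by (intro nn_integral_has_integral_lebesgue'[symmetric] integrable_integral integrable_continuous_real) auto
  finally show ?thesis .
qed

text \<open>Let \<open>t\<close> be the first point with \<open>\<bar>h\<bar> \<le> a\<close> and
  \<open>s\<close> the last point before it with \<open>\<bar>h\<bar> \<ge> b\<close>. In between
  the values stay strictly between the levels, so the fundamental theorem of calculus on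
  \<open>{s..t}\<close> sees the derivative only there. This localisation is what makes the later
  summation over dyadic levels possible.\<close>

lemma level_crossing_bound:
  fixes h h' :: "real \<Rightarrow> real"
  assumes h: "\<And>r. (h has_real_derivative h' r) (at r)" and h': "continuous_on UNIV h'"
    and ab: "a < b" and h0: "\<bar>h 0\<bar> \<ge> b" and R: "R \<ge> 0" "\<bar>h R\<bar> \<le> a"
  shows "ennreal (b - a) \<le> (\<integral>\<^sup>+ r. ennreal (\<bar>h' r\<bar> * indicator {r. a < \<bar>h r\<bar> \<and> \<bar>h r\<bar> < b} r) * indicator {0<..} r \<partial>lborel)"
proof -
  have hc: "continuous_on UNIV h"
    using h by (auto simp: continuous_on_eq_continuous_at intro: DERIV_isCont)
  have hS: "continuous_on S h" for S using hc by (rule continuous_on_subset) simp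
  define S1 where "S1 = {r\<in>{0..R}. \<bar>h r\<bar> \<le> a}"
  have "compact S1"
  proof -
    have "closed {r. \<bar>h r\<bar> \<le> a}" by (intro closed_Collect_le continuous_intros hS)
    then have "compact ({0..R} \<inter> {r. \<bar>h r\<bar> \<le> a})" by (intro compact_Int_closed) auto
    then show ?thesis by (simp add: S1_def Int_def)
  qed
  moreover have "R \<in> S1" using R by (auto simp: S1_def)
  ultimately obtain t where t: "t \<in> S1" "\<And>r. r \<in> S1 \<Longrightarrow> t \<le> r"
    using compact_attains_inf[of S1] by auto
  define S0 where "S0 = {r\<in>{0..t}. \<bar>h r\<bar> \<ge> b}"
  have "compact S0"
  proof -
    have "closed {r. b \<le> \<bar>h r\<bar>}" by (intro closed_Collect_le continuous_intros hS)
    then have "compact ({0..t} \<inter> {r. b \<le> \<bar>h r\<bar>})" by (intro compact_Int_closed) auto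
    then show ?thesis by (simp add: S0_def Int_def)
  qed
  moreover have "0 \<in> S0" using h0 t by (auto simp: S0_def S1_def)
  ultimately obtain s where s: "s \<in> S0" "\<And>r. r \<in> S0 \<Longrightarrow> r \<le> s"
    using compact_attains_sup[of S0] by auto
  have st: "0 \<le> s" "s \<le> t" "t \<le> R" "b \<le> \<bar>h s\<bar>" "\<bar>h t\<bar> \<le> a"
    using s t by (auto simp: S0_def S1_def)
  have mid: "a < \<bar>h r\<bar> \<and> \<bar>h r\<bar> < b" if "s < r" "r < t" for r
    using that s(2)[of r] t(2)[of r] st by (force simp: S0_def S1_def)
  have "ennreal (b - a) \<le> ennreal \<bar>h t - h s\<bar>"
    using st by (intro ennreal_leI) linarith
  also have "\<dots> \<le> (\<integral>\<^sup>+ r. ennreal \<bar>h' r\<bar> * indicator {s..t} r \<partial>lborel)"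
    by (rule abs_diff_le_nn_integral_deriv[OF h h' st(2)])
  also have "\<dots> \<le> (\<integral>\<^sup>+ r. ennreal (\<bar>h' r\<bar> * indicator {r. a < \<bar>h r\<bar> \<and> \<bar>h r\<bar> < b} r) * indicator {0<..} r \<partial>lborel)"
  proof (rule nn_integral_mono_AE)
    have "AE r in lborel. r \<noteq> s" "AE r in lborel. r \<noteq> t"
      by (rule AE_lborel_singleton)+
    then show "AE r in lborel. ennreal \<bar>h' r\<bar> * indicator {s..t} r
        \<le> ennreal (\<bar>h' r\<bar> * indicator {r. a < \<bar>h r\<bar> \<and> \<bar>h r\<bar> < b} r) * indicator {0<..} r"
    proof eventually_elim
      case (elim r)
      then show ?case using mid[of r] st by (auto simp: indicator_def)
    qed
  qed
  finally show ?thesis .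
qed

text \<open>All that the potential estimates use of a test function, without reference to a domain.
  The derivative is written through \<open>grad\<close>, ready for the chain rule along
  lines.\<close>

definition C1c :: "(real^'n::finite \<Rightarrow> real) \<Rightarrow> bool" where
  "C1c v \<longleftrightarrow> (\<forall>x. (v has_derivative (\<lambda>h. grad v x \<bullet> h)) (at x)) \<and> continuous_on UNIV (grad v) \<and>
     compact (tsupport v)"

lemma has_derivative_grad:
  fixes g :: "real^'n::finite \<Rightarrow> real"
  assumes "g differentiable (at x)"
  shows "(g has_derivative (\<lambda>h. grad g x \<bullet> h)) (at x)"
proof -
  let ?D = "frechet_derivative g (at x)"
  have D: "(g has_derivative ?D) (at x)" using assms by (simp add: frechet_derivative_works)
  then have l: "linear ?D" by (rule has_derivative_linear)
  have "?D h = grad g x \<bullet> h" for h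
  proof -
    have "?D h = ?D (\<Sum>i\<in>UNIV. h $ i *\<^sub>R axis i 1)"
      by (simp add: basis_expansion[of h, simplified scalar_mult_eq_scaleR])
    also have "\<dots> = (\<Sum>i\<in>UNIV. h $ i * ?D (axis i 1))"
      using l by (simp add: linear_sum linear_scale)
    finally show ?thesis by (simp add: inner_vec_def grad_def pd_def mult.commute)
  qed
  then have "?D = (\<lambda>h. grad g x \<bullet> h)" by auto
  with D show ?thesis by simp
qed

lemma grad_unique:
  fixes g :: "real^'n::finite \<Rightarrow> real"
  assumes "(g has_derivative (\<lambda>h. y \<bullet> h)) (at x)"
  shows "grad g x = y"
proof -
  have "frechet_derivative g (at x) = (\<lambda>h. y \<bullet> h)"
    using frechet_derivative_at[OF assms] by simp
  then show ?thesis by (simp add: grad_def pd_def vec_eq_iff inner_axis)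
qed

lemma C1cI:
  assumes "g differentiable_on UNIV" "\<And>i. continuous_on UNIV (pd i g)" "compact (tsupport g)"
  shows "C1c g"
proof -
  have "continuous_on UNIV (grad g)"
    using assms(2) unfolding grad_def by (intro continuous_on_vec_lambda) auto
  then show ?thesis
    using assms unfolding C1c_def by (auto simp: differentiable_on_def intro!: has_derivative_grad)
qed

lemma test_fun_C1c: "test_fun D g \<Longrightarrow> C1c g"
proof -
  assume g: "test_fun D g"
  then have "Ck (Suc 0) g" by (auto simp: test_fun_def)
  then show ?thesis using g by (intro C1cI) (auto simp: test_fun_def)
qed

lemma eq_0_outside_tsupport: "x \<notin> tsupport g \<Longrightarrow> g x = 0"
  using closure_subset[of "{x. g x \<noteq> 0}"] by (auto simp: tsupport_def)

lemma grad_eq_0_outside_tsupport: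
  assumes "x \<notin> tsupport g"
  shows "grad g x = 0"
proof (rule grad_unique)
  have "open (- tsupport g)" by (simp add: tsupport_def open_Compl)
  moreover have "((\<lambda>_. 0) has_derivative (\<lambda>h. 0 \<bullet> h)) (at x)" by simp
  ultimately show "(g has_derivative (\<lambda>h. 0 \<bullet> h)) (at x)"
    using assms by (elim has_derivative_transform_within_open) (auto simp: eq_0_outside_tsupport)
qed

lemma C1c_measurable:
  assumes "C1c v"
  shows "v \<in> borel_measurable borel" "grad v \<in> borel_measurable borel" "continuous_on UNIV v"
proof -
  show c: "continuous_on UNIV v"
    using assms by (auto simp: C1c_def continuous_on_eq_continuous_at intro: has_derivative_continuous)
  show "v \<in> borel_measurable borel" "grad v \<in> borel_measurable borel"
    using c assms by (auto simp: C1c_def intro: borel_measurable_continuous_onI)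
qed

text \<open>Substitution \<open>y = x + r *\<^sub>R z\<close>. Its Jacobian is the origin of the
  kernel \<open>r powr (-n)\<close> in the radial integrals.\<close>

lemma nn_integral_lborel_scale_ball:
  fixes f :: "real^'n::finite \<Rightarrow> ennreal"
  assumes [measurable]: "f \<in> borel_measurable borel" and r: "r > 0"
  shows "(\<integral>\<^sup>+ z. f (x + r *\<^sub>R z) * indicator (ball 0 1) z \<partial>lborel)
     = ennreal (r powr (- real CARD('n))) * (\<integral>\<^sup>+ y. f y * indicator (ball x r) y \<partial>lborel)"
proof -
  have ib: "indicator (ball x r) (x + r *\<^sub>R z) = (indicator (ball 0 1) z :: ennreal)" for z
    using r by (auto simp: indicator_def dist_norm)
  have "(\<integral>\<^sup>+ y. f y * indicator (ball x r) y \<partial>lborel)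
     = (\<integral>\<^sup>+ y. f y * indicator (ball x r) y \<partial>density (distr lborel borel (\<lambda>z. x + r *\<^sub>R z)) (\<lambda>_. ennreal (\<bar>r\<bar> ^ DIM(real^'n))))"
    using r by (subst lborel_affine[of r x]) auto
  also have "\<dots> = ennreal (r powr real CARD('n)) * (\<integral>\<^sup>+ z. f (x + r *\<^sub>R z) * indicator (ball 0 1) z \<partial>lborel)"
  proof -
    have [measurable]: "(\<lambda>y. f y * indicator (ball x r) y) \<in> borel_measurable borel"
      by (intro borel_measurable_times_ennreal borel_measurable_indicator assms(1)) simp
    have [measurable]: "(\<lambda>z. x + r *\<^sub>R z) \<in> borel \<rightarrow>\<^sub>M borel" by measurable
    show ?thesis
      using r by (simp add: nn_integral_density nn_integral_distr nn_integral_cmult ib powr_realpow)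
  qed
  also have "ennreal (r powr (- real CARD('n))) * \<dots> = (\<integral>\<^sup>+ z. f (x + r *\<^sub>R z) * indicator (ball 0 1) z \<partial>lborel)"
    using r by (simp add: mult.assoc[symmetric] ennreal_mult'[symmetric] powr_add[symmetric])
  finally show ?thesis by simp
qed

text \<open>Averaging the one-dimensional estimate along the rays \<open>x + r *\<^sub>R z\<close> over \<open>z\<close> in the unit ball
  produces the Riesz potential without polar coordinates.\<close>
lemma C1c_potential_estimate:
  fixes v :: "real^'n::finite \<Rightarrow> real"
  defines "n \<equiv> real CARD('n)"
  assumes v: "C1c v" and ab: "0 < a" "a < b" and vx: "\<bar>v x\<bar> \<ge> b"
  shows "ennreal ((b - a) * unit_ball_vol n) \<le> (\<integral>\<^sup>+ r. ennreal (r powr (-n)) * indicator {0<..} r *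
            (\<integral>\<^sup>+ y. ennreal (norm (grad v y) * indicator {y. a < \<bar>v y\<bar> \<and> \<bar>v y\<bar> < b} y) * indicator (ball x r) y \<partial>lborel) \<partial>lborel)"
proof -
  note [measurable] = C1c_measurable(1,2)[OF v]
  have [measurable]: "ball (0::real^'n) 1 \<in> sets borel" by simp
  define f where "f = (\<lambda>y. norm (grad v y) * indicator {y. a < \<bar>v y\<bar> \<and> \<bar>v y\<bar> < b} y :: real)"
  have [measurable]: "f \<in> borel_measurable borel" unfolding f_def by measurable
  have f0: "f y \<ge> 0" for y by (simp add: f_def)
  obtain B where B: "B > 0" "\<And>y. norm y \<ge> B \<Longrightarrow> v y = 0"
  proof -
    have "bounded (tsupport v)" using v by (auto simp: C1c_def intro: compact_imp_bounded)
    then obtain B where "B > 0" "\<And>y. y \<in> tsupport v \<Longrightarrow> norm y \<le> B" by (auto simp: bounded_pos)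
    then show ?thesis by (intro that[of "B + 1"]) (auto intro!: eq_0_outside_tsupport simp: not_le[symmetric] , force)
  qed
  \<comment> \<open>At the parameter \<open>(B + norm x) / norm z\<close> the ray has left the
    support, which excludes only the null set of \<open>z = 0\<close>. The bound
    \<open>norm z < 1\<close> estimates the derivative along the ray by the norm of the
    gradient.\<close>
  have line: "ennreal (b - a) \<le> (\<integral>\<^sup>+ r. ennreal (f (x + r *\<^sub>R z)) * indicator {0<..} r \<partial>lborel)"
    if z: "z \<noteq> 0" "norm z < 1" for z
  proof -
    define h where "h = (\<lambda>r. v (x + r *\<^sub>R z))"
    define h' where "h' = (\<lambda>r. grad v (x + r *\<^sub>R z) \<bullet> z)"
    have "(h has_real_derivative h' r) (at r)" for r
    proof -
      have "(v has_derivative (\<lambda>h. grad v (x + r *\<^sub>R z) \<bullet> h)) (at (x + r *\<^sub>R z))"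
        using v by (auto simp: C1c_def)
      then have "(h has_derivative (\<lambda>t. grad v (x + r *\<^sub>R z) \<bullet> (t *\<^sub>R z))) (at r)"
        unfolding h_def by (rule has_derivative_compose[rotated]) (auto intro!: derivative_eq_intros)
      then show ?thesis by (simp add: has_field_derivative_def h'_def mult_commute_abs)
    qed
    moreover have "continuous_on UNIV h'"
    proof -
      have gc: "continuous_on UNIV (grad v)" using v by (auto simp: C1c_def)
      have "continuous_on UNIV (\<lambda>r. grad v (x + r *\<^sub>R z))"
        by (rule continuous_on_compose2[OF gc]) (auto intro!: continuous_intros)
      then show ?thesis unfolding h'_def by (intro continuous_on_inner continuous_on_const)
    qed
    moreover have "\<bar>h ((B + norm x) / norm z)\<bar> \<le> a"
    proof -
      have "norm (((B + norm x) / norm z) *\<^sub>R z) = B + norm x" using z B by simp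
      then have "norm (x + ((B + norm x) / norm z) *\<^sub>R z) \<ge> B"
        by (smt (verit) norm_triangle_ineq2 norm_minus_cancel diff_minus_eq_add add.commute)
      then show ?thesis using B ab by (simp add: h_def)
    qed
    moreover have "(B + norm x) / norm z \<ge> 0" using B by simp
    ultimately have "ennreal (b - a) \<le> (\<integral>\<^sup>+ r. ennreal (\<bar>h' r\<bar> * indicator {r. a < \<bar>h r\<bar> \<and> \<bar>h r\<bar> < b} r) * indicator {0<..} r \<partial>lborel)"
      using ab vx by (intro level_crossing_bound) (auto simp: h_def)
    also have "\<dots> \<le> (\<integral>\<^sup>+ r. ennreal (f (x + r *\<^sub>R z)) * indicator {0<..} r \<partial>lborel)"
    proof (intro nn_integral_mono mult_right_mono ennreal_leI)
      fix r
      have "\<bar>h' r\<bar> \<le> norm (grad v (x + r *\<^sub>R z)) * norm z"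
        unfolding h'_def by (rule Cauchy_Schwarz_ineq2)
      also have "\<dots> \<le> norm (grad v (x + r *\<^sub>R z)) * 1" using z by (intro mult_left_mono) auto
      finally show "\<bar>h' r\<bar> * indicator {r. a < \<bar>h r\<bar> \<and> \<bar>h r\<bar> < b} r \<le> f (x + r *\<^sub>R z)"
        by (auto simp: f_def h_def indicator_def)
    qed auto
    finally show ?thesis .
  qed
  have "ennreal ((b - a) * unit_ball_vol n) = (\<integral>\<^sup>+ z. ennreal (b - a) * indicator (ball (0::real^'n) 1) z \<partial>lborel)"
    using ab by (subst nn_integral_cmult_indicator) (auto simp: emeasure_ball n_def ennreal_mult')
  also have "\<dots> \<le> (\<integral>\<^sup>+ z. (\<integral>\<^sup>+ r. ennreal (f (x + r *\<^sub>R z)) * indicator {0<..} r \<partial>lborel) * indicator (ball 0 1) z \<partial>lborel)"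
  proof (rule nn_integral_mono_AE)
    show "AE z in lborel. ennreal (b - a) * indicator (ball 0 1) z
       \<le> (\<integral>\<^sup>+ r. ennreal (f (x + r *\<^sub>R z)) * indicator {0<..} r \<partial>lborel) * indicator (ball 0 1) z"
      using AE_lborel_singleton[of 0] by eventually_elim (use line in \<open>auto simp: indicator_def\<close>)
  qed
  also have "\<dots> = (\<integral>\<^sup>+ z. (\<integral>\<^sup>+ r. ennreal (f (x + r *\<^sub>R z)) * indicator {0<..} r * indicator (ball 0 1) z \<partial>lborel) \<partial>lborel)"
    by (intro nn_integral_cong nn_integral_multc[symmetric]) measurable
  also have "\<dots> = (\<integral>\<^sup>+ r. (\<integral>\<^sup>+ z. ennreal (f (x + r *\<^sub>R z)) * indicator {0<..} r * indicator (ball 0 1) z \<partial>lborel) \<partial>lborel)"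
    by (rule lborel_pair.Fubini') measurable
  also have "\<dots> = (\<integral>\<^sup>+ r. ennreal (r powr (-n)) * indicator {0<..} r *
            (\<integral>\<^sup>+ y. ennreal (f y) * indicator (ball x r) y \<partial>lborel) \<partial>lborel)"
  proof (rule nn_integral_cong)
    fix r :: real
    show "(\<integral>\<^sup>+ z. ennreal (f (x + r *\<^sub>R z)) * indicator {0<..} r * indicator (ball 0 1) z \<partial>lborel)
      = ennreal (r powr (-n)) * indicator {0<..} r * (\<integral>\<^sup>+ y. ennreal (f y) * indicator (ball x r) y \<partial>lborel)"
      using nn_integral_lborel_scale_ball[of "\<lambda>y. ennreal (f y)" r x]
      by (cases "r > 0") (auto simp: n_def)
  qed
  finally show ?thesis unfolding f_def .
qed

text \<open>The constant \<open>K\<close> of \<open>potential_bound\<close> divided by the volume of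
  the unit ball, the factor that averaging over the rays puts on the other side.\<close>

definition trace_const :: "real \<Rightarrow> real \<Rightarrow> real \<Rightarrow> real \<Rightarrow> real" where
  "trace_const n m \<beta> C = unit_ball_vol n powr (1 - 1/m) *
     (C powr (1/m) / ((\<beta> - n) / m + 1) + 1 / (n/m - 1)) / unit_ball_vol n"

lemma trace_const_nonneg:
  assumes "n \<ge> 0" "m \<ge> 1" "m < n" "\<beta> > n - m"
  shows "trace_const n m \<beta> C \<ge> 0"
proof -
  have "(\<beta> - n) / m + 1 > 0" "n / m - 1 > 0" using assms by (auto simp: field_simps)
  then have "C powr (1/m) / ((\<beta> - n) / m + 1) + 1 / (n/m - 1) \<ge> 0"
    using add_nonneg_nonneg[OF divide_nonneg_pos[OF powr_ge_zero] divide_nonneg_pos[OF zero_le_one]] by blast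
  from divide_nonneg_nonneg[OF mult_nonneg_nonneg[OF powr_ge_zero this] unit_ball_vol_nonneg[OF assms(1)]]
  show ?thesis unfolding trace_const_def .
qed

text \<open>The pointwise potential estimate is integrated against \<open>w\<close> over the
  superlevel set. If \<open>W\<close> is the weighted mass of that set,
  \<open>potential_bound\<close> yields \<open>(b - a) * W\<close> at most
  \<open>trace_const n m \<beta> C * F powr (1/m) * W powr (1 - 1/s)\<close>, and the power of
  \<open>W\<close> is divided out. The potential bound is applied to \<open>w\<close> cut off to the
  superlevel set, which inherits the growth bound.\<close>

lemma C1c_weak_type:
  fixes v :: "real^'n::finite \<Rightarrow> real" and w :: "real^'n \<Rightarrow> ennreal"
  defines "n \<equiv> real CARD('n)"
  assumes v: "C1c v" and ab: "0 < a" "a < b" and w[measurable]: "w \<in> borel_measurable borel"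
    and m: "1 \<le> m" "m < n" and \<beta>: "\<beta> > n - m" and C: "C \<ge> 0" and F: "F \<ge> 0"
    and s: "s = m * \<beta> / (n - m)"
    and growth: "\<And>y r. r > 0 \<Longrightarrow> (\<integral>\<^sup>+ x. w x * indicator (ball y r) x \<partial>lborel) \<le> ennreal (C * r powr \<beta>)"
    and vF: "(\<integral>\<^sup>+ x. ennreal ((norm (grad v x) * indicator {y. a < \<bar>v y\<bar> \<and> \<bar>v y\<bar> < b} x) powr m) \<partial>lborel) \<le> ennreal F"
  shows "(\<integral>\<^sup>+ x. w x * indicator {x. b \<le> \<bar>v x\<bar>} x \<partial>lborel)
      \<le> ennreal ((trace_const n m \<beta> C * F powr (1/m) / (b - a)) powr s)"
proof -
  note [measurable] = C1c_measurable(1,2)[OF v]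
  define V where "V = unit_ball_vol n"
  have V: "V > 0" unfolding V_def n_def by (rule unit_ball_vol_pos) simp
  define K where "K = unit_ball_vol n powr (1 - 1/m) * (C powr (1/m) / ((\<beta> - n) / m + 1) + 1 / (n/m - 1))"
  have KV: "trace_const n m \<beta> C = K / V" by (simp add: trace_const_def K_def V_def)
  have b0: "\<beta> > 0" using \<beta> m by simp
  have s0: "s > 0" using s b0 m by simp
  define f where "f = (\<lambda>y. norm (grad v y) * indicator {y. a < \<bar>v y\<bar> \<and> \<bar>v y\<bar> < b} y :: real)"
  have f[measurable]: "f \<in> borel_measurable borel" unfolding f_def by measurable
  define wE where "wE = (\<lambda>x. w x * indicator {x. b \<le> \<bar>v x\<bar>} x)"
  have wE[measurable]: "wE \<in> borel_measurable borel" unfolding wE_def by measurable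
  have wE_le: "wE x \<le> w x" for x by (auto simp: wE_def indicator_def)
  have growthE: "(\<integral>\<^sup>+ x. wE x * indicator (ball y r) x \<partial>lborel) \<le> ennreal (C * r powr \<beta>)" if "r > 0" for y r
    by (rule order_trans[OF nn_integral_mono growth[OF that]]) (auto intro: mult_right_mono wE_le)
  \<comment> \<open>Compact support confines the superlevel set to a ball, so the growth bound makes
    its weighted mass finite; the division by a power of \<open>W\<close> depends on that.\<close>
  obtain B where B: "B > 0" "\<And>y. norm y \<ge> B \<Longrightarrow> v y = 0"
  proof -
    have "bounded (tsupport v)" using v by (auto simp: C1c_def intro: compact_imp_bounded)
    then obtain B where "B > 0" "\<And>y. y \<in> tsupport v \<Longrightarrow> norm y \<le> B" by (auto simp: bounded_pos)
    then show ?thesis by (intro that[of "B + 1"]) (auto intro!: eq_0_outside_tsupport simp: not_le[symmetric] , force)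
  qed
  have "integral\<^sup>N lborel wE \<le> ennreal (C * B powr \<beta>)"
  proof -
    have "integral\<^sup>N lborel wE \<le> (\<integral>\<^sup>+ x. wE x * indicator (ball 0 B) x \<partial>lborel)"
      using ab B(2) by (intro nn_integral_mono) (fastforce simp: wE_def indicator_def not_less)
    also have "\<dots> \<le> ennreal (C * B powr \<beta>)" by (rule growthE[OF B(1)])
    finally show ?thesis .
  qed
  then obtain W where W: "W \<ge> 0" "integral\<^sup>N lborel wE = ennreal W"
    by (metis ennreal_cases neq_top_trans ennreal_neq_top)
  have "W \<le> (trace_const n m \<beta> C * F powr (1/m) / (b - a)) powr s"
  proof (cases "W = 0")
    case False
    with W have W0: "W > 0" by simp
    have Ib: "indicator (ball x r) y = (if dist x y < r then 1 else 0 :: ennreal)" for x y :: "real^'n" and r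
      by (auto simp: indicator_def)
    have "ennreal ((b - a) * V * W) = (\<integral>\<^sup>+ x. wE x * ennreal ((b - a) * V) \<partial>lborel)"
      using ab V W by (simp add: nn_integral_multc W(2) ennreal_mult'[symmetric] mult.commute)
    also have "\<dots> \<le> (\<integral>\<^sup>+ x. wE x * (\<integral>\<^sup>+ r. ennreal (r powr (-n)) * indicator {0<..} r *
            (\<integral>\<^sup>+ y. ennreal (f y) * indicator (ball x r) y \<partial>lborel) \<partial>lborel) \<partial>lborel)"
    proof (intro nn_integral_mono)
      fix x show "wE x * ennreal ((b - a) * V) \<le> wE x * (\<integral>\<^sup>+ r. ennreal (r powr (-n)) * indicator {0<..} r *
            (\<integral>\<^sup>+ y. ennreal (f y) * indicator (ball x r) y \<partial>lborel) \<partial>lborel)"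
        using C1c_potential_estimate[OF v ab, of x]
        by (cases "b \<le> \<bar>v x\<bar>") (auto simp: wE_def V_def n_def f_def intro!: mult_left_mono)
    qed
    also have "\<dots> = (\<integral>\<^sup>+ x. (\<integral>\<^sup>+ r. wE x * (ennreal (r powr (-n)) * indicator {0<..} r *
            (\<integral>\<^sup>+ y. ennreal (f y) * indicator (ball x r) y \<partial>lborel)) \<partial>lborel) \<partial>lborel)"
      unfolding Ib by (intro nn_integral_cong nn_integral_cmult[symmetric]) measurable
    also have "\<dots> = (\<integral>\<^sup>+ r. (\<integral>\<^sup>+ x. wE x * (ennreal (r powr (-n)) * indicator {0<..} r *
            (\<integral>\<^sup>+ y. ennreal (f y) * indicator (ball x r) y \<partial>lborel)) \<partial>lborel) \<partial>lborel)"
      unfolding Ib by (rule lborel_pair.Fubini') measurable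
    also have "\<dots> = (\<integral>\<^sup>+ r. ennreal (r powr (-n)) * indicator {0<..} r *
            (\<integral>\<^sup>+ x. wE x * (\<integral>\<^sup>+ y. ennreal (f y) * indicator (ball x r) y \<partial>lborel) \<partial>lborel) \<partial>lborel)"
      unfolding Ib by (intro nn_integral_cong, subst nn_integral_cmult[symmetric]) (auto simp: mult_ac)
    also have "\<dots> \<le> ennreal (K * F powr (1/m) * W powr (1 - (n - m) / (m * \<beta>)))"
      unfolding K_def n_def
      using m \<beta> F C W0 W(2) vF growthE
      by (intro potential_bound wE f) (auto simp: f_def n_def)
    finally have "ennreal ((b - a) * V * W) \<le> ennreal (K * F powr (1/m) * W powr (1 - (n - m) / (m * \<beta>)))" .
    moreover have "K \<ge> 0" using trace_const_nonneg[of n m \<beta> C] m \<beta> V unfolding KV by (simp add: n_def zero_le_divide_iff)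
    ultimately have "(b - a) * V * W \<le> K * F powr (1/m) * W powr (1 - (n - m) / (m * \<beta>))"
      by (simp add: ennreal_le_iff)
    moreover have "(n - m) / (m * \<beta>) = 1 / s" using s by simp
    moreover have "W = W powr (1 - 1/s) * W powr (1/s)" using W0 by (simp add: powr_add[symmetric])
    ultimately have "W powr (1 - 1/s) * ((b - a) * V * W powr (1/s)) \<le> W powr (1 - 1/s) * (K * F powr (1/m))"
      by (simp add: mult_ac)
    then have "(b - a) * V * W powr (1/s) \<le> K * F powr (1/m)"
      using W0 by (simp add: mult_le_cancel_left_pos)
    then have "W powr (1/s) \<le> K / V * F powr (1/m) / (b - a)"
      using V ab by (simp add: field_simps)
    then have "(W powr (1/s)) powr s \<le> (K / V * F powr (1/m) / (b - a)) powr s"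
      using s0 by (intro powr_mono2) auto
    then show ?thesis using W0 s0 by (simp add: powr_powr KV)
  qed simp
  then show ?thesis using W by (simp add: wE_def ennreal_leI)
qed

lemma C1c_bounded:
  assumes "C1c v"
  obtains L where "L > 0" "\<And>x. \<bar>v x\<bar> < L"
proof -
  have "compact (v ` tsupport v)"
    using assms C1c_measurable(3)[OF assms] by (intro compact_continuous_image) (auto simp: C1c_def intro: continuous_on_subset)
  then obtain L where L: "L > 0" "\<And>x. x \<in> tsupport v \<Longrightarrow> \<bar>v x\<bar> \<le> L"
    by (auto simp: bounded_pos dest!: compact_imp_bounded)
  show ?thesis
  proof (rule that[of "L + 1"])
    show "\<bar>v x\<bar> < L + 1" for x
      using L eq_0_outside_tsupport[of x v] by (cases "x \<in> tsupport v") (auto, force)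
  qed (use L in auto)
qed

lemma le_suminf_ennreal: "f j \<le> (\<Sum>j. f j :: ennreal)"
  using sum_le_suminf[of f "{j}"] by simp

text \<open>Maz'ya's truncation: the weak type estimate only involves the gradient between two levels, so the
  estimates at dyadic levels can be summed; this needs \<open>s > m\<close>.\<close>
lemma C1c_strong_type:
  fixes v :: "real^'n::finite \<Rightarrow> real" and w :: "real^'n \<Rightarrow> ennreal"
  defines "n \<equiv> real CARD('n)"
  assumes v: "C1c v" and w[measurable]: "w \<in> borel_measurable borel"
    and m: "1 \<le> m" "m < n" and \<beta>: "\<beta> > n - m" and C: "C \<ge> 0" and F: "F \<ge> 0"
    and s: "s = m * \<beta> / (n - m)"
    and growth: "\<And>y r. r > 0 \<Longrightarrow> (\<integral>\<^sup>+ x. w x * indicator (ball y r) x \<partial>lborel) \<le> ennreal (C * r powr \<beta>)"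
    and vF: "(\<integral>\<^sup>+ x. ennreal (norm (grad v x) powr m) \<partial>lborel) \<le> ennreal F"
  shows "(\<integral>\<^sup>+ x. w x * ennreal (\<bar>v x\<bar> powr s) \<partial>lborel)
      \<le> ennreal ((4 * trace_const n m \<beta> C) powr s * F powr (s/m))"
proof -
  note [measurable] = C1c_measurable(1,2)[OF v]
  define \<kappa> where "\<kappa> = trace_const n m \<beta> C"
  have \<kappa>: "\<kappa> \<ge> 0" unfolding \<kappa>_def using m \<beta> by (intro trace_const_nonneg) (auto simp: n_def)
  have sm: "s > m" using s \<beta> m by (simp add: pos_less_divide_eq)
  obtain L where L: "L > 0" "\<And>x. \<bar>v x\<bar> < L" using C1c_bounded[OF v] by auto
  \<comment> \<open>Since \<open>L\<close> strictly exceeds \<open>\<bar>v\<bar>\<close>, no value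
    lies above \<open>2 * b 0\<close>, and the levels decrease to 0.\<close>
  define b where "b = (\<lambda>j::nat. L / 2 ^ Suc j)"
  have b: "b j > 0" "b (Suc j) = b j / 2" for j using L by (auto simp: b_def)
  define A where "A = (\<lambda>j. {y. b (Suc j) < \<bar>v y\<bar> \<and> \<bar>v y\<bar> < b j})"
  have [measurable]: "A j \<in> sets borel" for j unfolding A_def by measurable
  define f where "f = (\<lambda>j y. norm (grad v y) * indicator (A j) y :: real)"
  have fmeas[measurable]: "f j \<in> borel_measurable borel" for j unfolding f_def by measurable
  have fA: "ennreal (f j y powr m) = ennreal (norm (grad v y) powr m) * indicator (A j) y" for j y
    using m by (auto simp: f_def indicator_def)
  have disj: "disjoint_family A"
  proof -
    have dec: "b j \<le> b i" if "i \<le> j" for i j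
      using L that by (auto simp: b_def intro!: divide_left_mono power_increasing)
    have "A i \<inter> A j = {}" if "i < j" for i j
      using dec[of "Suc i" j] that by (auto simp: A_def)
    then show ?thesis by (auto simp: disjoint_family_on_def) (metis IntI empty_iff linorder_neqE_nat)
  qed
  define Fj where "Fj = (\<lambda>j. enn2real (\<integral>\<^sup>+ x. ennreal (f j x powr m) \<partial>lborel))"
  have Fj_le': "(\<integral>\<^sup>+ x. ennreal (f j x powr m) \<partial>lborel) \<le> ennreal F" for j
    by (rule order_trans[OF nn_integral_mono vF]) (auto simp: fA indicator_def)
  have Fj: "(\<integral>\<^sup>+ x. ennreal (f j x powr m) \<partial>lborel) = ennreal (Fj j)" for j
    unfolding Fj_def using neq_top_trans[OF _ Fj_le'] by (metis ennreal_enn2real_if ennreal_neq_top)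
  have Fj0: "Fj j \<ge> 0" for j by (simp add: Fj_def)
  have FjF: "Fj j \<le> F" for j using Fj_le'[of j] F unfolding Fj by simp
  have pw: "ennreal (\<bar>v x\<bar> powr s) \<le> (\<Sum>j. ennreal ((2 * b j) powr s) * indicator {x. b j \<le> \<bar>v x\<bar>} x)" for x
  proof (cases "v x = 0")
    case False
    have "\<exists>j. b j \<le> \<bar>v x\<bar>"
    proof -
      have lim: "(\<lambda>j. L * (1/2) ^ Suc j) \<longlonglongrightarrow> L * 0"
        by (intro tendsto_intros LIMSEQ_Suc LIMSEQ_realpow_zero) auto
      then have "eventually (\<lambda>j. L * (1/2) ^ Suc j < \<bar>v x\<bar>) sequentially"
        using order_tendstoD(2)[OF lim, of "\<bar>v x\<bar>"] False by simp
      then obtain j where "L * (1/2) ^ Suc j < \<bar>v x\<bar>" by (auto simp: eventually_sequentially)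
      then show ?thesis by (intro exI[of _ j]) (simp add: b_def power_one_over field_simps)
    qed
    \<comment> \<open>At the least level below \<open>\<bar>v x\<bar>\<close> the value is at most
      \<open>2 * b j\<close>: otherwise the preceding level would qualify, and for
      \<open>j = 0\<close> the bound is \<open>L\<close> itself.\<close>
    define j where "j = (LEAST j. b j \<le> \<bar>v x\<bar>)"
    have j: "b j \<le> \<bar>v x\<bar>" unfolding j_def by (rule LeastI_ex) fact
    have "\<bar>v x\<bar> \<le> 2 * b j"
    proof (cases j)
      case 0
      then show ?thesis using L(2)[of x] by (simp add: b_def)
    next
      case (Suc i)
      then have "\<not> b i \<le> \<bar>v x\<bar>" using not_less_Least[of i "\<lambda>j. b j \<le> \<bar>v x\<bar>"] unfolding j_def by simp
      then show ?thesis using Suc b(2)[of i] by simp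
    qed
    then have "ennreal (\<bar>v x\<bar> powr s) \<le> ennreal ((2 * b j) powr s) * indicator {x. b j \<le> \<bar>v x\<bar>} x"
      using j sm m by (auto intro!: ennreal_leI powr_mono2)
    also have "\<dots> \<le> (\<Sum>j. ennreal ((2 * b j) powr s) * indicator {x. b j \<le> \<bar>v x\<bar>} x)"
      by (rule le_suminf_ennreal)
    finally show ?thesis .
  qed simp
  have "(\<integral>\<^sup>+ x. w x * ennreal (\<bar>v x\<bar> powr s) \<partial>lborel)
     \<le> (\<integral>\<^sup>+ x. (\<Sum>j. ennreal ((2 * b j) powr s) * (w x * indicator {x. b j \<le> \<bar>v x\<bar>} x)) \<partial>lborel)"
  proof (rule nn_integral_mono)
    fix x
    have "w x * ennreal (\<bar>v x\<bar> powr s) \<le> w x * (\<Sum>j. ennreal ((2 * b j) powr s) * indicator {x. b j \<le> \<bar>v x\<bar>} x)"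
      by (intro mult_left_mono pw) auto
    also have "\<dots> = (\<Sum>j. ennreal ((2 * b j) powr s) * (w x * indicator {x. b j \<le> \<bar>v x\<bar>} x))"
      unfolding ennreal_suminf_cmult[symmetric] by (intro suminf_cong) (simp only: mult_ac)
    finally show "w x * ennreal (\<bar>v x\<bar> powr s) \<le> (\<Sum>j. ennreal ((2 * b j) powr s) * (w x * indicator {x. b j \<le> \<bar>v x\<bar>} x))" .
  qed
  also have "\<dots> = (\<Sum>j. ennreal ((2 * b j) powr s) * (\<integral>\<^sup>+ x. w x * indicator {x. b j \<le> \<bar>v x\<bar>} x \<partial>lborel))"
    by (subst nn_integral_suminf) (auto simp: nn_integral_cmult)
  also have "\<dots> \<le> (\<Sum>j. ennreal ((4 * \<kappa>) powr s * F powr (s/m - 1)) * ennreal (Fj j))"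
  proof (intro suminf_le summableI)
    fix j
    have h: "(\<integral>\<^sup>+ x. ennreal ((norm (grad v x) * indicator {y. b (Suc j) < \<bar>v y\<bar> \<and> \<bar>v y\<bar> < b j} x) powr m) \<partial>lborel)
        \<le> ennreal (Fj j)"
      using Fj[of j] by (simp add: f_def A_def)
    have "(\<integral>\<^sup>+ x. w x * indicator {x. b j \<le> \<bar>v x\<bar>} x \<partial>lborel) \<le> ennreal ((\<kappa> * Fj j powr (1/m) / (b j - b (Suc j))) powr s)"
      unfolding \<kappa>_def n_def using b[of j] m \<beta> C Fj0 s growth
      by (intro C1c_weak_type[OF v] h) (auto simp: n_def)
    then have "ennreal ((2 * b j) powr s) * (\<integral>\<^sup>+ x. w x * indicator {x. b j \<le> \<bar>v x\<bar>} x \<partial>lborel)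
      \<le> ennreal ((2 * b j) powr s) * ennreal ((\<kappa> * Fj j powr (1/m) / (b j / 2)) powr s)"
      using b[of j] by (intro mult_left_mono) auto
    also have "\<dots> = ennreal ((4 * \<kappa>) powr s * Fj j powr (s/m))"
    proof -
      have "(2 * b j) powr s * (\<kappa> * Fj j powr (1/m) / (b j / 2)) powr s = ((2 * b j) * (\<kappa> * Fj j powr (1/m) / (b j / 2))) powr s"
        by (rule powr_mult[symmetric])
      \<comment> \<open>The level cancels against the gap \<open>b j / 2\<close> between consecutive
        levels, so the bound does not depend on the scale. The 4 is the product of the two factors
        2.\<close>
      also have "(2 * b j) * (\<kappa> * Fj j powr (1/m) / (b j / 2)) = (4 * \<kappa>) * Fj j powr (1/m)"
        using b(1)[of j] by (simp add: field_simps)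
      also have "\<dots> powr s = (4 * \<kappa>) powr s * Fj j powr (s/m)"
        using \<kappa> by (simp add: powr_mult powr_powr)
      finally show ?thesis by (simp add: ennreal_mult'[symmetric])
    qed
    also have "\<dots> \<le> ennreal ((4 * \<kappa>) powr s * F powr (s/m - 1) * Fj j)"
    proof (cases "Fj j = 0")
      case False
      \<comment> \<open>Since \<open>s/m > 1\<close>, one factor \<open>Fj j\<close> is kept and the
        rest is bounded by the total energy. The remaining sum of the \<open>Fj j\<close> is at most
        \<open>F\<close> because the layers \<open>A j\<close> are disjoint.\<close>
      then have "Fj j powr (s/m) = Fj j powr (s/m - 1) * Fj j"
        using Fj0[of j] by (simp add: powr_diff)
      also have "\<dots> \<le> F powr (s/m - 1) * Fj j"
        using Fj0[of j] FjF[of j] sm m by (intro mult_right_mono powr_mono2) auto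
      finally show ?thesis
        by (intro ennreal_leI) (simp add: mult.assoc mult_left_mono)
    qed simp
    finally show "ennreal ((2 * b j) powr s) * (\<integral>\<^sup>+ x. w x * indicator {x. b j \<le> \<bar>v x\<bar>} x \<partial>lborel)
        \<le> ennreal ((4 * \<kappa>) powr s * F powr (s/m - 1)) * ennreal (Fj j)"
      using Fj0[of j] by (simp add: ennreal_mult')
  qed
  also have "\<dots> = ennreal ((4 * \<kappa>) powr s * F powr (s/m - 1)) * (\<Sum>j. ennreal (Fj j))"
    by simp
  also have "(\<Sum>j. ennreal (Fj j)) \<le> ennreal F"
  proof -
    have "(\<Sum>j. ennreal (Fj j)) = (\<integral>\<^sup>+ x. (\<Sum>j. ennreal (norm (grad v x) powr m) * indicator (A j) x) \<partial>lborel)"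
      unfolding Fj[symmetric] fA by (subst nn_integral_suminf) auto
    also have "\<dots> \<le> (\<integral>\<^sup>+ x. ennreal (norm (grad v x) powr m) \<partial>lborel)"
    proof (rule nn_integral_mono)
      fix x
      show "(\<Sum>j. ennreal (norm (grad v x) powr m) * indicator (A j) x) \<le> ennreal (norm (grad v x) powr m)"
      proof (cases "\<exists>i. x \<in> A i")
        case True
        then obtain i where "x \<in> A i" ..
        then show ?thesis using suminf_cmult_indicator[OF disj, of x i "\<lambda>_. ennreal (norm (grad v x) powr m)"] by simp
      qed simp
    qed
    also have "\<dots> \<le> ennreal F" by (rule vF)
    finally show ?thesis .
  qed
  then have "ennreal ((4 * \<kappa>) powr s * F powr (s/m - 1)) * (\<Sum>j. ennreal (Fj j)) \<le> ennreal ((4 * \<kappa>) powr s * F powr (s/m - 1)) * ennreal F"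
    by (intro mult_left_mono) auto
  also have "\<dots> = ennreal ((4 * \<kappa>) powr s * F powr (s/m))"
    using F by (cases "F = 0") (auto simp: ennreal_mult'[symmetric] powr_diff)
  finally show ?thesis by (simp add: \<kappa>_def)
qed

subsection \<open>A smooth approximation of the truncation\<close>

text \<open>One-variable counterpart of \<open>Ck\<close>. With the derivative existentially
  quantified, closure under sums, affine changes and composition follows by induction from
  exhibiting one.\<close>

primrec smooth_upto :: "nat \<Rightarrow> (real \<Rightarrow> real) \<Rightarrow> bool" where
  "smooth_upto 0 g = continuous_on UNIV g"
| "smooth_upto (Suc k) g = (\<exists>g'. (\<forall>x. (g has_real_derivative g' x) (at x)) \<and> smooth_upto k g')"

lemma smooth_upto_add: "smooth_upto k f \<Longrightarrow> smooth_upto k g \<Longrightarrow> smooth_upto k (\<lambda>x. f x + g x)"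
proof (induction k arbitrary: f g)
  case 0
  then show ?case by (auto intro: continuous_intros)
next
  case (Suc k)
  then obtain f' g' where "\<forall>x. (f has_real_derivative f' x) (at x)" "smooth_upto k f'"
    "\<forall>x. (g has_real_derivative g' x) (at x)" "smooth_upto k g'" by auto
  then show ?case using Suc.IH by (auto intro!: exI[of _ "\<lambda>x. f' x + g' x"] derivative_intros)
qed

lemma smooth_upto_affine: "smooth_upto k f \<Longrightarrow> smooth_upto k (\<lambda>x. a * f (c * x + d))"
proof (induction k arbitrary: f a)
  case 0
  then have f: "continuous_on UNIV f" by simp
  show ?case by (auto intro!: continuous_intros continuous_on_compose2[OF f])
next
  case (Suc k)
  then obtain f' where f': "\<forall>x. (f has_real_derivative f' x) (at x)" "smooth_upto k f'" by auto
  have "((\<lambda>x. a * f (c * x + d)) has_real_derivative ((a * c) * f' (c * x + d))) (at x)" for x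
  proof -
    have "((\<lambda>x. f (c * x + d)) has_real_derivative (f' (c * x + d) * c)) (at x)"
      by (rule DERIV_chain2[of f]) (use f' in \<open>auto intro!: derivative_eq_intros\<close>)
    then show ?thesis by (auto intro!: derivative_eq_intros)
  qed
  then show ?case using Suc.IH[OF f'(2), of "a * c"]
    by (auto intro!: exI[of _ "\<lambda>x. (a * c) * f' (c * x + d)"])
qed

text \<open>The real exponent \<open>a\<close> makes the family closed under differentiation: the
  derivative combines the exponents \<open>a - 1\<close> and \<open>a - 2\<close>, so smoothness of
  all members follows by one induction. The exponential flattens the function at 0 for every sign of
  \<open>a\<close>.\<close>

definition bump :: "real \<Rightarrow> real \<Rightarrow> real \<Rightarrow> real" where
  "bump \<epsilon> a s = (if s > 0 then s powr a * exp (- \<epsilon> / s) else 0)"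

text \<open>This is the right difference quotient of \<open>bump \<epsilon> a\<close> at 0. For
  small \<open>s\<close>, \<open>s powr (a - 1)\<close> is at most \<open>s powr (- N)\<close> once
  \<open>N \<ge> 1 - a\<close>, and in the variable \<open>\<epsilon> / s\<close> the exponential
  beats the \<open>N\<close>-th power.\<close>

lemma powr_exp_div_tendsto:
  assumes e: "\<epsilon> > 0"
  shows "((\<lambda>s::real. s powr a * exp (- \<epsilon> / s) / s) \<longlongrightarrow> 0) (at_right 0)"
proof -
  obtain N :: nat where N: "real N \<ge> 1 - a" using real_arch_simple by blast
  have "filterlim (\<lambda>s. \<epsilon> * inverse s) at_top (at_right 0)"
    using e by (intro filterlim_tendsto_pos_mult_at_top[OF tendsto_const _ filterlim_inverse_at_top_right]) auto
  then have "((\<lambda>s. (\<epsilon> * inverse s) ^ N / exp (\<epsilon> * inverse s)) \<longlongrightarrow> 0) (at_right 0)"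
    by (rule filterlim_compose[OF tendsto_power_div_exp_0])
  then have "((\<lambda>s. inverse (\<epsilon> ^ N) * ((\<epsilon> * inverse s) ^ N / exp (\<epsilon> * inverse s))) \<longlongrightarrow> inverse (\<epsilon> ^ N) * 0) (at_right 0)"
    by (intro tendsto_intros)
  then have lim: "((\<lambda>s. inverse (\<epsilon> ^ N) * ((\<epsilon> * inverse s) ^ N / exp (\<epsilon> * inverse s))) \<longlongrightarrow> 0) (at_right 0)"
    by simp
  have "eventually (\<lambda>s. s > (0::real) \<and> s < 1) (at_right 0)"
    by (auto simp: eventually_at_right_field intro!: exI[of _ 1])
  then have "eventually (\<lambda>s. s powr a * exp (- \<epsilon> / s) / s \<le> inverse (\<epsilon> ^ N) * ((\<epsilon> * inverse s) ^ N / exp (\<epsilon> * inverse s))) (at_right 0)"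
  proof eventually_elim
    case (elim s)
    have "s powr a / s = s powr (a - 1)" using elim by (simp add: powr_diff)
    also have "\<dots> \<le> s powr (- real N)" using elim N by (intro powr_mono') auto
    also have "\<dots> = inverse s ^ N" using elim by (simp add: powr_minus powr_realpow power_inverse)
    finally have "s powr a / s * exp (- \<epsilon> / s) \<le> inverse s ^ N * exp (- \<epsilon> / s)" by (intro mult_right_mono) auto
    then show ?case using e elim by (simp add: power_mult_distrib exp_minus field_simps)
  qed
  moreover have "eventually (\<lambda>s. 0 \<le> s powr a * exp (- \<epsilon> / s) / s) (at_right 0)"
    using eventually_at_right_less by eventually_elim auto
  ultimately show ?thesis by (intro tendsto_sandwich[OF _ _ tendsto_const lim])
qed

lemma bump_has_derivative:
  assumes "\<epsilon> > 0"
  shows "(bump \<epsilon> a has_real_derivative (a * bump \<epsilon> (a - 1) s + \<epsilon> * bump \<epsilon> (a - 2) s)) (at s)"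
proof -
  consider "s > 0" | "s < 0" | "s = 0" by linarith
  then show ?thesis
  proof cases
    case 1
    have "((\<lambda>s. s powr a * exp (- \<epsilon> / s)) has_real_derivative
        (a * (s powr (a - 1) * exp (- \<epsilon> / s)) + \<epsilon> * (s powr (a - 2) * exp (- \<epsilon> / s)))) (at s)"
    proof -
      have d1: "((\<lambda>s. s powr a) has_real_derivative a * s powr (a - 1)) (at s)"
        using 1 by (rule has_real_derivative_powr)
      have d2: "((\<lambda>s. exp (- \<epsilon> / s)) has_real_derivative exp (- \<epsilon> / s) * (\<epsilon> / s\<^sup>2)) (at s)"
        using 1 by (auto intro!: derivative_eq_intros simp: power2_eq_square)
      have "s powr (a - 2) = s powr a / s\<^sup>2" using 1 by (simp add: powr_diff)
      with DERIV_mult[OF d1 d2] show ?thesis by (simp add: mult_ac)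
    qed
    then have "(bump \<epsilon> a has_real_derivative
        (a * (s powr (a - 1) * exp (- \<epsilon> / s)) + \<epsilon> * (s powr (a - 2) * exp (- \<epsilon> / s)))) (at s)"
      by (rule has_field_derivative_transform_within_open[of _ _ _ "{0<..}"]) (use 1 in \<open>auto simp: bump_def\<close>)
    then show ?thesis using 1 by (simp add: bump_def)
  next
    case 2
    have "((\<lambda>s. 0) has_real_derivative 0) (at s)" by simp
    then have "(bump \<epsilon> a has_real_derivative 0) (at s)"
      by (rule has_field_derivative_transform_within_open[of _ _ _ "{..<0}"]) (use 2 in \<open>auto simp: bump_def\<close>)
    then show ?thesis using 2 by (simp add: bump_def)
  next
    case 3
    have "((\<lambda>s::real. s powr a * exp (- \<epsilon> / s) / s) \<longlongrightarrow> 0) (at_right 0)"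
      using assms by (rule powr_exp_div_tendsto)
    then have r: "((\<lambda>s. bump \<epsilon> a s / s) \<longlongrightarrow> 0) (at_right 0)"
      by (rule Lim_transform_eventually) (auto simp: bump_def eventually_at_right_less intro!: eventually_mono[OF eventually_at_right_less])
    have "((\<lambda>s::real. 0) \<longlongrightarrow> (0::real)) (at_left 0)" by simp
    then have "((\<lambda>s. bump \<epsilon> a s / s) \<longlongrightarrow> 0) (at_left 0)"
      by (rule Lim_transform_eventually)
        (auto simp: bump_def eventually_at_filter)
    with r have "((\<lambda>s. bump \<epsilon> a s / s) \<longlongrightarrow> 0) (at 0)" by (simp add: filterlim_at_split)
    then show ?thesis using 3 by (simp add: has_field_derivative_iff bump_def)
  qed
qed

lemma smooth_upto_bump: "\<epsilon> > 0 \<Longrightarrow> smooth_upto k (bump \<epsilon> a)"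
proof (induction k arbitrary: a)
  case 0
  then show ?case using bump_has_derivative[of \<epsilon> a]
    by (auto simp: continuous_on_eq_continuous_at intro: DERIV_isCont)
next
  case (Suc k)
  have "smooth_upto k (\<lambda>s. a * bump \<epsilon> (a - 1) s + \<epsilon> * bump \<epsilon> (a - 2) s)"
    using smooth_upto_affine[of k "bump \<epsilon> (a - 1)" a 1 0] smooth_upto_affine[of k "bump \<epsilon> (a - 2)" \<epsilon> 1 0] Suc
    by (intro smooth_upto_add) auto
  then show ?case using bump_has_derivative[OF Suc.prems, of a]
    by (auto intro!: exI[of _ "\<lambda>s. a * bump \<epsilon> (a - 1) s + \<epsilon> * bump \<epsilon> (a - 2) s"])
qed

text \<open>As \<open>\<epsilon>\<close> tends to 0 this tends to \<open>sgn t * max 0 (\<bar>t\<bar> - k)\<close>. Both \<open>trunc\<close> and its derivative vanish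
  identically for \<open>\<bar>t\<bar> \<le> k\<close>, so composition maps test functions to test functions.\<close>
definition trunc :: "real \<Rightarrow> real \<Rightarrow> real \<Rightarrow> real" where
  "trunc k \<epsilon> t = bump \<epsilon> 1 (t - k) - bump \<epsilon> 1 (- t - k)"

text \<open>The derivative of \<open>bump \<epsilon> 1\<close>, in a closed form from which the
  bounds 0 and 1 can be read off by \<open>1 + x \<le> exp x\<close>.\<close>

definition bump' :: "real \<Rightarrow> real \<Rightarrow> real" where
  "bump' \<epsilon> s = (if s > 0 then exp (- \<epsilon> / s) * (1 + \<epsilon> / s) else 0)"

definition trunc' :: "real \<Rightarrow> real \<Rightarrow> real \<Rightarrow> real" where
  "trunc' k \<epsilon> t = bump' \<epsilon> (t - k) + bump' \<epsilon> (- t - k)"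

lemma bump'_eq: "bump' \<epsilon> s = bump \<epsilon> 0 s + \<epsilon> * bump \<epsilon> (- 1) s"
  by (auto simp: bump'_def bump_def powr_minus field_simps)

lemma smooth_upto_trunc: "\<epsilon> > 0 \<Longrightarrow> smooth_upto j (trunc k \<epsilon>)"
  using smooth_upto_add[OF smooth_upto_affine[OF smooth_upto_bump, of \<epsilon> j 1 1 1 "-k"] smooth_upto_affine[OF smooth_upto_bump, of \<epsilon> j "-1" 1 "-1" "-k"]]
  by (simp add: trunc_def[abs_def] algebra_simps)

lemma continuous_trunc': "\<epsilon> > 0 \<Longrightarrow> continuous_on UNIV (trunc' k \<epsilon>)"
proof -
  assume e: "\<epsilon> > 0"
  have "smooth_upto 0 (bump \<epsilon> a)" for a using e by (rule smooth_upto_bump)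
  then have b: "continuous_on UNIV (bump \<epsilon> a)" for a by simp
  have "continuous_on UNIV (bump' \<epsilon>)"
    unfolding bump'_eq[abs_def] by (intro continuous_intros b)
  then have "continuous_on UNIV (\<lambda>t. bump' \<epsilon> (t - k))" "continuous_on UNIV (\<lambda>t. bump' \<epsilon> (- t - k))"
    by (auto intro!: continuous_on_compose2[of UNIV "bump' \<epsilon>"] continuous_intros)
  then show ?thesis unfolding trunc'_def[abs_def] by (rule continuous_on_add)
qed

lemma trunc_has_derivative:
  assumes "\<epsilon> > 0" shows "(trunc k \<epsilon> has_real_derivative trunc' k \<epsilon> t) (at t)"
proof -
  have d: "(bump \<epsilon> 1 has_real_derivative bump' \<epsilon> s) (at s)" for s
    using bump_has_derivative[OF assms, of 1 s] by (simp add: bump'_eq)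
  have "((\<lambda>t. bump \<epsilon> 1 (t - k)) has_real_derivative (bump' \<epsilon> (t - k) * 1)) (at t)"
    "((\<lambda>t. bump \<epsilon> 1 (- t - k)) has_real_derivative (bump' \<epsilon> (- t - k) * (-1))) (at t)"
    by (rule DERIV_chain2[OF d]; auto intro!: derivative_eq_intros)+
  from DERIV_diff[OF this] show ?thesis by (simp add: trunc_def[abs_def] trunc'_def)
qed

lemma bump'_bounds: "\<epsilon> > 0 \<Longrightarrow> 0 \<le> bump' \<epsilon> s \<and> bump' \<epsilon> s \<le> 1"
proof -
  assume e: "\<epsilon> > 0"
  have "exp (- \<epsilon> / s) * (1 + \<epsilon> / s) \<le> 1" if "s > 0"
  proof -
    have "exp (- \<epsilon> / s) * (1 + \<epsilon> / s) \<le> exp (- \<epsilon> / s) * exp (\<epsilon> / s)"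
      by (intro mult_left_mono exp_ge_add_one_self) auto
    then show ?thesis by (simp add: exp_add[symmetric])
  qed
  then show ?thesis using e by (auto simp: bump'_def)
qed

lemma trunc'_bounds:
  assumes "\<epsilon> > 0" "k > 0"
  shows "0 \<le> trunc' k \<epsilon> t" "trunc' k \<epsilon> t \<le> 1" "\<bar>t\<bar> \<le> k \<Longrightarrow> trunc' k \<epsilon> t = 0"
  using bump'_bounds[OF assms(1), of "t - k"] bump'_bounds[OF assms(1), of "- t - k"] assms(2)
  by (auto simp: trunc'_def bump'_def[of _ "t - k"] bump'_def[of _ "- t - k"] split: if_splits)

lemma abs_trunc_eq:
  assumes "k > 0"
  shows "\<bar>trunc k \<epsilon> t\<bar> = (if \<bar>t\<bar> > k then (\<bar>t\<bar> - k) * exp (- \<epsilon> / (\<bar>t\<bar> - k)) else 0)"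
  using assms by (auto simp: trunc_def bump_def abs_mult split: abs_split)

lemma abs_trunc_le:
  assumes "\<epsilon> > 0" "k > 0"
  shows "\<bar>trunc k \<epsilon> t\<bar> \<le> max 0 (\<bar>t\<bar> - k)" "\<bar>trunc k \<epsilon> t\<bar> \<le> \<bar>t\<bar>"
proof -
  show *: "\<bar>trunc k \<epsilon> t\<bar> \<le> max 0 (\<bar>t\<bar> - k)"
    using assms by (auto simp: abs_trunc_eq max_def intro!: mult_left_le)
  then show "\<bar>trunc k \<epsilon> t\<bar> \<le> \<bar>t\<bar>" using assms by (auto simp: max_def split: if_splits)
qed

text \<open>At \<open>\<bar>t\<bar> = k\<close> the derivative is 0 for every
  \<open>\<epsilon>\<close>, so the limit is the indicator of the strict superlevel set at every
  point. No statement about \<open>Du\<close> on the level sets of \<open>u\<close> is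
  required.\<close>

lemma trunc_tendsto:
  assumes "k > 0"
  shows "((\<lambda>\<epsilon>. \<bar>trunc k \<epsilon> t\<bar>) \<longlongrightarrow> max 0 (\<bar>t\<bar> - k)) (at_right 0)"
    "((\<lambda>\<epsilon>. trunc' k \<epsilon> t) \<longlongrightarrow> indicator {t. \<bar>t\<bar> > k} t) (at_right 0)"
proof -
  have "((\<lambda>\<epsilon>. (\<bar>t\<bar> - k) * exp (- \<epsilon> / (\<bar>t\<bar> - k))) \<longlongrightarrow> (\<bar>t\<bar> - k) * exp (- 0 / (\<bar>t\<bar> - k))) (at_right 0)" if "\<bar>t\<bar> > k"
    using that by (intro tendsto_intros) auto
  then show "((\<lambda>\<epsilon>. \<bar>trunc k \<epsilon> t\<bar>) \<longlongrightarrow> max 0 (\<bar>t\<bar> - k)) (at_right 0)"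
    using assms by (cases "\<bar>t\<bar> > k") (auto simp: abs_trunc_eq max_def)
  have "((\<lambda>\<epsilon>. exp (- \<epsilon> / s) * (1 + \<epsilon> / s)) \<longlongrightarrow> exp (- 0 / s) * (1 + 0 / s)) (at_right 0)" if "s > 0" for s :: real
    using that by (intro tendsto_intros) auto
  then have b: "((\<lambda>\<epsilon>. bump' \<epsilon> s) \<longlongrightarrow> indicator {0<..} s) (at_right 0)" for s
    by (cases "s > 0") (auto simp: bump'_def)
  have "((\<lambda>\<epsilon>. trunc' k \<epsilon> t) \<longlongrightarrow> indicator {0<..} (t - k) + indicator {0<..} (- t - k)) (at_right 0)"
    unfolding trunc'_def by (intro tendsto_add b)
  also have "indicator {0<..} (t - k) + indicator {0<..} (- t - k) = (indicator {t. \<bar>t\<bar> > k} t :: real)"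
    using assms by (auto simp: indicator_def)
  finally show "((\<lambda>\<epsilon>. trunc' k \<epsilon> t) \<longlongrightarrow> indicator {t. \<bar>t\<bar> > k} t) (at_right 0)" .
qed

subsection \<open>Calculus of test functions\<close>

lemma pd_eqI: "(f has_derivative f') (at x) \<Longrightarrow> pd i f x = f' (axis i 1)"
  unfolding pd_def by (metis frechet_derivative_at)

lemma Ck_SucD: "Ck (Suc k) f \<Longrightarrow> Ck k f"
proof (induction k arbitrary: f)
  case 0
  then show ?case by (auto intro: differentiable_imp_continuous_on)
next
  case (Suc k)
  then have "f differentiable_on UNIV" "\<And>i. Ck (Suc k) (pd i f)" by auto
  with Suc.IH show ?case by auto
qed

lemma Ck_SucI:
  assumes "\<And>x. (f has_derivative f' x) (at x)" "\<And>i. Ck k (\<lambda>x. f' x (axis i 1))"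
  shows "Ck (Suc k) f"
proof -
  have "f differentiable_on UNIV" using assms(1) by (auto simp: differentiable_on_def differentiable_def)
  moreover have "pd i f = (\<lambda>x. f' x (axis i 1))" for i using pd_eqI[OF assms(1)] by auto
  ultimately show ?thesis using assms(2) by simp
qed

lemma Ck_Suc_has_derivative:
  "Ck (Suc k) f \<Longrightarrow> (f has_derivative (\<lambda>h. grad f x \<bullet> h)) (at x)"
  by (auto simp: differentiable_on_def intro!: has_derivative_grad)

lemma grad_inner_axis: "grad f x \<bullet> axis i 1 = pd i f x"
  by (simp add: grad_def inner_axis)

lemma Ck_add: "Ck k f \<Longrightarrow> Ck k g \<Longrightarrow> Ck k (\<lambda>x. f x + g x)"
proof (induction k arbitrary: f g)
  case 0
  then show ?case by (auto intro: continuous_intros)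
next
  case (Suc k)
  show ?case
    by (rule Ck_SucI[OF has_derivative_add[OF Ck_Suc_has_derivative[OF Suc.prems(1)] Ck_Suc_has_derivative[OF Suc.prems(2)]]])
       (use Suc in \<open>auto simp: grad_inner_axis intro!: Suc.IH\<close>)
qed

lemma Ck_mult: "Ck k f \<Longrightarrow> Ck k g \<Longrightarrow> Ck k (\<lambda>x. f x * g x)"
proof (induction k arbitrary: f g)
  case 0
  then show ?case by (auto intro: continuous_intros)
next
  case (Suc k)
  have "Ck k f" "Ck k g" using Suc.prems Ck_SucD by blast+
  then show ?case
    by (intro Ck_SucI[OF has_derivative_mult[OF Ck_Suc_has_derivative[OF Suc.prems(1)] Ck_Suc_has_derivative[OF Suc.prems(2)]]])
       (use Suc in \<open>auto simp: grad_inner_axis intro!: Suc.IH Ck_add\<close>)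
qed

lemma has_derivative_compose_real:
  assumes "(g has_real_derivative g' (f x)) (at (f x))" "(f has_derivative (\<lambda>h. grad f x \<bullet> h)) (at x)"
  shows "((\<lambda>x. g (f x)) has_derivative (\<lambda>h. (g' (f x) *\<^sub>R grad f x) \<bullet> h)) (at x)"
  using has_derivative_compose[OF assms(2) assms(1)[unfolded has_field_derivative_def]] by (simp add: mult_ac)

lemma Ck_compose: "smooth_upto k g \<Longrightarrow> Ck k f \<Longrightarrow> Ck k (\<lambda>x. g (f x))"
proof (induction k arbitrary: g)
  case 0
  then show ?case by (auto intro: continuous_on_compose2)
next
  case (Suc k)
  then obtain g' where g': "\<And>x. (g has_real_derivative g' x) (at x)" "smooth_upto k g'" by auto
  have f: "Ck k f" using Suc.prems Ck_SucD by blast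
  have "Ck k (\<lambda>x. g' (f x) * pd i f x)" for i
    using Suc.prems Suc.IH[OF g'(2) f] by (intro Ck_mult) auto
  then show ?case
    by (intro Ck_SucI[where f'="\<lambda>x h. (g' (f x) *\<^sub>R grad f x) \<bullet> h"] has_derivative_compose_real
        g'(1) Ck_Suc_has_derivative[OF Suc.prems(2)])
       (simp_all add: grad_inner_axis)
qed

lemma tsupport_mono: "(\<And>x. g x = 0 \<Longrightarrow> f x = 0) \<Longrightarrow> tsupport f \<subseteq> tsupport g"
  unfolding tsupport_def by (intro closure_mono) auto

lemma compact_tsupport_mono:
  assumes "compact (tsupport g)" "\<And>x. g x = 0 \<Longrightarrow> f x = 0"
  shows "compact (tsupport f)"
proof -
  have "compact (tsupport g \<inter> tsupport f)"
    using assms(1) by (rule compact_Int_closed) (simp add: tsupport_def)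
  then show ?thesis using inf.absorb2[OF tsupport_mono[of g f]] assms(2) by simp
qed

text \<open>Because \<open>g 0 = 0\<close>, composition cannot enlarge the support.\<close>

lemma test_fun_compose:
  assumes "test_fun D f" "\<And>k. smooth_upto k g" "g 0 = 0"
  shows "test_fun D (\<lambda>x. g (f x))"
proof -
  have "Ck k (\<lambda>x. g (f x))" for k
    using assms(1) unfolding test_fun_def by (intro Ck_compose[OF assms(2)]) blast
  moreover have z: "g (f x) = 0" if "f x = 0" for x using that assms(3) by simp
  have "compact (tsupport (\<lambda>x. g (f x)))"
    by (rule compact_tsupport_mono[of f]) (use assms(1) z in \<open>simp_all add: test_fun_def\<close>)
  moreover have "tsupport (\<lambda>x. g (f x)) \<subseteq> D"
    using tsupport_mono[of f "\<lambda>x. g (f x)"] z assms(1) unfolding test_fun_def by blast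
  ultimately show ?thesis unfolding test_fun_def by blast
qed

lemma grad_compose:
  assumes "C1c f" "\<And>t. (g has_real_derivative g' t) (at t)"
  shows "grad (\<lambda>x. g (f x)) x = g' (f x) *\<^sub>R grad f x"
  using assms by (intro grad_unique has_derivative_compose_real) (auto simp: C1c_def)

section \<open>Integrals of compactly supported functions and integration by parts\<close>

lemma integrable_continuous_compact_tsupport:
  fixes h :: "real^'n::finite \<Rightarrow> real"
  assumes "continuous_on UNIV h" "compact (tsupport h)"
  shows "integrable lborel h"
proof -
  have "integrable lborel (\<lambda>x. indicator (tsupport h) x *\<^sub>R h x)"
    using assms by (intro borel_integrable_compact) (auto intro: continuous_on_subset)
  also have "(\<lambda>x. indicator (tsupport h) x *\<^sub>R h x) = h"
    by (rule ext) (auto simp: indicator_def eq_0_outside_tsupport)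
  finally show ?thesis .
qed

lemma pd_eq_grad_nth: "pd i f x = grad f x $ i"
  by (simp add: grad_def)

lemma C1c_pd:
  assumes "C1c h"
  shows "continuous_on UNIV (pd i h)" "compact (tsupport (pd i h))"
proof -
  have "continuous_on UNIV (grad h)" using assms by (simp add: C1c_def)
  then show "continuous_on UNIV (pd i h)" unfolding pd_eq_grad_nth[abs_def]
    by (rule continuous_on_component)
  have "x \<in> tsupport h" if "pd i h x \<noteq> 0" for x
  proof (rule ccontr)
    assume "x \<notin> tsupport h"
    from grad_eq_0_outside_tsupport[OF this] that show False by (simp add: pd_eq_grad_nth)
  qed
  then have "{x. pd i h x \<noteq> 0} \<subseteq> tsupport h" by blast
  then have "tsupport (pd i h) \<subseteq> tsupport h" unfolding tsupport_def[of "pd i h"]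
    by (intro closure_minimal) (auto simp: tsupport_def)
  moreover have "compact (tsupport h \<inter> tsupport (pd i h))"
    using assms unfolding C1c_def by (intro compact_Int_closed) (auto simp: tsupport_def)
  ultimately show "compact (tsupport (pd i h))" using inf.absorb2[of "tsupport (pd i h)" "tsupport h"] by simp
qed

lemma continuous_compact_tsupport_bounded:
  fixes h :: "real^'n::finite \<Rightarrow> real"
  assumes "continuous_on UNIV h" "compact (tsupport h)"
  obtains L where "L > 0" "\<And>x. \<bar>h x\<bar> \<le> L"
proof -
  have "compact (h ` tsupport h)"
    using assms by (intro compact_continuous_image) (auto intro: continuous_on_subset)
  then obtain L where L: "L > 0" "\<And>x. x \<in> tsupport h \<Longrightarrow> \<bar>h x\<bar> \<le> L"
    by (auto simp: bounded_pos dest!: compact_imp_bounded)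
  have "\<bar>h x\<bar> \<le> L" for x using L eq_0_outside_tsupport[of x h] by (cases "x \<in> tsupport h") auto
  with L(1) show ?thesis by (rule that)
qed

text \<open>The integral of \<open>h (x + t e)\<close> does not depend on \<open>t\<close>; differentiate at \<open>t = 0\<close>.\<close>
lemma integral_pd_eq_0:
  fixes h :: "real^'n::finite \<Rightarrow> real"
  assumes h: "C1c h"
  shows "(\<integral>x. pd i h x \<partial>lborel) = 0"
proof -
  define e :: "real^'n" where "e = axis i 1"
  have e1: "norm e = 1" by (simp add: e_def)
  have hc: "continuous_on UNIV h" and hcs: "compact (tsupport h)"
    using C1c_measurable[OF h] h by (auto simp: C1c_def)
  note [measurable] = C1c_measurable(1)[OF h]
  have hi: "integrable lborel h" by (rule integrable_continuous_compact_tsupport[OF hc hcs])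
  obtain L where L: "L > 0" "\<And>x. \<bar>pd i h x\<bar> \<le> L"
    using continuous_compact_tsupport_bounded[OF C1c_pd[OF h]] by auto
  obtain B where B: "B > 0" "\<And>y. norm y > B \<Longrightarrow> h y = 0"
  proof -
    have "bounded (tsupport h)" using hcs by (rule compact_imp_bounded)
    then obtain B where "B > 0" "\<And>y. y \<in> tsupport h \<Longrightarrow> norm y \<le> B" by (auto simp: bounded_pos)
    then show ?thesis by (intro that[of B]) (auto intro!: eq_0_outside_tsupport simp: not_le[symmetric])
  qed
  define t where "t = (\<lambda>j::nat. 1 / real (Suc j))"
  have t: "t j > 0" "t j \<le> 1" for j by (auto simp: t_def)
  have t0: "t \<longlonglongrightarrow> 0" unfolding t_def using LIMSEQ_inverse_real_of_nat by (simp add: inverse_eq_divide)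
  define q where "q = (\<lambda>j x. (h (x + t j *\<^sub>R e) - h x) / t j)"
  have line: "((\<lambda>r. h (x + r *\<^sub>R e)) has_real_derivative pd i h (x + r *\<^sub>R e)) (at r)" for x r
  proof -
    have "(h has_derivative (\<lambda>v. grad h (x + r *\<^sub>R e) \<bullet> v)) (at (x + r *\<^sub>R e))"
      using h by (auto simp: C1c_def)
    then have "((\<lambda>r. h (x + r *\<^sub>R e)) has_derivative (\<lambda>s. grad h (x + r *\<^sub>R e) \<bullet> (s *\<^sub>R e))) (at r)"
      by (rule has_derivative_compose[rotated]) (auto intro!: derivative_eq_intros)
    then show ?thesis by (simp add: has_field_derivative_def grad_inner_axis e_def mult_commute_abs)
  qed
  have trans_int: "integrable lborel (\<lambda>x. h (x + y))" "(\<integral>x. h (x + y) \<partial>lborel) = (\<integral>x. h x \<partial>lborel)" for y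
  proof -
    have d: "distr lborel borel ((+) y) = (lborel :: (real^'n) measure)" by (rule lborel_distr_plus)
    have "integrable (distr lborel borel ((+) y)) h" using hi d by simp
    then show "integrable lborel (\<lambda>x. h (x + y))" by (subst (asm) integrable_distr_eq) (auto simp: add.commute)
    have "(\<integral>x. h x \<partial>lborel) = (\<integral>x. h x \<partial>distr lborel borel ((+) y))" using d by simp
    then show "(\<integral>x. h (x + y) \<partial>lborel) = (\<integral>x. h x \<partial>lborel)" by (subst (asm) integral_distr) (auto simp: add.commute)
  qed
  have q0: "(\<integral>x. q j x \<partial>lborel) = 0" for j
    unfolding q_def using trans_int[of "t j *\<^sub>R e"] hi by (simp add: Bochner_Integration.integral_diff)
  \<comment> \<open>Domination: the mean value inequality bounds the quotients by \<open>L\<close>,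
    and as the shifts are at most 1 they vanish outside the ball of radius
    \<open>B + 1\<close>.\<close>
  have lim: "(\<lambda>j. \<integral>x. q j x \<partial>lborel) \<longlonglongrightarrow> (\<integral>x. pd i h x \<partial>lborel)"
  proof (rule integral_dominated_convergence[where w="\<lambda>x. L * indicator (cball 0 (B + 1)) x"])
    show "pd i h \<in> borel_measurable lborel" using C1c_pd(1)[OF h] by (simp add: borel_measurable_continuous_onI)
    show "q j \<in> borel_measurable lborel" for j unfolding q_def by measurable
    show "integrable lborel (\<lambda>x. L * indicator (cball (0::real^'n) (B + 1)) x)"
      by (intro integrable_mult_right integrable_real_indicator) (use emeasure_lborel_cball_finite[of "0::real^'n" "B + 1"] in auto)
    show "AE x in lborel. (\<lambda>j. q j x) \<longlonglongrightarrow> pd i h x"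
    proof (rule AE_I2)
      fix x :: "real^'n"
      have "((\<lambda>r. (h (x + r *\<^sub>R e) - h x) / r) \<longlongrightarrow> pd i h x) (at 0)"
        using line[of x 0] by (simp add: has_field_derivative_iff)
      moreover have "filterlim t (at 0) sequentially"
        using t0 t(1) by (auto simp: filterlim_at intro!: always_eventually less_imp_neq[THEN not_sym])
      ultimately show "(\<lambda>j. q j x) \<longlonglongrightarrow> pd i h x"
        unfolding q_def by (rule filterlim_compose)
    qed
    show "AE x in lborel. norm (q j x) \<le> L * indicator (cball 0 (B + 1)) x" for j
    proof (rule AE_I2)
      fix x :: "real^'n"
      show "norm (q j x) \<le> L * indicator (cball 0 (B + 1)) x"
      proof (cases "norm x \<le> B + 1")
        case True
        have "\<bar>h (x + t j *\<^sub>R e) - h (x + 0 *\<^sub>R e)\<bar> \<le> L * \<bar>t j - 0\<bar>"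
          using field_differentiable_bound[of UNIV "\<lambda>r. h (x + r *\<^sub>R e)" "\<lambda>r. pd i h (x + r *\<^sub>R e)" L "t j" 0]
            line L by auto
        then show ?thesis using True t[of j] by (simp add: q_def field_simps)
      next
        case False
        have "norm (x + t j *\<^sub>R e) \<ge> norm x - norm (t j *\<^sub>R e)" by (metis norm_diff_ineq)
        then have "norm (x + t j *\<^sub>R e) > B" using False t[of j] e1 by simp
        then show ?thesis using False B by (simp add: q_def)
      qed
    qed
  qed
  with q0 show ?thesis by (simp add: LIMSEQ_const_iff)
qed

lemma C1c_mult:
  assumes f: "C1c f" and g: "C1c g"
  shows "C1c (\<lambda>x. f x * g x)" "pd i (\<lambda>x. f x * g x) x = f x * pd i g x + pd i f x * g x"
proof -
  have d: "((\<lambda>x. f x * g x) has_derivative (\<lambda>h. f x * (grad g x \<bullet> h) + (grad f x \<bullet> h) * g x)) (at x)" for x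
    using f g by (intro has_derivative_mult) (auto simp: C1c_def)
  show p: "pd i (\<lambda>x. f x * g x) x = f x * pd i g x + pd i f x * g x" for i x
    using pd_eqI[OF d] by (simp add: grad_inner_axis)
  show "C1c (\<lambda>x. f x * g x)"
  proof (rule C1cI)
    show "(\<lambda>x. f x * g x) differentiable_on UNIV"
      unfolding differentiable_on_def differentiable_def using d has_derivative_at_withinI by blast
    show "continuous_on UNIV (pd i (\<lambda>x. f x * g x))" for i
    proof -
      have "continuous_on UNIV (\<lambda>x. f x * pd i g x + pd i f x * g x)"
        by (rule continuous_on_add; rule continuous_on_mult; rule C1c_pd(1)[OF f] C1c_pd(1)[OF g]
            C1c_measurable(3)[OF f] C1c_measurable(3)[OF g])
      also have "(\<lambda>x. f x * pd i g x + pd i f x * g x) = pd i (\<lambda>x. f x * g x)"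
        by (rule ext) (rule p[symmetric])
      finally show ?thesis .
    qed
    have "compact (tsupport f)" using f unfolding C1c_def by blast
    then show "compact (tsupport (\<lambda>x. f x * g x))" by (rule compact_tsupport_mono) simp
  qed
qed

lemma C1c_integration_by_parts:
  fixes f g :: "real^'n::finite \<Rightarrow> real"
  assumes f: "C1c f" and g: "C1c g"
  shows "(\<integral>x. f x * pd i g x \<partial>lborel) = - (\<integral>x. pd i f x * g x \<partial>lborel)"
proof -
  have "compact (tsupport f)" "compact (tsupport g)" using f g unfolding C1c_def by blast+
  note cs = this[THEN compact_tsupport_mono]
  have "integrable lborel (\<lambda>x. f x * pd i g x)"
    by (rule integrable_continuous_compact_tsupport[OF continuous_on_mult[OF C1c_measurable(3)[OF f] C1c_pd(1)[OF g]] cs(1)]) simp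
  moreover have "integrable lborel (\<lambda>x. pd i f x * g x)"
    by (rule integrable_continuous_compact_tsupport[OF continuous_on_mult[OF C1c_pd(1)[OF f] C1c_measurable(3)[OF g]] cs(2)]) simp
  ultimately have "(\<integral>x. f x * pd i g x \<partial>lborel) + (\<integral>x. pd i f x * g x \<partial>lborel) = (\<integral>x. pd i (\<lambda>x. f x * g x) x \<partial>lborel)"
    unfolding C1c_mult(2)[OF f g] by (simp add: Bochner_Integration.integral_add)
  also have "\<dots> = 0" by (rule integral_pd_eq_0[OF C1c_mult(1)[OF f g]])
  finally show ?thesis by simp
qed

subsection \<open>Approximation and chain rule in W10\<close>

text \<open>Uniform upper bounds survive almost everywhere limits without any domination. The trace
  inequality and the energy estimate are carried from smooth functions to their limits in this
  way.\<close>

lemma nn_integral_Fatou_bound: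
  fixes u :: "nat \<Rightarrow> 'a \<Rightarrow> ennreal"
  assumes [measurable]: "\<And>k. u k \<in> borel_measurable M"
    and lim: "AE x in M. (\<lambda>k. u k x) \<longlonglongrightarrow> v x" and le: "\<And>k. (\<integral>\<^sup>+ x. u k x \<partial>M) \<le> c"
  shows "(\<integral>\<^sup>+ x. v x \<partial>M) \<le> c"
proof -
  have "(\<integral>\<^sup>+ x. v x \<partial>M) \<le> (\<integral>\<^sup>+ x. liminf (\<lambda>k. u k x) \<partial>M)"
    using lim by (intro nn_integral_mono_AE) (auto elim!: eventually_mono dest: lim_imp_Liminf[rotated])
  also have "\<dots> \<le> liminf (\<lambda>k. \<integral>\<^sup>+ x. u k x \<partial>M)" by (rule nn_integral_liminf) measurable
  also have "\<dots> \<le> c" by (rule Liminf_le) (use le in auto)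
  finally show ?thesis .
qed

lemma nn_tendsto_0_AE_subseq:
  fixes g :: "nat \<Rightarrow> 'a \<Rightarrow> real"
  assumes [measurable]: "\<And>k. g k \<in> borel_measurable M" and g0: "\<And>k x. g k x \<ge> 0"
    and lim: "(\<lambda>k. \<integral>\<^sup>+ x. ennreal (g k x) \<partial>M) \<longlonglongrightarrow> 0"
  obtains r :: "nat \<Rightarrow> nat" where "strict_mono r" "AE x in M. (\<lambda>k. g (r k) x) \<longlonglongrightarrow> 0"
proof -
  \<comment> \<open>Early terms may have infinite integral; from \<open>K\<close> on they are
    integrable, as the subsequence theorem for L1 convergence demands.\<close>
  have "eventually (\<lambda>k. (\<integral>\<^sup>+ x. ennreal (g k x) \<partial>M) < 1) sequentially"
    using lim by (rule order_tendstoD) simp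
  then obtain K where K: "\<And>k. k \<ge> K \<Longrightarrow> (\<integral>\<^sup>+ x. ennreal (g k x) \<partial>M) < 1"
    by (auto simp: eventually_sequentially)
  have i: "integrable M (g (k + K))" for k
    using K[of "k + K"] g0 by (intro integrableI_nonneg) (auto intro: order.strict_trans)
  have "(\<lambda>k. enn2real (\<integral>\<^sup>+ x. ennreal (g (k + K) x) \<partial>M)) \<longlonglongrightarrow> 0"
    using LIMSEQ_ignore_initial_segment[OF lim, of K] by (intro tendsto_enn2real) auto
  then have "(\<lambda>k. \<integral>x. norm (g (k + K) x) \<partial>M) \<longlonglongrightarrow> 0"
    using g0 by (subst integral_eq_nn_integral) auto
  from tendsto_L1_AE_subseq[OF i this] obtain r where r: "strict_mono r" "AE x in M. (\<lambda>k. g (r k + K) x) \<longlonglongrightarrow> 0"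
    by auto
  show ?thesis
    by (rule that[of "\<lambda>k. r k + K"]) (use r in \<open>auto simp: strict_mono_def\<close>)
qed

lemma tendsto_0_powrD:
  fixes a :: "nat \<Rightarrow> real"
  assumes "(\<lambda>k. a k powr s) \<longlonglongrightarrow> 0" "s > 0" "\<And>k. a k \<ge> 0"
  shows "a \<longlonglongrightarrow> 0"
proof -
  have "(\<lambda>k. (a k powr s) powr (1/s)) \<longlonglongrightarrow> 0 powr (1/s)"
    using assms by (intro tendsto_powr') auto
  then show ?thesis using assms by (simp add: powr_powr)
qed

lemma powr_add_le_2:
  fixes a b :: real
  assumes "a \<ge> 0" "b \<ge> 0" "m \<ge> 0"
  shows "(a + b) powr m \<le> 2 powr m * (a powr m + b powr m)"
proof -
  have "(a + b) powr m \<le> (2 * max a b) powr m" using assms by (intro powr_mono2) auto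
  also have "\<dots> = 2 powr m * max a b powr m" by (simp add: powr_mult)
  also have "\<dots> \<le> 2 powr m * (a powr m + b powr m)"
    by (intro mult_left_mono) (auto simp: max_def)
  finally show ?thesis .
qed

lemma borel_measurable_vec_components:
  fixes F :: "'a \<Rightarrow> real^'n::finite"
  assumes "\<And>i. (\<lambda>x. F x $ i) \<in> borel_measurable M"
  shows "F \<in> borel_measurable M"
  unfolding borel_measurable_euclidean_space[of F]
  using assms by (auto simp: Basis_vec_def inner_axis)

section \<open>Transfer between integrals over \<open>lebesgue_on D\<close> and
  \<open>lborel\<close>\<close>

lemma nn_set_integral_eq_lebesgue_on:
  "D \<in> sets lebesgue \<Longrightarrow> (\<integral>\<^sup>+ x\<in>D. f x \<partial>lebesgue) = (\<integral>\<^sup>+ x. f x \<partial>lebesgue_on D)"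
  by (subst nn_integral_restrict_space) auto

lemma lebesgue_on_measurable_borel:
  "f \<in> borel_measurable borel \<Longrightarrow> f \<in> borel_measurable (lebesgue_on D)"
  by (intro measurable_restrict_space1 measurable_completion) simp

lemma set_lebesgue_integral_eq_lebesgue_on:
  fixes f :: "real^'n::finite \<Rightarrow> real"
  shows "D \<in> sets lebesgue \<Longrightarrow> (LINT x:D|lebesgue. f x) = (\<integral>x. f x \<partial>lebesgue_on D)"
  unfolding set_lebesgue_integral_def by (subst integral_restrict_space) auto

lemma nn_integral_lebesgue_on_eq_lborel:
  assumes f: "f \<in> borel_measurable borel" and D: "D \<in> sets lebesgue" and z: "\<And>x. x \<notin> D \<Longrightarrow> f x = 0"
  shows "(\<integral>\<^sup>+ x. f x \<partial>lebesgue_on D) = (\<integral>\<^sup>+ x. f x \<partial>lborel)"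
proof -
  have "(\<integral>\<^sup>+ x. f x \<partial>lebesgue_on D) = (\<integral>\<^sup>+ x. f x * indicator D x \<partial>lebesgue)"
    using D by (simp add: nn_set_integral_eq_lebesgue_on)
  also have "\<dots> = (\<integral>\<^sup>+ x. f x \<partial>lebesgue)"
    by (intro nn_integral_cong) (auto simp: indicator_def z)
  finally show ?thesis by (simp add: nn_integral_completion)
qed

lemma integral_lebesgue_on_eq_lborel:
  fixes f :: "real^'n::finite \<Rightarrow> real"
  assumes f: "f \<in> borel_measurable borel" and D: "D \<in> sets lebesgue" and z: "\<And>x. x \<notin> D \<Longrightarrow> f x = 0"
  shows "(\<integral>x. f x \<partial>lebesgue_on D) = (\<integral>x. f x \<partial>lborel)"
proof -
  have "(\<integral>x. f x \<partial>lebesgue_on D) = (\<integral>x. indicator D x *\<^sub>R f x \<partial>lebesgue)"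
    using D by (subst integral_restrict_space) auto
  also have "\<dots> = (\<integral>x. f x \<partial>lebesgue)"
    by (intro Bochner_Integration.integral_cong) (auto simp: indicator_def z)
  also have "\<dots> = (\<integral>x. f x \<partial>lborel)" using f by (intro integral_completion) simp
  finally show ?thesis .
qed

lemma test_fun_outside:
  assumes "test_fun D f" "x \<notin> D"
  shows "f x = 0" "grad f x = 0"
  using assms eq_0_outside_tsupport[of x f] grad_eq_0_outside_tsupport[of x f] by (auto simp: test_fun_def)

section \<open>Approximation of W10 functions by test functions\<close>

lemma sobolev_W10_measurable:
  assumes "sobolev_W10 m D u Du"
  shows "u \<in> borel_measurable (lebesgue_on D)" "Du \<in> borel_measurable (lebesgue_on D)"
  using assms by (auto simp: sobolev_W10_def lp_on_def intro!: borel_measurable_vec_components)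

text \<open>Bridge from the componentwise integrability in \<open>sobolev_W10\<close> to the
  Euclidean norm of the gradient: the norm is at most the dimension times the largest
  component.\<close>

lemma norm_powr_le_sum_powr:
  fixes y :: "real^'n::finite"
  assumes "m \<ge> 0"
  shows "norm y powr m \<le> (real CARD('n)) powr m * (\<Sum>i\<in>UNIV. \<bar>y $ i\<bar> powr m)"
proof -
  define M where "M = Max (range (\<lambda>i. \<bar>y $ i\<bar>))"
  have "M \<in> range (\<lambda>i. \<bar>y $ i\<bar>)" unfolding M_def by (intro Max_in) auto
  then obtain i where i: "M = \<bar>y $ i\<bar>" by auto
  have "norm y \<le> (\<Sum>i\<in>UNIV. \<bar>y $ i\<bar>)" by (rule norm_le_l1_cart)
  also have "\<dots> \<le> (\<Sum>i\<in>(UNIV::'n set). M)" by (intro sum_mono) (auto simp: M_def)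
  finally have "norm y powr m \<le> (real CARD('n) * M) powr m"
    using assms by (intro powr_mono2) auto
  also have "\<dots> = real CARD('n) powr m * \<bar>y $ i\<bar> powr m" by (simp add: powr_mult i)
  also have "\<dots> \<le> real CARD('n) powr m * (\<Sum>i\<in>UNIV. \<bar>y $ i\<bar> powr m)"
    by (intro mult_left_mono member_le_sum) auto
  finally show ?thesis .
qed

lemma sobolev_W10_integrals_finite:
  fixes u :: "real^'n::finite \<Rightarrow> real"
  assumes u: "sobolev_W10 m D u Du" and m: "m \<ge> 1" and D: "D \<in> sets lebesgue"
  shows "(\<integral>\<^sup>+ x. ennreal (\<bar>u x\<bar> powr m) \<partial>lebesgue_on D) < \<infinity>"
    "(\<integral>\<^sup>+ x. ennreal (norm (Du x) powr m) \<partial>lebesgue_on D) < \<infinity>"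
proof -
  show "(\<integral>\<^sup>+ x. ennreal (\<bar>u x\<bar> powr m) \<partial>lebesgue_on D) < \<infinity>"
    using u D by (auto simp: sobolev_W10_def lp_on_def nn_set_integral_eq_lebesgue_on)
  have [measurable]: "(\<lambda>x. Du x $ i) \<in> borel_measurable (lebesgue_on D)" for i
    using u by (auto simp: sobolev_W10_def lp_on_def)
  have f: "(\<integral>\<^sup>+ x. ennreal (\<bar>Du x $ i\<bar> powr m) \<partial>lebesgue_on D) < \<infinity>" for i
    using u D by (auto simp: sobolev_W10_def lp_on_def nn_set_integral_eq_lebesgue_on)
  have "(\<integral>\<^sup>+ x. ennreal (norm (Du x) powr m) \<partial>lebesgue_on D)
     \<le> (\<integral>\<^sup>+ x. ennreal (real CARD('n) powr m) * (\<Sum>i\<in>UNIV. ennreal (\<bar>Du x $ i\<bar> powr m)) \<partial>lebesgue_on D)"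
    using norm_powr_le_sum_powr[of m "Du _"] m
    by (intro nn_integral_mono) (simp add: ennreal_mult'[symmetric] sum_ennreal ennreal_leI)
  also have "\<dots> = ennreal (real CARD('n) powr m) * (\<Sum>i\<in>UNIV. \<integral>\<^sup>+ x. ennreal (\<bar>Du x $ i\<bar> powr m) \<partial>lebesgue_on D)"
    by (subst nn_integral_cmult) (auto simp: nn_integral_sum simp del: sum_ennreal)
  also have "\<dots> < \<infinity>" using f by (auto simp: ennreal_mult_less_top less_top)
  finally show "(\<integral>\<^sup>+ x. ennreal (norm (Du x) powr m) \<partial>lebesgue_on D) < \<infinity>" .
qed

text \<open>The errors of function and gradient are added before a subsequence is extracted, so that
  a single subsequence converges almost everywhere for both.\<close>

lemma sobolev_W10_approx:
  fixes u :: "real^'n::finite \<Rightarrow> real"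
  assumes u: "sobolev_W10 m D u Du" and m: "m \<ge> 1" and D: "D \<in> sets lebesgue"
  obtains f where "\<And>k. test_fun D (f k)"
    "(\<lambda>k. \<integral>\<^sup>+ x. ennreal (\<bar>f k x - u x\<bar> powr m) \<partial>lebesgue_on D) \<longlonglongrightarrow> 0"
    "(\<lambda>k. \<integral>\<^sup>+ x. ennreal (norm (grad (f k) x - Du x) powr m) \<partial>lebesgue_on D) \<longlonglongrightarrow> 0"
    "AE x in lebesgue_on D. (\<lambda>k. f k x) \<longlonglongrightarrow> u x"
    "AE x in lebesgue_on D. (\<lambda>k. grad (f k) x) \<longlonglongrightarrow> Du x"
proof -
  note [measurable] = sobolev_W10_measurable[OF u]
  from u D obtain f where f: "\<And>k. test_fun D (f k)"
    "(\<lambda>k. \<integral>\<^sup>+ x. ennreal (\<bar>f k x - u x\<bar> powr m) \<partial>lebesgue_on D) \<longlonglongrightarrow> 0"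
    "(\<lambda>k. \<integral>\<^sup>+ x. ennreal (norm (grad (f k) x - Du x) powr m) \<partial>lebesgue_on D) \<longlonglongrightarrow> 0"
    by (auto simp: sobolev_W10_def nn_set_integral_eq_lebesgue_on)
  have [measurable]: "f k \<in> borel_measurable (lebesgue_on D)" "grad (f k) \<in> borel_measurable (lebesgue_on D)" for k
    using C1c_measurable(1,2)[OF test_fun_C1c[OF f(1)]] by (auto intro: lebesgue_on_measurable_borel)
  define g where "g = (\<lambda>k x. \<bar>f k x - u x\<bar> powr m + norm (grad (f k) x - Du x) powr m)"
  have "(\<lambda>k. (\<integral>\<^sup>+ x. ennreal (\<bar>f k x - u x\<bar> powr m) \<partial>lebesgue_on D)
      + (\<integral>\<^sup>+ x. ennreal (norm (grad (f k) x - Du x) powr m) \<partial>lebesgue_on D)) \<longlonglongrightarrow> 0 + 0"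
    by (intro tendsto_add f)
  then have "(\<lambda>k. \<integral>\<^sup>+ x. ennreal (g k x) \<partial>lebesgue_on D) \<longlonglongrightarrow> 0"
    unfolding g_def by (subst ennreal_plus, simp, simp, subst nn_integral_add) auto
  then obtain r where r: "strict_mono r" "AE x in lebesgue_on D. (\<lambda>k. g (r k) x) \<longlonglongrightarrow> 0"
    by (rule nn_tendsto_0_AE_subseq[rotated 2]) (auto simp: g_def)
  have AE: "AE x in lebesgue_on D. (\<lambda>k. f (r k) x) \<longlonglongrightarrow> u x \<and> (\<lambda>k. grad (f (r k)) x) \<longlonglongrightarrow> Du x"
    using r(2)
  proof eventually_elim
    case (elim x)
    have "(\<lambda>k. \<bar>f (r k) x - u x\<bar> powr m) \<longlonglongrightarrow> 0" "(\<lambda>k. norm (grad (f (r k)) x - Du x) powr m) \<longlonglongrightarrow> 0"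
      by (rule tendsto_sandwich[OF _ _ tendsto_const elim]; simp add: g_def)+
    then have "(\<lambda>k. \<bar>f (r k) x - u x\<bar>) \<longlonglongrightarrow> 0" "(\<lambda>k. norm (grad (f (r k)) x - Du x)) \<longlonglongrightarrow> 0"
      using m by (auto elim!: tendsto_0_powrD)
    then show ?case
      by (auto simp: tendsto_rabs_zero_iff LIM_zero_iff tendsto_norm_zero_iff)
  qed
  show ?thesis
  proof (rule that[of "\<lambda>k. f (r k)"])
    show "(\<lambda>k. \<integral>\<^sup>+ x. ennreal (\<bar>f (r k) x - u x\<bar> powr m) \<partial>lebesgue_on D) \<longlonglongrightarrow> 0"
      "(\<lambda>k. \<integral>\<^sup>+ x. ennreal (norm (grad (f (r k)) x - Du x) powr m) \<partial>lebesgue_on D) \<longlonglongrightarrow> 0"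
      using LIMSEQ_subseq_LIMSEQ[OF f(2) r(1)] LIMSEQ_subseq_LIMSEQ[OF f(3) r(1)] by (simp_all only: o_def)
    show "test_fun D (f (r k))" for k by (rule f(1))
    show "AE x in lebesgue_on D. (\<lambda>k. f (r k) x) \<longlonglongrightarrow> u x"
      by (rule eventually_mono[OF AE]) (rule conjunct1)
    show "AE x in lebesgue_on D. (\<lambda>k. grad (f (r k)) x) \<longlonglongrightarrow> Du x"
      by (rule eventually_mono[OF AE]) (rule conjunct2)
  qed
qed

text \<open>The factor \<open>2 powr m\<close> in the conclusion spares Minkowski's inequality.\<close>
lemma sobolev_W10_trace:
  fixes w :: "real^'n::finite \<Rightarrow> ennreal"
  assumes u: "sobolev_W10 m D u Du" and m: "m \<ge> 1" and D: "D \<in> sets lebesgue"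
    and w[measurable]: "w \<in> borel_measurable (lebesgue_on D)" and wfin: "\<And>x. w x \<noteq> top" and c: "c \<ge> 0" and e: "e > 0" and s: "s > 0"
    and tr: "\<And>f F. test_fun D f \<Longrightarrow> F \<ge> 0 \<Longrightarrow> (\<integral>\<^sup>+ x. ennreal (norm (grad f x) powr m) \<partial>lebesgue_on D) \<le> ennreal F
       \<Longrightarrow> (\<integral>\<^sup>+ x. w x * ennreal (\<bar>f x\<bar> powr s) \<partial>lebesgue_on D) \<le> ennreal (c * F powr e)"
    and F: "F \<ge> 0" "(\<integral>\<^sup>+ x. ennreal (norm (Du x) powr m) \<partial>lebesgue_on D) \<le> ennreal F"
  shows "(\<integral>\<^sup>+ x. w x * ennreal (\<bar>u x\<bar> powr s) \<partial>lebesgue_on D) \<le> ennreal (c * (2 powr m * F) powr e)"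
proof -
  note [measurable] = sobolev_W10_measurable[OF u]
  obtain f where f: "\<And>k. test_fun D (f k)"
    "(\<lambda>k. \<integral>\<^sup>+ x. ennreal (\<bar>f k x - u x\<bar> powr m) \<partial>lebesgue_on D) \<longlonglongrightarrow> 0"
    "(\<lambda>k. \<integral>\<^sup>+ x. ennreal (norm (grad (f k) x - Du x) powr m) \<partial>lebesgue_on D) \<longlonglongrightarrow> 0"
    "AE x in lebesgue_on D. (\<lambda>k. f k x) \<longlonglongrightarrow> u x"
    "AE x in lebesgue_on D. (\<lambda>k. grad (f k) x) \<longlonglongrightarrow> Du x"
    by (rule sobolev_W10_approx[OF u m D]) (rule that)
  have [measurable]: "f k \<in> borel_measurable (lebesgue_on D)" "grad (f k) \<in> borel_measurable (lebesgue_on D)" for k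
    using C1c_measurable(1,2)[OF test_fun_C1c[OF f(1)]] by (auto intro: lebesgue_on_measurable_borel)
  \<comment> \<open>The energies of the approximants are estimated by \<open>F\<close> plus the
    approximation error. A slack \<open>\<delta>\<close> covers that error on a tail of the
    sequence, and it is sent to 0 once Fatou has been applied.\<close>
  have \<delta>: "(\<integral>\<^sup>+ x. w x * ennreal (\<bar>u x\<bar> powr s) \<partial>lebesgue_on D) \<le> ennreal (c * (2 powr m * (F + \<delta>)) powr e)"
    if \<delta>: "\<delta> > 0" for \<delta>
  proof -
    have "eventually (\<lambda>k. (\<integral>\<^sup>+ x. ennreal (norm (grad (f k) x - Du x) powr m) \<partial>lebesgue_on D) < ennreal \<delta>) sequentially"
      using f(3) by (rule order_tendstoD) (use \<delta> in simp)
    then obtain K where K: "\<And>k. k \<ge> K \<Longrightarrow> (\<integral>\<^sup>+ x. ennreal (norm (grad (f k) x - Du x) powr m) \<partial>lebesgue_on D) < ennreal \<delta>"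
      by (auto simp: eventually_sequentially)
    show ?thesis
    proof (rule nn_integral_Fatou_bound[where u="\<lambda>k x. w x * ennreal (\<bar>f (k + K) x\<bar> powr s)"])
      show "AE x in lebesgue_on D. (\<lambda>k. w x * ennreal (\<bar>f (k + K) x\<bar> powr s)) \<longlonglongrightarrow> w x * ennreal (\<bar>u x\<bar> powr s)"
        using f(4)
      proof eventually_elim
        case (elim x)
        from LIMSEQ_ignore_initial_segment[OF this, of K]
        have "(\<lambda>k. \<bar>f (k + K) x\<bar> powr s) \<longlonglongrightarrow> \<bar>u x\<bar> powr s"
          using s by (intro tendsto_powr' tendsto_rabs) auto
        then show ?case
          by (intro tendsto_mult_ennreal tendsto_ennrealI tendsto_const)
             (auto simp: wfin)
      qed
    next
      fix k
      have "(\<integral>\<^sup>+ x. ennreal (norm (grad (f (k + K)) x) powr m) \<partial>lebesgue_on D)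
        \<le> (\<integral>\<^sup>+ x. ennreal (2 powr m) * (ennreal (norm (Du x) powr m) + ennreal (norm (grad (f (k + K)) x - Du x) powr m)) \<partial>lebesgue_on D)"
      proof (intro nn_integral_mono)
        fix x
        have "norm (grad (f (k + K)) x) \<le> norm (Du x) + norm (grad (f (k + K)) x - Du x)"
          by (metis norm_triangle_sub add.commute)
        then have "norm (grad (f (k + K)) x) powr m \<le> (norm (Du x) + norm (grad (f (k + K)) x - Du x)) powr m"
          using m by (intro powr_mono2) auto
        also have "\<dots> \<le> 2 powr m * (norm (Du x) powr m + norm (grad (f (k + K)) x - Du x) powr m)"
          using m by (intro powr_add_le_2) auto
        finally show "ennreal (norm (grad (f (k + K)) x) powr m)
           \<le> ennreal (2 powr m) * (ennreal (norm (Du x) powr m) + ennreal (norm (grad (f (k + K)) x - Du x) powr m))"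
          by (simp add: ennreal_mult'[symmetric] ennreal_plus[symmetric] ennreal_leI del: ennreal_plus)
      qed
      also have "\<dots> = ennreal (2 powr m) * ((\<integral>\<^sup>+ x. ennreal (norm (Du x) powr m) \<partial>lebesgue_on D)
          + (\<integral>\<^sup>+ x. ennreal (norm (grad (f (k + K)) x - Du x) powr m) \<partial>lebesgue_on D))"
        by (subst nn_integral_cmult) (auto simp: nn_integral_add)
      also have "\<dots> \<le> ennreal (2 powr m) * (ennreal F + ennreal \<delta>)"
        by (intro mult_left_mono add_mono F less_imp_le[OF K]) auto
      also have "\<dots> = ennreal (2 powr m * (F + \<delta>))"
        using F \<delta> by (simp add: ennreal_mult'[symmetric] ennreal_plus[symmetric] del: ennreal_plus)
      finally show "(\<integral>\<^sup>+ x. w x * ennreal (\<bar>f (k + K) x\<bar> powr s) \<partial>lebesgue_on D) \<le> ennreal (c * (2 powr m * (F + \<delta>)) powr e)"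
        using F \<delta> by (intro tr f(1)) auto
    qed measurable
  qed
  have "((\<lambda>\<delta>. ennreal (c * (2 powr m * (F + \<delta>)) powr e)) \<longlongrightarrow> ennreal (c * (2 powr m * (F + 0)) powr e)) (at_right 0)"
    using e F by (intro tendsto_ennrealI tendsto_intros) (auto simp: eventually_at_right_less intro!: eventually_mono[OF eventually_at_right_less])
  then have "(\<integral>\<^sup>+ x. w x * ennreal (\<bar>u x\<bar> powr s) \<partial>lebesgue_on D) \<le> ennreal (c * (2 powr m * (F + 0)) powr e)"
    by (rule tendsto_lowerbound) (auto intro!: eventually_mono[OF eventually_at_right_less] \<delta>)
  then show ?thesis by simp
qed

text \<open>On a finite measure Holder's inequality turns convergence in the power \<open>m\<close>
  into L1 convergence, which survives multiplication by a bounded function. Integrability of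
  \<open>v\<close> comes along: it differs from some \<open>f k\<close> by an integrable
  function.\<close>

lemma tendsto_integral_bounded_mult:
  fixes f :: "nat \<Rightarrow> 'a \<Rightarrow> real"
  assumes fin: "emeasure M (space M) < \<infinity>" and m: "m \<ge> 1"
    and fi: "\<And>k. integrable M (f k)" and v[measurable]: "v \<in> borel_measurable M"
    and lim: "(\<lambda>k. \<integral>\<^sup>+ x. ennreal (\<bar>f k x - v x\<bar> powr m) \<partial>M) \<longlonglongrightarrow> 0"
    and \<phi>[measurable]: "\<phi> \<in> borel_measurable M" and L: "\<And>x. \<bar>\<phi> x\<bar> \<le> L"
  shows "(\<lambda>k. \<integral>x. f k x * \<phi> x \<partial>M) \<longlonglongrightarrow> (\<integral>x. v x * \<phi> x \<partial>M)"
proof -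
  have [measurable]: "f k \<in> borel_measurable M" for k using fi by auto
  have L0: "L \<ge> 0" using L[of undefined] by linarith
  define a where "a = (\<lambda>k. enn2real (\<integral>\<^sup>+ x. ennreal (\<bar>f k x - v x\<bar> powr m) \<partial>M))"
  define B where "B = enn2real (emeasure M (space M))"
  have B: "emeasure M (space M) = ennreal B" "B \<ge> 0" using fin by (auto simp: B_def)
  have a: "a \<longlonglongrightarrow> 0" unfolding a_def using lim by (intro tendsto_enn2real) auto
  have "eventually (\<lambda>k. (\<integral>\<^sup>+ x. ennreal (\<bar>f k x - v x\<bar> powr m) \<partial>M) < 1) sequentially"
    using lim by (rule order_tendstoD) simp
  then have ev: "eventually (\<lambda>k. (\<integral>\<^sup>+ x. ennreal \<bar>f k x - v x\<bar> \<partial>M) \<le> ennreal (a k powr (1/m) * B powr (1 - 1/m))) sequentially"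
  proof eventually_elim
    case (elim k)
    then have "(\<integral>\<^sup>+ x. ennreal (\<bar>f k x - v x\<bar> powr m) \<partial>M) = ennreal (a k)"
      unfolding a_def by (intro ennreal_enn2real[symmetric]) (rule order.strict_trans[OF _ ennreal_one_less_top])
    then show ?case using m B by (intro nn_integral_Holder_finite) (auto simp: a_def)
  qed
  have "(\<lambda>k. ennreal (a k powr (1/m) * B powr (1 - 1/m))) \<longlonglongrightarrow> ennreal (0 powr (1/m) * B powr (1 - 1/m))"
    using m a by (intro tendsto_ennrealI tendsto_intros) (auto simp: a_def)
  then have L1: "(\<lambda>k. \<integral>\<^sup>+ x. ennreal \<bar>f k x - v x\<bar> \<partial>M) \<longlonglongrightarrow> 0"
    by (intro tendsto_sandwich[OF _ ev tendsto_const]) auto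
  have vi: "integrable M v"
  proof -
    from order_tendstoD(2)[OF L1, of 1] obtain k where k: "(\<integral>\<^sup>+ x. ennreal \<bar>f k x - v x\<bar> \<partial>M) < 1"
      by (auto simp: eventually_sequentially)
    have "integrable M (\<lambda>x. f k x - v x)"
      using k by (intro integrableI_bounded) (auto intro: order.strict_trans)
    from Bochner_Integration.integrable_diff[OF fi[of k] this] show ?thesis by simp
  qed
  show ?thesis
  proof (rule tendsto_L1_int)
    show "integrable M (\<lambda>x. f k x * \<phi> x)" for k
      by (rule Bochner_Integration.integrable_bound[OF integrable_mult_right[OF fi[of k], of L]])
         (use L L0 in \<open>auto simp: abs_mult mult.commute intro!: mult_right_mono\<close>)
    show "integrable M (\<lambda>x. v x * \<phi> x)"
      by (rule Bochner_Integration.integrable_bound[OF integrable_mult_right[OF vi, of L]])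
         (use L L0 in \<open>auto simp: abs_mult mult.commute intro!: mult_right_mono\<close>)
    have "(\<lambda>k. ennreal L * (\<integral>\<^sup>+ x. ennreal \<bar>f k x - v x\<bar> \<partial>M)) \<longlonglongrightarrow> ennreal L * 0"
      by (intro tendsto_mult_ennreal L1 tendsto_const) auto
    then have lim': "(\<lambda>k. ennreal L * (\<integral>\<^sup>+ x. ennreal \<bar>f k x - v x\<bar> \<partial>M)) \<longlonglongrightarrow> 0" by simp
    show "(\<lambda>k. \<integral>\<^sup>+ x. ennreal (norm (f k x * \<phi> x - v x * \<phi> x)) \<partial>M) \<longlonglongrightarrow> 0"
    proof (rule tendsto_sandwich[OF _ _ tendsto_const lim'])
      show "eventually (\<lambda>k. (\<integral>\<^sup>+ x. ennreal (norm (f k x * \<phi> x - v x * \<phi> x)) \<partial>M) \<le> ennreal L * (\<integral>\<^sup>+ x. ennreal \<bar>f k x - v x\<bar> \<partial>M)) sequentially"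
      proof (intro always_eventually allI)
        fix k
        have "norm (f k x * \<phi> x - v x * \<phi> x) \<le> L * \<bar>f k x - v x\<bar>" for x
        proof -
          have "norm (f k x * \<phi> x - v x * \<phi> x) = \<bar>\<phi> x\<bar> * \<bar>f k x - v x\<bar>"
            unfolding real_norm_def left_diff_distrib[symmetric] abs_mult by (rule mult.commute)
          also have "\<dots> \<le> L * \<bar>f k x - v x\<bar>" using L[of x] by (intro mult_right_mono) auto
          finally show ?thesis .
        qed
        then have "(\<integral>\<^sup>+ x. ennreal (norm (f k x * \<phi> x - v x * \<phi> x)) \<partial>M) \<le> (\<integral>\<^sup>+ x. ennreal L * ennreal \<bar>f k x - v x\<bar> \<partial>M)"
          using L0 by (intro nn_integral_mono) (simp add: ennreal_mult'[symmetric] ennreal_leI)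
        then show "(\<integral>\<^sup>+ x. ennreal (norm (f k x * \<phi> x - v x * \<phi> x)) \<partial>M) \<le> ennreal L * (\<integral>\<^sup>+ x. ennreal \<bar>f k x - v x\<bar> \<partial>M)"
          by (simp add: nn_integral_cmult)
      qed
    qed auto
  qed
qed

section \<open>Limits of weak gradients and the chain rule\<close>

lemma integrable_lebesgue_on_of_lborel:
  fixes f :: "real^'n::finite \<Rightarrow> real"
  assumes "integrable lborel f" "D \<in> sets lebesgue"
  shows "integrable (lebesgue_on D) f"
proof -
  have "integrable lebesgue f" using assms(1) by (simp add: integrable_completion)
  then have "integrable lebesgue (\<lambda>x. indicator D x *\<^sub>R f x)"
    using assms(2) by (intro integrable_mult_indicator)
  then show ?thesis using assms(2) by (simp add: integrable_restrict_space)
qed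

lemma emeasure_lebesgue_on_space:
  "D \<in> sets lebesgue \<Longrightarrow> emeasure (lebesgue_on D) (space (lebesgue_on D)) = emeasure lebesgue D"
  by (simp add: emeasure_restrict_space)

lemma emeasure_bounded_finite_lebesgue:
  fixes D :: "(real^'n::finite) set"
  assumes "bounded D" "open D"
  shows "emeasure lebesgue D < \<infinity>"
  using emeasure_bounded_finite[OF assms(1)] assms(2) by (simp add: emeasure_completion)

text \<open>Integration by parts holds for each \<open>h k\<close>, and both sides converge because
  \<open>g\<close> and its derivatives are bounded. This supplies the weak gradient that
  \<open>sobolev_W10\<close> demands in addition to approximability.\<close>

lemma has_weak_gradient_limit:
  fixes v :: "real^'n::finite \<Rightarrow> real"
  assumes D: "open D" "bounded D" and m: "m \<ge> 1" and h: "\<And>k. test_fun D (h k)"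
    and v: "v \<in> borel_measurable (lebesgue_on D)" and Dv: "Dv \<in> borel_measurable (lebesgue_on D)"
    and lim: "(\<lambda>k. \<integral>\<^sup>+ x. ennreal (\<bar>h k x - v x\<bar> powr m) \<partial>lebesgue_on D) \<longlonglongrightarrow> 0"
    and limD: "(\<lambda>k. \<integral>\<^sup>+ x. ennreal (norm (grad (h k) x - Dv x) powr m) \<partial>lebesgue_on D) \<longlonglongrightarrow> 0"
  shows "has_weak_gradient D v Dv"
  unfolding has_weak_gradient_def
proof (intro allI impI)
  fix g i assume g: "test_fun D g"
  have Ds: "D \<in> sets lebesgue" using D(1) by simp
  note hC = test_fun_C1c[OF h] and gC = test_fun_C1c[OF g]
  have cs: "compact (tsupport (h k))" "compact (tsupport g)" for k using h g by (auto simp: test_fun_def)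
  have fin: "emeasure (lebesgue_on D) (space (lebesgue_on D)) < \<infinity>"
    unfolding emeasure_lebesgue_on_space[OF Ds] by (rule emeasure_bounded_finite_lebesgue[OF D(2,1)])
  have i1: "integrable (lebesgue_on D) (h k)" for k
    by (intro integrable_lebesgue_on_of_lborel integrable_continuous_compact_tsupport C1c_measurable(3)[OF hC] cs Ds)
  have i2: "integrable (lebesgue_on D) (pd i (h k))" for k
    by (intro integrable_lebesgue_on_of_lborel integrable_continuous_compact_tsupport C1c_pd[OF hC] Ds)
  have gm: "g \<in> borel_measurable (lebesgue_on D)" "pd i g \<in> borel_measurable (lebesgue_on D)"
    by (intro lebesgue_on_measurable_borel borel_measurable_continuous_onI C1c_measurable(3)[OF gC] C1c_pd(1)[OF gC])+
  have Dvi[measurable]: "(\<lambda>x. Dv x $ i) \<in> borel_measurable (lebesgue_on D)"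
    using borel_measurable_inner[OF Dv borel_measurable_const[of "axis i 1"]] by (simp add: inner_axis)
  obtain L where L: "\<And>x. \<bar>g x\<bar> \<le> L"
    using continuous_compact_tsupport_bounded[OF C1c_measurable(3)[OF gC] cs(2)] by metis
  obtain L' where L': "\<And>x. \<bar>pd i g x\<bar> \<le> L'"
    using continuous_compact_tsupport_bounded[OF C1c_pd[OF gC]] by metis
  have l1: "(\<lambda>k. \<integral>x. h k x * pd i g x \<partial>lebesgue_on D) \<longlonglongrightarrow> (\<integral>x. v x * pd i g x \<partial>lebesgue_on D)"
    by (rule tendsto_integral_bounded_mult[OF fin m i1 v lim gm(2) L'])
  have limi: "(\<lambda>k. \<integral>\<^sup>+ x. ennreal (\<bar>pd i (h k) x - Dv x $ i\<bar> powr m) \<partial>lebesgue_on D) \<longlonglongrightarrow> 0"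
  proof (rule tendsto_sandwich[OF _ _ tendsto_const limD])
    show "\<forall>\<^sub>F k in sequentially. (\<integral>\<^sup>+ x. ennreal (\<bar>pd i (h k) x - Dv x $ i\<bar> powr m) \<partial>lebesgue_on D)
       \<le> (\<integral>\<^sup>+ x. ennreal (norm (grad (h k) x - Dv x) powr m) \<partial>lebesgue_on D)"
    proof (intro always_eventually allI nn_integral_mono ennreal_leI powr_mono2)
      fix k x
      show "\<bar>pd i (h k) x - Dv x $ i\<bar> \<le> norm (grad (h k) x - Dv x)"
        using component_le_norm_cart[of "grad (h k) x - Dv x" i] by (simp add: pd_eq_grad_nth)
    qed (use m in auto)
  qed auto
  have l2: "(\<lambda>k. \<integral>x. pd i (h k) x * g x \<partial>lebesgue_on D) \<longlonglongrightarrow> (\<integral>x. Dv x $ i * g x \<partial>lebesgue_on D)"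
    by (rule tendsto_integral_bounded_mult[OF fin m i2 Dvi limi gm(1) L])
  have "(\<integral>x. h k x * pd i g x \<partial>lebesgue_on D) = - (\<integral>x. pd i (h k) x * g x \<partial>lebesgue_on D)" for k
  proof -
    have "(\<integral>x. h k x * pd i g x \<partial>lebesgue_on D) = (\<integral>x. h k x * pd i g x \<partial>lborel)"
      by (intro integral_lebesgue_on_eq_lborel borel_measurable_times borel_measurable_continuous_onI
          C1c_measurable(3)[OF hC] C1c_pd(1)[OF gC] Ds) (simp add: test_fun_outside[OF g] pd_eq_grad_nth)
    moreover have "(\<integral>x. pd i (h k) x * g x \<partial>lebesgue_on D) = (\<integral>x. pd i (h k) x * g x \<partial>lborel)"
      by (intro integral_lebesgue_on_eq_lborel borel_measurable_times borel_measurable_continuous_onI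
          C1c_measurable(3)[OF gC] C1c_pd(1)[OF hC] Ds) (simp add: test_fun_outside[OF g])
    ultimately show ?thesis using C1c_integration_by_parts[OF hC gC] by simp
  qed
  with l1 have "(\<lambda>k. - (\<integral>x. pd i (h k) x * g x \<partial>lebesgue_on D)) \<longlonglongrightarrow> (\<integral>x. v x * pd i g x \<partial>lebesgue_on D)" by simp
  with tendsto_minus[OF l2] have "(\<integral>x. v x * pd i g x \<partial>lebesgue_on D) = - (\<integral>x. Dv x $ i * g x \<partial>lebesgue_on D)"
    using LIMSEQ_unique by blast
  then show "(LINT x:D|lebesgue. v x * pd i g x) = - (LINT x:D|lebesgue. Dv x $ i * g x)"
    using Ds by (simp add: set_lebesgue_integral_eq_lebesgue_on)
qed

text \<open>Composing the approximating test functions with \<open>G\<close> gives test functions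
  again. The gradient error splits into \<open>G' (f k x)\<close> times the old error, harmless
  since \<open>\<bar>G' t\<bar> \<le> 1\<close>, and \<open>G' (f k x) - G' (u x)\<close> times
  \<open>Du x\<close>, which tends to 0 by continuity of \<open>G'\<close> and dominated
  convergence. The sharp truncation would fail here, its derivative having jumps.\<close>

lemma sobolev_W10_compose:
  fixes u :: "real^'n::finite \<Rightarrow> real"
  assumes u: "sobolev_W10 m D u Du" and D: "open D" "bounded D" and m: "m \<ge> 1"
    and G: "\<And>k. smooth_upto k G" "G 0 = 0" and G': "\<And>t. (G has_real_derivative G' t) (at t)" "continuous_on UNIV G'"
    and G'1: "\<And>t. \<bar>G' t\<bar> \<le> 1" 
  shows "sobolev_W10 m D (\<lambda>x. G (u x)) (\<lambda>x. G' (u x) *\<^sub>R Du x)"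
proof -
  note [measurable] = sobolev_W10_measurable[OF u]
  have Ds: "D \<in> sets lebesgue" using D(1) by simp
  have Glip: "\<bar>G s - G t\<bar> \<le> \<bar>s - t\<bar>" for s t
    using field_differentiable_bound[of UNIV G G' 1 s t] G' G'1 by auto
  then have Gle: "\<bar>G t\<bar> \<le> \<bar>t\<bar>" for t using Glip[of t 0] G(2) by simp
  have [measurable]: "G \<in> borel_measurable borel" "G' \<in> borel_measurable borel"
    using G(1)[of 0] G'(2) by (auto intro: borel_measurable_continuous_onI)
  obtain f where f: "\<And>k. test_fun D (f k)"
    "(\<lambda>k. \<integral>\<^sup>+ x. ennreal (\<bar>f k x - u x\<bar> powr m) \<partial>lebesgue_on D) \<longlonglongrightarrow> 0"
    "(\<lambda>k. \<integral>\<^sup>+ x. ennreal (norm (grad (f k) x - Du x) powr m) \<partial>lebesgue_on D) \<longlonglongrightarrow> 0"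
    "AE x in lebesgue_on D. (\<lambda>k. f k x) \<longlonglongrightarrow> u x"
    "AE x in lebesgue_on D. (\<lambda>k. grad (f k) x) \<longlonglongrightarrow> Du x"
    by (rule sobolev_W10_approx[OF u m Ds]) (rule that)
  have fm[measurable]: "f k \<in> borel_measurable (lebesgue_on D)" "grad (f k) \<in> borel_measurable (lebesgue_on D)" for k
    using C1c_measurable(1,2)[OF test_fun_C1c[OF f(1)]] by (auto intro: lebesgue_on_measurable_borel)
  define h where "h = (\<lambda>k x. G (f k x))"
  have h: "test_fun D (h k)" for k
    unfolding h_def by (rule test_fun_compose[OF f(1) G])
  have gh: "grad (h k) x = G' (f k x) *\<^sub>R grad (f k) x" for k x
    unfolding h_def by (rule grad_compose[OF test_fun_C1c[OF f(1)] G'(1)])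
  have lim1: "(\<lambda>k. \<integral>\<^sup>+ x. ennreal (\<bar>h k x - G (u x)\<bar> powr m) \<partial>lebesgue_on D) \<longlonglongrightarrow> 0"
    by (rule tendsto_sandwich[OF _ _ tendsto_const f(2)])
       (use m in \<open>auto simp: h_def intro!: always_eventually nn_integral_mono ennreal_leI powr_mono2 Glip\<close>)
  define R where "R = (\<lambda>k x. ennreal (\<bar>G' (f k x) - G' (u x)\<bar> powr m * norm (Du x) powr m))"
  have Rlim: "(\<lambda>k. \<integral>\<^sup>+ x. R k x \<partial>lebesgue_on D) \<longlonglongrightarrow> (\<integral>\<^sup>+ x. 0 \<partial>lebesgue_on D)"
  proof (rule nn_integral_dominated_convergence[where w="\<lambda>x. ennreal (2 powr m) * ennreal (norm (Du x) powr m)"])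
    show "AE x in lebesgue_on D. R k x \<le> ennreal (2 powr m) * ennreal (norm (Du x) powr m)" for k
    proof (rule AE_I2)
      fix x
      have "\<bar>G' (f k x) - G' (u x)\<bar> \<le> 2" using G'1[of "f k x"] G'1[of "u x"] by linarith
      then have "\<bar>G' (f k x) - G' (u x)\<bar> powr m \<le> 2 powr m" using m by (intro powr_mono2) auto
      then show "R k x \<le> ennreal (2 powr m) * ennreal (norm (Du x) powr m)"
        unfolding R_def by (subst ennreal_mult'[symmetric]) (auto intro!: ennreal_leI mult_right_mono)
    qed
    show "(\<integral>\<^sup>+ x. ennreal (2 powr m) * ennreal (norm (Du x) powr m) \<partial>lebesgue_on D) < \<infinity>"
      using sobolev_W10_integrals_finite(2)[OF u m Ds] by (simp add: nn_integral_cmult ennreal_mult_less_top)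
    show "AE x in lebesgue_on D. (\<lambda>k. R k x) \<longlonglongrightarrow> 0"
      using f(4)
    proof eventually_elim
      case (elim x)
      have "isCont G' (u x)" using G'(2) by (simp add: continuous_on_eq_continuous_at)
      from isCont_tendsto_compose[OF this elim] have "(\<lambda>k. \<bar>G' (f k x) - G' (u x)\<bar>) \<longlonglongrightarrow> 0"
        by (simp add: LIM_zero tendsto_rabs_zero)
      then have "(\<lambda>k. \<bar>G' (f k x) - G' (u x)\<bar> powr m) \<longlonglongrightarrow> 0 powr m"
        using m by (intro tendsto_powr') auto
      then have "(\<lambda>k. \<bar>G' (f k x) - G' (u x)\<bar> powr m * norm (Du x) powr m) \<longlonglongrightarrow> 0 * norm (Du x) powr m"
        by (intro tendsto_mult tendsto_const) simp
      then have "(\<lambda>k. ennreal (\<bar>G' (f k x) - G' (u x)\<bar> powr m * norm (Du x) powr m)) \<longlonglongrightarrow> ennreal 0"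
        by (intro tendsto_ennrealI) simp
      then show ?case by (simp add: R_def)
    qed
  qed (simp_all add: R_def)
  have lim2: "(\<lambda>k. \<integral>\<^sup>+ x. ennreal (norm (grad (h k) x - G' (u x) *\<^sub>R Du x) powr m) \<partial>lebesgue_on D) \<longlonglongrightarrow> 0"
  proof -
    have "(\<lambda>k. ennreal (2 powr m) * ((\<integral>\<^sup>+ x. ennreal (norm (grad (f k) x - Du x) powr m) \<partial>lebesgue_on D) + (\<integral>\<^sup>+ x. R k x \<partial>lebesgue_on D)))
        \<longlonglongrightarrow> ennreal (2 powr m) * (0 + 0)"
      using Rlim by (intro tendsto_mult_ennreal tendsto_add f(3) tendsto_const) auto
    then have l: "(\<lambda>k. ennreal (2 powr m) * ((\<integral>\<^sup>+ x. ennreal (norm (grad (f k) x - Du x) powr m) \<partial>lebesgue_on D) + (\<integral>\<^sup>+ x. R k x \<partial>lebesgue_on D)))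
        \<longlonglongrightarrow> 0" by simp
    show ?thesis
    proof (rule tendsto_sandwich[OF _ _ tendsto_const l])
      show "\<forall>\<^sub>F k in sequentially. (\<integral>\<^sup>+ x. ennreal (norm (grad (h k) x - G' (u x) *\<^sub>R Du x) powr m) \<partial>lebesgue_on D)
         \<le> ennreal (2 powr m) * ((\<integral>\<^sup>+ x. ennreal (norm (grad (f k) x - Du x) powr m) \<partial>lebesgue_on D) + (\<integral>\<^sup>+ x. R k x \<partial>lebesgue_on D))"
      proof (intro always_eventually allI)
        fix k
        have "(\<integral>\<^sup>+ x. ennreal (norm (grad (h k) x - G' (u x) *\<^sub>R Du x) powr m) \<partial>lebesgue_on D)
          \<le> (\<integral>\<^sup>+ x. ennreal (2 powr m) * (ennreal (norm (grad (f k) x - Du x) powr m) + R k x) \<partial>lebesgue_on D)"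
        proof (intro nn_integral_mono)
          fix x
          have "grad (h k) x - G' (u x) *\<^sub>R Du x = G' (f k x) *\<^sub>R (grad (f k) x - Du x) + (G' (f k x) - G' (u x)) *\<^sub>R Du x"
            by (simp add: gh algebra_simps)
          then have "norm (grad (h k) x - G' (u x) *\<^sub>R Du x) \<le> \<bar>G' (f k x)\<bar> * norm (grad (f k) x - Du x) + \<bar>G' (f k x) - G' (u x)\<bar> * norm (Du x)"
            by (metis norm_triangle_ineq norm_scaleR)
          also have "\<dots> \<le> norm (grad (f k) x - Du x) + \<bar>G' (f k x) - G' (u x)\<bar> * norm (Du x)"
            using G'1[of "f k x"] by (simp add: mult_left_le_one_le)
          finally have "norm (grad (h k) x - G' (u x) *\<^sub>R Du x) powr m \<le> (norm (grad (f k) x - Du x) + \<bar>G' (f k x) - G' (u x)\<bar> * norm (Du x)) powr m"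
            using m by (intro powr_mono2) auto
          also have "\<dots> \<le> 2 powr m * (norm (grad (f k) x - Du x) powr m + (\<bar>G' (f k x) - G' (u x)\<bar> * norm (Du x)) powr m)"
            using m by (intro powr_add_le_2) auto
          finally show "ennreal (norm (grad (h k) x - G' (u x) *\<^sub>R Du x) powr m)
             \<le> ennreal (2 powr m) * (ennreal (norm (grad (f k) x - Du x) powr m) + R k x)"
            by (simp add: R_def powr_mult ennreal_mult'[symmetric] ennreal_plus[symmetric] ennreal_leI del: ennreal_plus)
        qed
        also have "\<dots> = ennreal (2 powr m) * ((\<integral>\<^sup>+ x. ennreal (norm (grad (f k) x - Du x) powr m) \<partial>lebesgue_on D) + (\<integral>\<^sup>+ x. R k x \<partial>lebesgue_on D))"
          by (subst nn_integral_cmult) (auto simp: R_def nn_integral_add)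
        finally show "(\<integral>\<^sup>+ x. ennreal (norm (grad (h k) x - G' (u x) *\<^sub>R Du x) powr m) \<partial>lebesgue_on D)
         \<le> ennreal (2 powr m) * ((\<integral>\<^sup>+ x. ennreal (norm (grad (f k) x - Du x) powr m) \<partial>lebesgue_on D) + (\<integral>\<^sup>+ x. R k x \<partial>lebesgue_on D))" .
      qed
    qed auto
  qed
  have wg: "has_weak_gradient D (\<lambda>x. G (u x)) (\<lambda>x. G' (u x) *\<^sub>R Du x)"
    by (rule has_weak_gradient_limit[OF D m h _ _ lim1 lim2]) measurable
  have lp1: "lp_on m D (\<lambda>x. G (u x))"
    unfolding lp_on_def nn_set_integral_eq_lebesgue_on[OF Ds]
  proof
    have "(\<integral>\<^sup>+ x. ennreal (\<bar>G (u x)\<bar> powr m) \<partial>lebesgue_on D) \<le> (\<integral>\<^sup>+ x. ennreal (\<bar>u x\<bar> powr m) \<partial>lebesgue_on D)"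
      using m by (intro nn_integral_mono ennreal_leI powr_mono2 Gle) auto
    also have "\<dots> < \<infinity>" by (rule sobolev_W10_integrals_finite(1)[OF u m Ds])
    finally show "(\<integral>\<^sup>+ x. ennreal (\<bar>G (u x)\<bar> powr m) \<partial>lebesgue_on D) < \<infinity>" .
  qed measurable
  have lp2: "lp_on m D (\<lambda>x. (G' (u x) *\<^sub>R Du x) $ i)" for i
    unfolding lp_on_def nn_set_integral_eq_lebesgue_on[OF Ds]
  proof
    have "(\<lambda>x. Du x \<bullet> axis i 1) \<in> borel_measurable (lebesgue_on D)" by measurable
    then have [measurable]: "(\<lambda>x. Du x $ i) \<in> borel_measurable (lebesgue_on D)" by (simp add: inner_axis)
    show "(\<lambda>x. (G' (u x) *\<^sub>R Du x) $ i) \<in> borel_measurable (lebesgue_on D)"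
      unfolding vector_scaleR_component by measurable
    have "(\<integral>\<^sup>+ x. ennreal (\<bar>(G' (u x) *\<^sub>R Du x) $ i\<bar> powr m) \<partial>lebesgue_on D) \<le> (\<integral>\<^sup>+ x. ennreal (norm (Du x) powr m) \<partial>lebesgue_on D)"
    proof (intro nn_integral_mono ennreal_leI powr_mono2)
      fix x
      have "\<bar>(G' (u x) *\<^sub>R Du x) $ i\<bar> = \<bar>G' (u x)\<bar> * \<bar>Du x $ i\<bar>" by (simp add: abs_mult)
      also have "\<dots> \<le> 1 * norm (Du x)" by (intro mult_mono G'1 component_le_norm_cart) auto
      finally show "\<bar>(G' (u x) *\<^sub>R Du x) $ i\<bar> \<le> norm (Du x)" by simp
    qed (use m in auto)
    also have "\<dots> < \<infinity>" by (rule sobolev_W10_integrals_finite(2)[OF u m Ds])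
    finally show "(\<integral>\<^sup>+ x. ennreal (\<bar>(G' (u x) *\<^sub>R Du x) $ i\<bar> powr m) \<partial>lebesgue_on D) < \<infinity>" .
  qed
  show ?thesis
    unfolding sobolev_W10_def nn_set_integral_eq_lebesgue_on[OF Ds]
    by (intro conjI allI lp1 lp2 wg exI[of _ h] h lim1 lim2)
qed

lemma sobolev_W10_trunc:
  fixes u :: "real^'n::finite \<Rightarrow> real"
  assumes u: "sobolev_W10 m D u Du" and D: "open D" "bounded D" and m: "m \<ge> 1" and k: "k > 0" and e: "\<epsilon> > 0"
  shows "sobolev_W10 m D (\<lambda>x. trunc k \<epsilon> (u x)) (\<lambda>x. trunc' k \<epsilon> (u x) *\<^sub>R Du x)"
proof (rule sobolev_W10_compose[OF u D m smooth_upto_trunc[OF e] _ trunc_has_derivative[OF e] continuous_trunc'[OF e]])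
  show "trunc k \<epsilon> 0 = 0" using k by (simp add: trunc_def bump_def)
  show "\<bar>trunc' k \<epsilon> t\<bar> \<le> 1" for t using trunc'_bounds(1,2)[OF e k, of t] by simp
qed

subsection \<open>The trace inequality in W10 for Morrey weights\<close>

text \<open>In the borderline case \<open>m = n\<close> the trace inequality is used with an exponent \<open>m1 < n\<close>, and for
  non-critical \<open>s\<close> with a growth exponent \<open>\<beta>1 < \<beta>\<close>.\<close>
lemma trace_exponents:
  fixes m n \<beta> s :: real
  assumes n: "2 \<le> n" and m: "1 < m" "m \<le> n" and \<beta>: "\<beta> > n - m" and s: "m < s" "m < n \<Longrightarrow> s \<le> m * \<beta> / (n - m)"
  obtains m1 \<beta>1 where "1 \<le> m1" "m1 < n" "m1 \<le> m" "\<beta>1 \<le> \<beta>" "\<beta>1 > n - m1" "s = m1 * \<beta>1 / (n - m1)"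
proof (cases "m < n")
  case True
  show ?thesis
  \<comment> \<open>The second exponent solves \<open>s = m * \<beta>1 / (n - m)\<close> for
    \<open>\<beta>1\<close>.\<close>
  proof (rule that[of m "s * (n - m) / m"])
    show "s * (n - m) / m \<le> \<beta>" using s(2)[OF True] True m by (simp add: field_simps)
    have "m * (n - m) < s * (n - m)" using s True by (intro mult_strict_right_mono) auto
    then show "s * (n - m) / m > n - m" using m by (simp add: pos_less_divide_eq mult.commute)
  qed (use True m in auto)
next
  case False
  then have mn: "m = n" using m by simp
  have b: "\<beta> > 0" using \<beta> mn by simp
  have s0: "s > 0" using s m by simp
  \<comment> \<open>\<open>s * n / (\<beta> + s)\<close> is the value of \<open>m1\<close> at which
    \<open>s * (n - m1) / m1\<close> equals \<open>\<beta>\<close>; any larger \<open>m1\<close>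
    lowers the growth exponent. The maximum with 1 keeps the gradient exponent admissible.\<close>
  define m1 where "m1 = max 1 (s * n / (\<beta> + s))"
  have "s * n / (\<beta> + s) < n" using b s0 n by (simp add: pos_divide_less_eq distrib_left mult.commute)
  then have m1: "1 \<le> m1" "m1 < n" using n by (auto simp: m1_def)
  show ?thesis
  proof (rule that[of m1 "s * (n - m1) / m1"])
    have "s * n / (\<beta> + s) \<le> m1" by (simp add: m1_def)
    then have "s * n \<le> m1 * (\<beta> + s)" using b s0 by (simp add: pos_divide_le_eq)
    then have "s * (n - m1) \<le> \<beta> * m1" by (simp add: algebra_simps)
    then show "s * (n - m1) / m1 \<le> \<beta>" using m1 by (simp add: pos_divide_le_eq)
    have "m1 * (n - m1) < s * (n - m1)" using s mn m1 by (intro mult_strict_right_mono) auto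
    then show "s * (n - m1) / m1 > n - m1" using m1 by (simp add: pos_less_divide_eq mult.commute)
  qed (use m1 mn in auto)
qed

text \<open>Only balls centred in \<open>D\<close> are tested, as in the Morrey norm; arbitrary
  centres are recovered in \<open>lower_growth_everywhere\<close>.\<close>

definition lower_growth :: "real \<Rightarrow> real \<Rightarrow> (real^'n::finite) set \<Rightarrow> (real^'n \<Rightarrow> real) \<Rightarrow> bool" where
  "lower_growth C \<beta> D w \<longleftrightarrow> w \<in> borel_measurable (lebesgue_on D) \<and> (\<forall>x. w x \<ge> 0) \<and>
     (\<forall>x0\<in>D. \<forall>\<rho>>0. (\<integral>\<^sup>+ x. ennreal (w x) * indicator (ball x0 \<rho>) x \<partial>lebesgue_on D) \<le> ennreal (C * \<rho> powr \<beta>))"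

text \<open>The added 1 accounts for the ball being open; the absolute value keeps the radius
  positive for every real \<open>d\<close>.\<close>

lemma subset_ball_diameter:
  fixes D :: "(real^'n::finite) set"
  assumes "bounded D" "diameter D \<le> d" "x0 \<in> D"
  shows "D \<subseteq> ball x0 (\<bar>d\<bar> + 1)"
proof
  fix x assume "x \<in> D"
  then have "dist x0 x \<le> diameter D" using assms by (intro diameter_bounded_bound)
  then show "x \<in> ball x0 (\<bar>d\<bar> + 1)" using assms(2) by simp
qed

text \<open>A ball of radius \<open>r\<close> that meets \<open>D\<close> lies in a ball of radius
  \<open>2 * r\<close> about a point of \<open>D\<close>. Capping this radius at
  \<open>\<bar>d\<bar> + 1\<close> allows the exponent to be lowered from \<open>\<beta>\<close> to
  \<open>\<beta>1\<close> at the cost of a power of the cap.\<close>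

lemma lower_growth_everywhere:
  fixes D :: "(real^'n::finite) set"
  assumes w: "lower_growth C \<beta> D w" and D: "open D" "bounded D" "diameter D \<le> d" and C: "C \<ge> 0"
    and \<beta>1: "\<beta>1 \<le> \<beta>" "\<beta>1 > 0" and r: "r > 0"
  shows "(\<integral>\<^sup>+ x. ennreal (w x) * indicator (ball y r) x \<partial>lebesgue_on D)
      \<le> ennreal (C * (\<bar>d\<bar> + 1) powr (\<beta> - \<beta>1) * 2 powr \<beta>1 * r powr \<beta>1)"
proof (cases "ball y r \<inter> D = {}")
  case True
  then have "indicator (ball y r) x = (0::ennreal)" if "x \<in> D" for x using that by (auto simp: indicator_def)
  then have "(\<integral>\<^sup>+ x. ennreal (w x) * indicator (ball y r) x \<partial>lebesgue_on D) = (\<integral>\<^sup>+ x. 0 \<partial>lebesgue_on D)"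
    by (intro nn_integral_cong) auto
  then show ?thesis by simp
next
  case False
  then obtain x0 where x0: "x0 \<in> D" "dist y x0 < r" by auto
  define \<rho> where "\<rho> = min (2 * r) (\<bar>d\<bar> + 1)"
  have \<rho>: "\<rho> > 0" using r by (simp add: \<rho>_def)
  have "indicator (ball y r) x \<le> (indicator (ball x0 \<rho>) x :: ennreal)" if "x \<in> D" for x
  proof (cases "x \<in> ball y r")
    case True
    then have "dist x0 x < 2 * r" using x0(2) by (smt (verit) dist_triangle2 dist_commute mem_ball)
    moreover have "dist x0 x < \<bar>d\<bar> + 1" using subset_ball_diameter[OF D(2,3) x0(1)] that by auto
    ultimately have "x \<in> ball x0 \<rho>" by (simp add: \<rho>_def)
    then show ?thesis by (simp add: indicator_def)
  qed simp
  then have "(\<integral>\<^sup>+ x. ennreal (w x) * indicator (ball y r) x \<partial>lebesgue_on D)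
     \<le> (\<integral>\<^sup>+ x. ennreal (w x) * indicator (ball x0 \<rho>) x \<partial>lebesgue_on D)"
    by (intro nn_integral_mono mult_left_mono) auto
  also have "\<dots> \<le> ennreal (C * \<rho> powr \<beta>)" using w x0 \<rho> by (auto simp: lower_growth_def)
  also have "C * \<rho> powr \<beta> \<le> C * (\<bar>d\<bar> + 1) powr (\<beta> - \<beta>1) * 2 powr \<beta>1 * r powr \<beta>1"
  proof -
    have "\<rho> powr \<beta> = \<rho> powr (\<beta> - \<beta>1) * \<rho> powr \<beta>1" by (simp add: powr_add[symmetric])
    also have "\<dots> \<le> (\<bar>d\<bar> + 1) powr (\<beta> - \<beta>1) * (2 * r) powr \<beta>1"
      using \<rho> \<beta>1 by (intro mult_mono powr_mono2) (auto simp: \<rho>_def)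
    also have "(2 * r) powr \<beta>1 = 2 powr \<beta>1 * r powr \<beta>1" by (simp add: powr_mult)
    finally have "C * \<rho> powr \<beta> \<le> C * ((\<bar>d\<bar> + 1) powr (\<beta> - \<beta>1) * (2 powr \<beta>1 * r powr \<beta>1))"
      using C by (rule mult_left_mono)
    then show ?thesis by (simp add: mult_ac)
  qed
  finally show ?thesis by (simp add: ennreal_leI)
qed

lemma emeasure_le_of_diameter:
  fixes D :: "(real^'n::finite) set"
  assumes "open D" "bounded D" "diameter D \<le> d"
  shows "emeasure lebesgue D \<le> ennreal (unit_ball_vol (real CARD('n)) * (\<bar>d\<bar> + 1) ^ CARD('n))"
proof (cases "D = {}")
  case False
  then obtain x0 where "x0 \<in> D" by auto
  from subset_ball_diameter[OF assms(2,3) this] have "emeasure lebesgue D \<le> emeasure lebesgue (ball x0 (\<bar>d\<bar> + 1))"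
    by (intro emeasure_mono) auto
  also have "\<dots> = emeasure lborel (ball x0 (\<bar>d\<bar> + 1))" by simp
  also have "\<dots> = ennreal (unit_ball_vol (real CARD('n)) * (\<bar>d\<bar> + 1) ^ CARD('n))"
    by (subst emeasure_ball) auto
  finally show ?thesis .
qed simp

text \<open>The order of the quantifiers is the point: \<open>C\<close> precedes domain, weight and
  function, so it depends on the domain through \<open>d\<close> and on the weight through
  \<open>C0\<close> and \<open>\<beta>\<close> only. The inequality is proved for test functions and
  then extended by density.\<close>

theorem sobolev_W10_Morrey_trace:
  fixes m \<beta> s C0 d :: real
  defines "n \<equiv> real CARD('n::finite)"
  assumes n: "2 \<le> n" and m: "1 < m" "m \<le> n" and \<beta>: "\<beta> > n - m"
    and s: "m < s" "m < n \<Longrightarrow> s \<le> m * \<beta> / (n - m)" and C0: "C0 \<ge> 0"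
  shows "\<exists>C\<ge>0. \<forall>(D::(real^'n) set) w v Dv F. open D \<and> bounded D \<and> diameter D \<le> d \<and> lower_growth C0 \<beta> D w
     \<and> sobolev_W10 m D v Dv \<and> F \<ge> 0 \<and> (\<integral>\<^sup>+ x. ennreal (norm (Dv x) powr m) \<partial>lebesgue_on D) \<le> ennreal F
     \<longrightarrow> (\<integral>\<^sup>+ x. ennreal (w x) * ennreal (\<bar>v x\<bar> powr s) \<partial>lebesgue_on D) \<le> ennreal (C * F powr (s/m))"
proof -
  obtain m1 \<beta>1 where e: "1 \<le> m1" "m1 < n" "m1 \<le> m" "\<beta>1 \<le> \<beta>" "\<beta>1 > n - m1" "s = m1 * \<beta>1 / (n - m1)"
    using trace_exponents[OF n m \<beta> s] by metis
  have b1: "\<beta>1 > 0" using e by simp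
  define C1 where "C1 = C0 * (\<bar>d\<bar> + 1) powr (\<beta> - \<beta>1) * 2 powr \<beta>1"
  have C1: "C1 \<ge> 0" using C0 by (simp add: C1_def)
  define B where "B = unit_ball_vol n * (\<bar>d\<bar> + 1) ^ CARD('n)"
  have B: "B \<ge> 0" by (simp add: B_def n_def)
  define c where "c = (4 * trace_const n m1 \<beta>1 C1) powr s * (B powr (1 - m1/m)) powr (s/m1)"
  define C where "C = c * (2 powr m) powr (s/m)"
  have c: "c \<ge> 0" by (simp add: c_def)
  show ?thesis
  proof (intro exI[of _ C] conjI allI impI)
    show "C \<ge> 0" using c by (simp add: C_def)
    fix D :: "(real^'n) set" and w v Dv F
    assume A: "open D \<and> bounded D \<and> diameter D \<le> d \<and> lower_growth C0 \<beta> D w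
     \<and> sobolev_W10 m D v Dv \<and> F \<ge> 0 \<and> (\<integral>\<^sup>+ x. ennreal (norm (Dv x) powr m) \<partial>lebesgue_on D) \<le> ennreal F"
    then have D: "open D" "bounded D" "diameter D \<le> d" and w: "lower_growth C0 \<beta> D w"
      and v: "sobolev_W10 m D v Dv" and F: "F \<ge> 0" "(\<integral>\<^sup>+ x. ennreal (norm (Dv x) powr m) \<partial>lebesgue_on D) \<le> ennreal F"
      by auto
    have Ds: "D \<in> sets lebesgue" using D(1) by simp
    have wm[measurable]: "w \<in> borel_measurable (lebesgue_on D)" using w by (simp add: lower_growth_def)
    \<comment> \<open>The potential estimates require a Borel weight on the whole space:
      \<open>g\<close> agrees almost everywhere with \<open>w\<close> extended by 0.\<close>
    have "(\<lambda>x. ennreal (w x)) \<in> borel_measurable (lebesgue_on D)" by measurable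
    then have "(\<lambda>x. ennreal (w x) * indicator D x) \<in> borel_measurable lebesgue"
      using Ds by (subst (asm) borel_measurable_restrict_space_iff_ennreal) auto
    then obtain g where g[measurable]: "g \<in> borel_measurable lborel" and geq: "AE x in lborel. ennreal (w x) * indicator D x = g x"
      using completion_ex_borel_measurable by blast
    have gb: "g \<in> borel_measurable borel" using g by simp
    have geq': "AE x in lebesgue. ennreal (w x) * indicator D x = g x" using geq by (rule AE_completion)
    have trans: "(\<integral>\<^sup>+ x. ennreal (w x) * f x \<partial>lebesgue_on D) = (\<integral>\<^sup>+ x. g x * f x \<partial>lborel)" for f
    proof -
      have "(\<integral>\<^sup>+ x. ennreal (w x) * f x \<partial>lebesgue_on D) = (\<integral>\<^sup>+ x. (ennreal (w x) * f x) * indicator D x \<partial>lebesgue)"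
        using nn_set_integral_eq_lebesgue_on[OF Ds, of "\<lambda>x. ennreal (w x) * f x"] by simp
      also have "\<dots> = (\<integral>\<^sup>+ x. g x * f x \<partial>lebesgue)"
        by (rule nn_integral_cong_AE) (use geq' in \<open>eventually_elim, auto simp: mult_ac\<close>)
      finally show ?thesis by (simp add: nn_integral_completion)
    qed
    have growth: "(\<integral>\<^sup>+ x. g x * indicator (ball y r) x \<partial>lborel) \<le> ennreal (C1 * r powr \<beta>1)" if "r > 0" for y r
      unfolding trans[symmetric] C1_def by (rule lower_growth_everywhere[OF w D C0 e(4) b1 that])
    have tr: "(\<integral>\<^sup>+ x. ennreal (w x) * ennreal (\<bar>f x\<bar> powr s) \<partial>lebesgue_on D) \<le> ennreal (c * F powr (s/m))"
      if f: "test_fun D f" and F: "F \<ge> 0" "(\<integral>\<^sup>+ x. ennreal (norm (grad f x) powr m) \<partial>lebesgue_on D) \<le> ennreal F" for f F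
    proof -
      note fC = test_fun_C1c[OF f]
      note [measurable] = C1c_measurable(2)[OF fC] lebesgue_on_measurable_borel[OF C1c_measurable(2)[OF fC], of D]
      have "(\<integral>\<^sup>+ x. ennreal (norm (grad f x) powr m1) \<partial>lborel) = (\<integral>\<^sup>+ x. ennreal (norm (grad f x) powr m1) \<partial>lebesgue_on D)"
        using test_fun_outside(2)[OF f] by (intro nn_integral_lebesgue_on_eq_lborel[symmetric] Ds) auto
      \<comment> \<open>Holder on the bounded domain lowers the gradient exponent from
        \<open>m\<close> to \<open>m1\<close>, at the price of a power of the volume bound
        \<open>B\<close>.\<close>
      also have "\<dots> \<le> ennreal (F powr (1/(m/m1)) * B powr (1 - 1/(m/m1)))"
      proof (rule nn_integral_Holder_finite)
        show "(\<integral>\<^sup>+ x. ennreal ((norm (grad f x) powr m1) powr (m/m1)) \<partial>lebesgue_on D) \<le> ennreal F"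
          using F(2) e by (simp add: powr_powr)
        show "emeasure (lebesgue_on D) (space (lebesgue_on D)) \<le> ennreal B"
          unfolding emeasure_lebesgue_on_space[OF Ds] B_def n_def by (rule emeasure_le_of_diameter[OF D])
      qed (use e F B in auto)
      finally have F1: "(\<integral>\<^sup>+ x. ennreal (norm (grad f x) powr m1) \<partial>lborel) \<le> ennreal (F powr (m1/m) * B powr (1 - m1/m))"
        by simp
      have "(\<integral>\<^sup>+ x. ennreal (w x) * ennreal (\<bar>f x\<bar> powr s) \<partial>lebesgue_on D) = (\<integral>\<^sup>+ x. g x * ennreal (\<bar>f x\<bar> powr s) \<partial>lborel)"
        by (rule trans)
      also have "\<dots> \<le> ennreal ((4 * trace_const n m1 \<beta>1 C1) powr s * (F powr (m1/m) * B powr (1 - m1/m)) powr (s/m1))"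
        unfolding n_def by (rule C1c_strong_type[OF fC gb e(1) _ _ C1 _ _ growth F1]) (use e in \<open>auto simp: n_def\<close>)
      also have "(F powr (m1/m) * B powr (1 - m1/m)) powr (s/m1) = F powr (s/m) * (B powr (1 - m1/m)) powr (s/m1)"
        using e(1) by (simp add: powr_mult powr_powr)
      finally show ?thesis by (simp add: c_def mult_ac)
    qed
    have "(\<integral>\<^sup>+ x. ennreal (w x) * ennreal (\<bar>v x\<bar> powr s) \<partial>lebesgue_on D) \<le> ennreal (c * (2 powr m * F) powr (s/m))"
      by (rule sobolev_W10_trace[OF v _ Ds _ _ c _ _ tr F]) (use m s in auto)
    then show "(\<integral>\<^sup>+ x. ennreal (w x) * ennreal (\<bar>v x\<bar> powr s) \<partial>lebesgue_on D) \<le> ennreal (C * F powr (s/m))"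
      by (simp add: C_def powr_mult mult_ac)
  qed
qed

subsection \<open>The energy estimate\<close>

text \<open>Approximate \<open>(u x, U x)\<close> by simple functions. For these the composition is
  glued from finitely many sections of \<open>a\<close>, each measurable in \<open>x\<close>, and
  continuity in the last two arguments gives the limit. The exceptional null set \<open>N\<close>,
  where values are replaced by 0, is removed at the end because Lebesgue measure is
  complete.\<close>

lemma caratheodory_measurable:
  fixes a :: "real^'n::finite \<Rightarrow> real \<Rightarrow> real^'n \<Rightarrow> 'c::euclidean_space"
  assumes a: "caratheodory D a" and D: "D \<in> sets lebesgue"
    and u: "u \<in> borel_measurable (lebesgue_on D)" and U: "U \<in> borel_measurable (lebesgue_on D)"
  shows "(\<lambda>x. a x (u x) (U x)) \<in> borel_measurable (lebesgue_on D)"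
proof -
  have am: "(\<lambda>x. a x z y) \<in> borel_measurable (lebesgue_on D)" for z y
    using a by (simp add: caratheodory_def)
  have "(\<lambda>x. (u x, U x)) \<in> borel_measurable (lebesgue_on D)"
    using u U by (rule borel_measurable_Pair)
  from borel_measurable_implies_sequence_metric[OF this] obtain S
    where S: "\<And>i. simple_function (lebesgue_on D) (S i)"
      "\<And>x. x \<in> space (lebesgue_on D) \<Longrightarrow> (\<lambda>i. S i x) \<longlonglongrightarrow> (u x, U x)"
    by blast
  have Sa: "(\<lambda>x. a x (fst (S i x)) (snd (S i x))) \<in> borel_measurable (lebesgue_on D)" for i
  proof (rule measurable_compose_countable'[where f="\<lambda>p x. a x (fst p) (snd p)" and g="S i" and I="S i ` space (lebesgue_on D)"])
    have fin: "finite (S i ` space (lebesgue_on D))" using S(1)[of i] by (rule simple_functionD)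
    then show "countable (S i ` space (lebesgue_on D))" by (rule countable_finite)
    show "S i \<in> lebesgue_on D \<rightarrow>\<^sub>M count_space (S i ` space (lebesgue_on D))"
      unfolding measurable_count_space_eq2[OF fin] using simple_functionD(2)[OF S(1)[of i]] by blast
  qed (rule am)
  have "AE x in lebesgue. x \<in> D \<longrightarrow> continuous_on UNIV (\<lambda>(z, y). a x z y)"
    using a D unfolding caratheodory_def by (subst (asm) AE_restrict_space_iff) auto
  then obtain N where N: "N \<in> null_sets lebesgue"
    "\<And>x. x \<notin> N \<Longrightarrow> x \<in> D \<Longrightarrow> continuous_on UNIV (\<lambda>(z, y). a x z y)"
    by (auto elim!: AE_E3)
  have [measurable]: "N \<in> sets lebesgue" using N(1) by auto
  define X where "X = (\<lambda>i x. if x \<in> N then 0 else indicator D x *\<^sub>R a x (fst (S i x)) (snd (S i x)))"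
  define Y where "Y = (\<lambda>x. if x \<in> N then 0 else indicator D x *\<^sub>R a x (u x) (U x))"
  have "Y \<in> borel_measurable lebesgue"
  proof (rule borel_measurable_LIMSEQ_metric)
    fix i
    have "(\<lambda>x. indicator D x *\<^sub>R a x (fst (S i x)) (snd (S i x))) \<in> borel_measurable lebesgue"
      using Sa[of i] D by (subst (asm) borel_measurable_restrict_space_iff) auto
    then show "X i \<in> borel_measurable lebesgue" unfolding X_def by measurable
  next
    fix x
    show "(\<lambda>i. X i x) \<longlonglongrightarrow> Y x"
    proof (cases "x \<in> D \<and> x \<notin> N")
      case True
      then have "isCont (\<lambda>(z, y). a x z y) (u x, U x)"
        using N(2)[of x] by (simp add: continuous_on_eq_continuous_at)
      moreover have "(\<lambda>i. S i x) \<longlonglongrightarrow> (u x, U x)" using True S(2)[of x] by simp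
      ultimately have "(\<lambda>i. (\<lambda>(z, y). a x z y) (S i x)) \<longlonglongrightarrow> (\<lambda>(z, y). a x z y) (u x, U x)"
        by (rule isCont_tendsto_compose)
      then show ?thesis using True by (simp add: X_def Y_def split_beta)
    qed (auto simp: X_def Y_def)
  qed
  then have "(\<lambda>x. indicator D x *\<^sub>R a x (u x) (U x)) \<in> borel_measurable lebesgue"
  proof (rule borel_measurable_AE)
    show "AE x in lebesgue. Y x = indicator D x *\<^sub>R a x (u x) (U x)"
      using AE_not_in[OF N(1)] by eventually_elim (simp add: Y_def)
  qed
  then show ?thesis using D by (subst borel_measurable_restrict_space_iff) auto
qed

text \<open>Holder with exponent \<open>p / t\<close> on \<open>ball x0 \<rho> \<inter> D\<close>:
  the Morrey bound contributes \<open>\<rho> powr (lam * (t/p))\<close>, the volume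
  \<open>\<rho> powr (n * (1 - t/p))\<close> with \<open>n\<close> the dimension. It is used with
  \<open>t = m / (m - 1)\<close> for \<open>\<phi>\<close> and \<open>t = 1\<close> for
  \<open>\<psi>\<close>.\<close>

lemma in_morrey_lower_growth:
  fixes D :: "(real^'n::finite) set"
  assumes \<phi>: "in_morrey p lam D \<phi>" "morrey_norm p lam D \<phi> \<le> \<Phi>" and \<phi>0: "\<And>x. \<phi> x \<ge> 0"
    and t: "1 \<le> t" "t \<le> p" and D: "open D"
  shows "lower_growth (\<bar>\<Phi>\<bar> powr t * unit_ball_vol (real CARD('n)) powr (1 - t/p))
     (real CARD('n) - (real CARD('n) - lam) * t / p) D (\<lambda>x. \<phi> x powr t)"
  unfolding lower_growth_def
proof (intro conjI allI ballI impI)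
  have Ds: "D \<in> sets lebesgue" using D by simp
  have \<phi>m[measurable]: "\<phi> \<in> borel_measurable (lebesgue_on D)" using \<phi> by (auto simp: in_morrey_def lp_on_def)
  show "(\<lambda>x. \<phi> x powr t) \<in> borel_measurable (lebesgue_on D)" by measurable
  show "0 \<le> \<phi> x powr t" for x by simp
  fix x0 \<rho> assume x0: "x0 \<in> D" and \<rho>: "(0::real) < \<rho>"
  define S where "S = ball x0 \<rho> \<inter> D"
  have Ss: "S \<in> sets lebesgue" using Ds by (auto simp: S_def)
  define I where "I = (\<integral>\<^sup>+ x\<in>S. ennreal (\<bar>\<phi> x\<bar> powr p) \<partial>lebesgue)"
  \<comment> \<open>\<open>morrey_vals\<close> passes through \<open>enn2real\<close>, which sends
    infinity to 0. It is the finiteness from \<open>lp_on\<close> that lets the Morrey bound say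
    something about \<open>I\<close>.\<close>
  have "I \<le> (\<integral>\<^sup>+ x\<in>D. ennreal (\<bar>\<phi> x\<bar> powr p) \<partial>lebesgue)"
    unfolding I_def by (intro nn_integral_mono) (auto simp: S_def indicator_def)
  also have "\<dots> < \<infinity>" using \<phi> by (auto simp: in_morrey_def lp_on_def)
  finally have Ifin: "I = ennreal (enn2real I)" by (simp add: less_top)
  have "(\<rho> powr (-lam) * enn2real I) powr (1/p) \<in> morrey_vals p lam D \<phi>"
    unfolding morrey_vals_def I_def S_def using x0 \<rho> by blast
  then have "(\<rho> powr (-lam) * enn2real I) powr (1/p) \<le> morrey_norm p lam D \<phi>"
    unfolding morrey_norm_def using \<phi> by (intro cSup_upper) (auto simp: in_morrey_def)
  then have "(\<rho> powr (-lam) * enn2real I) powr (1/p) \<le> \<bar>\<Phi>\<bar>" using \<phi>(2) by linarith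
  then have "((\<rho> powr (-lam) * enn2real I) powr (1/p)) powr p \<le> \<bar>\<Phi>\<bar> powr p"
    using t by (intro powr_mono2) auto
  then have "\<rho> powr (-lam) * enn2real I \<le> \<bar>\<Phi>\<bar> powr p"
    using t by (simp add: powr_powr)
  then have Ib: "enn2real I \<le> \<bar>\<Phi>\<bar> powr p * \<rho> powr lam"
    using \<rho> by (simp add: powr_minus field_simps)
  have mS: "emeasure (lebesgue_on S) (space (lebesgue_on S)) \<le> ennreal (unit_ball_vol (real CARD('n)) * \<rho> powr real CARD('n))"
  proof -
    have "emeasure lebesgue S \<le> emeasure lebesgue (ball x0 \<rho>)"
      by (intro emeasure_mono) (auto simp: S_def)
    also have "\<dots> = emeasure lborel (ball x0 \<rho>)" by simp
    also have "\<dots> = ennreal (unit_ball_vol (real CARD('n)) * \<rho> powr real CARD('n))"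
      using \<rho> by (subst emeasure_ball) (auto simp: powr_realpow)
    finally show ?thesis unfolding emeasure_lebesgue_on_space[OF Ss] .
  qed
  have "(\<integral>\<^sup>+ x. ennreal (\<phi> x powr t) * indicator (ball x0 \<rho>) x \<partial>lebesgue_on D) = (\<integral>\<^sup>+ x. ennreal (\<phi> x powr t) \<partial>lebesgue_on S)"
  proof -
    have "(\<integral>\<^sup>+ x. ennreal (\<phi> x powr t) * indicator (ball x0 \<rho>) x \<partial>lebesgue_on D)
      = (\<integral>\<^sup>+ x. ennreal (\<phi> x powr t) * indicator (ball x0 \<rho>) x * indicator D x \<partial>lebesgue)"
      using nn_set_integral_eq_lebesgue_on[OF Ds, of "\<lambda>x. ennreal (\<phi> x powr t) * indicator (ball x0 \<rho>) x"] by simp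
    also have "\<dots> = (\<integral>\<^sup>+ x\<in>S. ennreal (\<phi> x powr t) \<partial>lebesgue)"
      by (intro nn_integral_cong) (auto simp: S_def indicator_def)
    finally show ?thesis using nn_set_integral_eq_lebesgue_on[OF Ss, of "\<lambda>x. ennreal (\<phi> x powr t)"] by simp
  qed
  also have "\<dots> \<le> ennreal ((\<bar>\<Phi>\<bar> powr p * \<rho> powr lam) powr (1/(p/t)) * (unit_ball_vol (real CARD('n)) * \<rho> powr real CARD('n)) powr (1 - 1/(p/t)))"
  proof (rule nn_integral_Holder_finite)
    have [measurable]: "\<phi> \<in> borel_measurable (lebesgue_on S)"
      by (rule measurable_restrict_mono[OF \<phi>m]) (simp add: S_def)
    show "(\<lambda>x. \<phi> x powr t) \<in> borel_measurable (lebesgue_on S)" by measurable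
    have "(\<integral>\<^sup>+ x. ennreal ((\<phi> x powr t) powr (p/t)) \<partial>lebesgue_on S) = I"
      unfolding I_def nn_set_integral_eq_lebesgue_on[OF Ss] using t \<phi>0 by (simp add: powr_powr)
    also have "\<dots> \<le> ennreal (\<bar>\<Phi>\<bar> powr p * \<rho> powr lam)"
      by (subst Ifin) (intro ennreal_leI Ib)
    finally show "(\<integral>\<^sup>+ x. ennreal ((\<phi> x powr t) powr (p/t)) \<partial>lebesgue_on S) \<le> ennreal (\<bar>\<Phi>\<bar> powr p * \<rho> powr lam)" .
  qed (use t mS in auto)
  also have "(\<bar>\<Phi>\<bar> powr p * \<rho> powr lam) powr (1/(p/t)) * (unit_ball_vol (real CARD('n)) * \<rho> powr real CARD('n)) powr (1 - 1/(p/t))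
     = \<bar>\<Phi>\<bar> powr t * unit_ball_vol (real CARD('n)) powr (1 - t/p) * (\<rho> powr (lam * (t/p)) * \<rho> powr (real CARD('n) * (1 - t/p)))"
    using t by (simp add: powr_mult powr_powr mult_ac)
  also have "\<rho> powr (lam * (t/p)) * \<rho> powr (real CARD('n) * (1 - t/p)) = \<rho> powr (real CARD('n) - (real CARD('n) - lam) * t / p)"
    unfolding powr_add[symmetric] by (simp add: field_simps add_divide_distrib diff_divide_distrib)
  finally show "(\<integral>\<^sup>+ x. ennreal (\<phi> x powr t) * indicator (ball x0 \<rho>) x \<partial>lebesgue_on D)
    \<le> ennreal (\<bar>\<Phi>\<bar> powr t * unit_ball_vol (real CARD('n)) powr (1 - t/p) * \<rho> powr (real CARD('n) - (real CARD('n) - lam) * t / p))" .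
qed

lemma one_lower_growth:
  fixes D :: "(real^'n::finite) set"
  assumes "open D"
  shows "lower_growth (unit_ball_vol (real CARD('n))) (real CARD('n)) D (\<lambda>_. 1)"
  unfolding lower_growth_def
proof (intro conjI allI ballI impI)
  fix x0 \<rho> assume x0: "x0 \<in> D" and \<rho>: "(0::real) < \<rho>"
  have Ds: "D \<in> sets lebesgue" using assms by simp
  have "(\<integral>\<^sup>+ x. ennreal 1 * indicator (ball x0 \<rho>) x \<partial>lebesgue_on D) = (\<integral>\<^sup>+ x. indicator (ball x0 \<rho>) x * indicator D x \<partial>lebesgue)"
    using nn_set_integral_eq_lebesgue_on[OF Ds, of "indicator (ball x0 \<rho>)"] by simp
  also have "\<dots> \<le> (\<integral>\<^sup>+ x. indicator (ball x0 \<rho>) x \<partial>lebesgue)"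
    by (intro nn_integral_mono) (auto simp: indicator_def)
  also have "\<dots> = emeasure lborel (ball x0 \<rho>)" by simp
  also have "\<dots> = ennreal (unit_ball_vol (real CARD('n)) * \<rho> powr real CARD('n))"
    using \<rho> by (subst emeasure_ball) (auto simp: powr_realpow)
  finally show "(\<integral>\<^sup>+ x. ennreal 1 * indicator (ball x0 \<rho>) x \<partial>lebesgue_on D) \<le> ennreal (unit_ball_vol (real CARD('n)) * \<rho> powr real CARD('n))" .
qed auto

text \<open>\<open>X\<close> may change sign, so its integral is a Bochner integral;
  \<open>ennreal\<close> cuts a negative value to 0, which only enlarges the right side. If
  \<open>H\<close> has infinite integral nothing is to be shown, otherwise linearity
  applies.\<close>

lemma nn_integral_le_integral_add:
  fixes g H X :: "'a \<Rightarrow> real"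
  assumes X: "integrable M X" and H[measurable]: "H \<in> borel_measurable M" and H0: "\<And>x. H x \<ge> 0"
    and g: "AE x in M. 0 \<le> g x \<and> g x \<le> X x + H x"
  shows "(\<integral>\<^sup>+ x. ennreal (g x) \<partial>M) \<le> ennreal (\<integral>x. X x \<partial>M) + (\<integral>\<^sup>+ x. ennreal (H x) \<partial>M)"
proof (cases "(\<integral>\<^sup>+ x. ennreal (H x) \<partial>M) < \<infinity>")
  case True
  have Hi: "integrable M H" using True H0 by (intro integrableI_nonneg) auto
  have "(\<integral>\<^sup>+ x. ennreal (g x) \<partial>M) \<le> (\<integral>\<^sup>+ x. ennreal (X x + H x) \<partial>M)"
    by (rule nn_integral_mono_AE) (use g in \<open>eventually_elim, auto intro: ennreal_leI\<close>)
  also have "\<dots> = ennreal (\<integral>x. X x + H x \<partial>M)"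
  proof (rule nn_integral_eq_integral)
    show "AE x in M. 0 \<le> X x + H x" using g by eventually_elim auto
  qed (use X Hi in simp)
  also have "\<dots> = ennreal ((\<integral>x. X x \<partial>M) + (\<integral>x. H x \<partial>M))" using X Hi by simp
  also have "\<dots> \<le> ennreal (\<integral>x. X x \<partial>M) + ennreal (\<integral>x. H x \<partial>M)"
    by (cases "(\<integral>x. X x \<partial>M) \<ge> 0") (auto simp: H0 ennreal_plus[symmetric] ennreal_neg intro: ennreal_leI simp del: ennreal_plus)
  also have "ennreal (\<integral>x. H x \<partial>M) = (\<integral>\<^sup>+ x. ennreal (H x) \<partial>M)"
    using Hi H0 by (intro nn_integral_eq_integral[symmetric]) auto
  finally show ?thesis .
next
  case False
  then have "(\<integral>\<^sup>+ x. ennreal (H x) \<partial>M) = top" using not_less_iff_gr_or_eq top.not_eq_extremum by fastforce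
  then show ?thesis by simp
qed

lemma ennreal_integral_le_nn_integral_norm:
  fixes f :: "'a \<Rightarrow> real"
  shows "ennreal \<bar>\<integral>x. f x \<partial>M\<bar> \<le> (\<integral>\<^sup>+ x. ennreal \<bar>f x\<bar> \<partial>M)"
proof (cases "integrable M f")
  case True
  then show ?thesis using integral_norm_bound_ennreal[OF True] by simp
qed (simp add: not_integrable_integral_eq)

text \<open>At \<open>c = d powr (m-1)\<close> the product and both powers coincide. On either side
  of this threshold one of the two powers alone dominates.\<close>

lemma mult_le_conjugate_powr:
  fixes c d m :: real
  assumes "c \<ge> 0" "d \<ge> 0" "m > 1"
  shows "c * d \<le> c powr (m/(m-1)) + d powr m"
proof (cases "c \<le> d powr (m-1)")
  case True
  have "c * d \<le> d powr (m-1) * d" using True assms by (intro mult_right_mono) auto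
  also have "\<dots> = d powr m" using assms by (cases "d = 0") (auto simp: powr_diff)
  finally show ?thesis by (simp add: add_increasing)
next
  case False
  then have c: "c > 0" using assms by (smt (verit) powr_ge_zero)
  have "d = (d powr (m-1)) powr (1/(m-1))" using assms by (simp add: powr_powr)
  also have "\<dots> \<le> c powr (1/(m-1))" using False assms by (intro powr_mono2) auto
  finally have "c * d \<le> c powr 1 * c powr (1/(m-1))" using assms by (simp add: mult_left_mono)
  also have "\<dots> = c powr (m/(m-1))" unfolding powr_add[symmetric] using assms by (simp add: field_simps)
  finally show ?thesis by (simp add: add_increasing2)
qed

text \<open>The Bochner integral of a non-integrable function is 0, so the integral of the lower order term is
  bounded by that of its absolute value in any case.\<close>
lemma energy_estimate:
  fixes D :: "(real^'n::finite) set" and a :: "real^'n \<Rightarrow> real \<Rightarrow> real^'n \<Rightarrow> real^'n"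
  assumes D: "open D" "bounded D" and m: "m > 1" and l: "l > 0" and k: "k > 0" and \<gamma>: "\<gamma> > 0" and \<Lambda>: "\<Lambda> > 0"
    and sol: "weak_solution m D a b u Du" and car: "caratheodory D a"
    and \<phi>0: "\<And>x. \<phi> x \<ge> 0" and \<psi>0: "\<And>x. \<psi> x \<ge> 0"
    and \<phi>m[measurable]: "\<phi> \<in> borel_measurable (lebesgue_on D)" and \<psi>m[measurable]: "\<psi> \<in> borel_measurable (lebesgue_on D)"
    and str: "AE x in lebesgue_on D. \<forall>z \<xi>.
            norm (a x z \<xi>) \<le> \<Lambda> * (\<phi> x + \<bar>z\<bar> powr (l * (m - 1) / m) + norm \<xi> powr (m - 1))
          \<and> \<bar>b x z \<xi>\<bar> \<le> \<Lambda> * (\<psi> x + \<bar>z\<bar> powr (l - 1) + norm \<xi> powr (m * (l - 1) / l))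
          \<and> a x z \<xi> \<bullet> \<xi> \<ge> \<gamma> * norm \<xi> powr m - \<Lambda> * \<bar>z\<bar> powr l - \<Lambda> * \<phi> x powr (m / (m - 1))"
    and ufin: "(\<integral>\<^sup>+ x. ennreal (\<bar>u x\<bar> powr l) \<partial>lebesgue_on D) < \<infinity>"
    and \<phi>fin: "(\<integral>\<^sup>+ x. ennreal (\<phi> x powr (m/(m-1))) \<partial>lebesgue_on D) < \<infinity>"
  shows "(\<integral>\<^sup>+ x. ennreal (\<gamma> * (indicator {t. \<bar>t\<bar> > k} (u x) * norm (Du x) powr m)) \<partial>lebesgue_on D)
     \<le> (\<integral>\<^sup>+ x. ennreal (\<Lambda> * (\<psi> x + \<bar>u x\<bar> powr (l - 1) + norm (Du x) powr (m * (l - 1) / l)) * max 0 (\<bar>u x\<bar> - k)) \<partial>lebesgue_on D)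
      + (\<integral>\<^sup>+ x. ennreal (\<Lambda> * (\<bar>u x\<bar> powr l + \<phi> x powr (m/(m-1))) * indicator {t. \<bar>t\<bar> > k} (u x)) \<partial>lebesgue_on D)"
    (is "?L \<le> ?R1 + ?R2")
proof -
  let ?N = "lebesgue_on D"
  have Ds: "D \<in> sets lebesgue" using D(1) by simp
  have u: "sobolev_W10 m D u Du" using sol by (simp add: weak_solution_def)
  note [measurable] = sobolev_W10_measurable[OF u]
  have am[measurable]: "(\<lambda>x. a x (u x) (Du x)) \<in> borel_measurable ?N"
    by (rule caratheodory_measurable[OF car Ds]) measurable
  \<comment> \<open>Majorant for the product of \<open>a x (u x) (Du x)\<close> with
    \<open>Du x\<close>. Each of the three growth terms, multiplied by \<open>norm (Du x)\<close>,
    contributes one \<open>norm (Du x) powr m\<close>, whence the 3.\<close>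
  have dom: "integrable ?N (\<lambda>x. \<Lambda> * (\<phi> x powr (m/(m-1)) + \<bar>u x\<bar> powr l + 3 * norm (Du x) powr m))"
  proof (intro integrable_mult_right Bochner_Integration.integrable_add)
    show "integrable ?N (\<lambda>x. \<phi> x powr (m/(m-1)))" using \<phi>fin by (intro integrableI_nonneg) auto
    show "integrable ?N (\<lambda>x. \<bar>u x\<bar> powr l)" using ufin by (intro integrableI_nonneg) auto
    show "integrable ?N (\<lambda>x. norm (Du x) powr m)"
      using sobolev_W10_integrals_finite(2)[OF u _ Ds] m by (intro integrableI_nonneg) auto
  qed
  \<comment> \<open>The right-hand side does not depend on \<open>\<epsilon>\<close>, so Fatou can
    replace \<open>trunc'\<close> by the indicator on the left.\<close>
  have eps: "(\<integral>\<^sup>+ x. ennreal (\<gamma> * (trunc' k \<epsilon> (u x) * norm (Du x) powr m)) \<partial>?N) \<le> ?R1 + ?R2" if e: "\<epsilon> > 0" for \<epsilon>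
  proof -
    define G where "G = (\<lambda>x. trunc' k \<epsilon> (u x))"
    have G: "0 \<le> G x" "G x \<le> 1" "\<bar>u x\<bar> \<le> k \<Longrightarrow> G x = 0" for x
      unfolding G_def by (rule trunc'_bounds[OF e k])+
    have [measurable]: "trunc' k \<epsilon> \<in> borel_measurable borel"
      by (rule borel_measurable_continuous_onI[OF continuous_trunc'[OF e]])
    have Gm[measurable]: "G \<in> borel_measurable ?N" unfolding G_def by measurable
    define v where "v = (\<lambda>x. trunc k \<epsilon> (u x))"
    define X where "X = (\<lambda>x. a x (u x) (Du x) \<bullet> (G x *\<^sub>R Du x))"
    have W: "sobolev_W10 m D v (\<lambda>x. G x *\<^sub>R Du x)"
      unfolding v_def G_def using m by (intro sobolev_W10_trunc[OF u D _ k e]) simp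
    have "(LINT x:D|lebesgue. a x (u x) (Du x) \<bullet> (G x *\<^sub>R Du x)) + (LINT x:D|lebesgue. b x (u x) (Du x) * v x) = 0"
      using sol W unfolding weak_solution_def by blast
    then have eq: "(\<integral>x. X x \<partial>?N) + (\<integral>x. b x (u x) (Du x) * v x \<partial>?N) = 0"
      unfolding X_def by (simp only: set_lebesgue_integral_eq_lebesgue_on[OF Ds])
    have Xi: "integrable ?N X"
    proof (rule Bochner_Integration.integrable_bound[OF dom])
      show "X \<in> borel_measurable ?N" unfolding X_def by measurable
      show "AE x in ?N. norm (X x) \<le> norm (\<Lambda> * (\<phi> x powr (m/(m-1)) + \<bar>u x\<bar> powr l + 3 * norm (Du x) powr m))"
        using str
      proof eventually_elim
        case (elim x)
        have "norm (X x) = G x * \<bar>a x (u x) (Du x) \<bullet> Du x\<bar>" using G[of x] by (simp add: X_def abs_mult)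
        also have "\<dots> \<le> 1 * (norm (a x (u x) (Du x)) * norm (Du x))"
          using G[of x] by (intro mult_mono Cauchy_Schwarz_ineq2) auto
        also have "\<dots> \<le> \<Lambda> * (\<phi> x + \<bar>u x\<bar> powr (l * (m - 1) / m) + norm (Du x) powr (m - 1)) * norm (Du x)"
          using elim by (simp add: mult_right_mono)
        also have "\<dots> = \<Lambda> * (\<phi> x * norm (Du x) + \<bar>u x\<bar> powr (l * (m - 1) / m) * norm (Du x) + norm (Du x) powr (m - 1) * norm (Du x))"
          by (simp add: algebra_simps)
        also have "\<dots> \<le> \<Lambda> * ((\<phi> x powr (m/(m-1)) + norm (Du x) powr m) + ((\<bar>u x\<bar> powr (l * (m - 1) / m)) powr (m/(m-1)) + norm (Du x) powr m) + norm (Du x) powr m)"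
        proof (intro mult_left_mono add_mono mult_le_conjugate_powr \<phi>0 m norm_ge_zero powr_ge_zero)
          show "norm (Du x) powr (m - 1) * norm (Du x) \<le> norm (Du x) powr m"
            by (cases "Du x = 0") (auto simp: powr_diff)
        qed (use \<Lambda> in auto)
        also have "(\<bar>u x\<bar> powr (l * (m - 1) / m)) powr (m/(m-1)) = \<bar>u x\<bar> powr l"
          using m by (simp add: powr_powr)
        finally show ?case using \<Lambda> by (simp add: algebra_simps)
      qed
    qed
    define H where "H = (\<lambda>x. \<Lambda> * (\<bar>u x\<bar> powr l + \<phi> x powr (m/(m-1))) * G x)"
    have "(\<integral>\<^sup>+ x. ennreal (\<gamma> * (G x * norm (Du x) powr m)) \<partial>?N) \<le> ennreal (\<integral>x. X x \<partial>?N) + (\<integral>\<^sup>+ x. ennreal (H x) \<partial>?N)"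
    proof (rule nn_integral_le_integral_add[OF Xi])
      show "H \<in> borel_measurable ?N" unfolding H_def by measurable
      show "H x \<ge> 0" for x using G[of x] \<Lambda> by (simp add: H_def)
      show "AE x in ?N. 0 \<le> \<gamma> * (G x * norm (Du x) powr m) \<and> \<gamma> * (G x * norm (Du x) powr m) \<le> X x + H x"
        using str
      proof eventually_elim
        case (elim x)
        then have "\<gamma> * norm (Du x) powr m \<le> a x (u x) (Du x) \<bullet> Du x + \<Lambda> * (\<bar>u x\<bar> powr l + \<phi> x powr (m/(m-1)))"
          by (smt (verit) distrib_left)
        from mult_left_mono[OF this G(1)[of x]] show ?case
          using G(1)[of x] \<gamma> by (simp add: X_def H_def algebra_simps)
      qed
    qed
    also have "\<dots> \<le> ?R1 + ?R2"
    proof (rule add_mono)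
      have "ennreal (\<integral>x. X x \<partial>?N) \<le> ennreal \<bar>\<integral>x. b x (u x) (Du x) * v x \<partial>?N\<bar>"
        using eq by (intro ennreal_leI) linarith
      also have "\<dots> \<le> (\<integral>\<^sup>+ x. ennreal \<bar>b x (u x) (Du x) * v x\<bar> \<partial>?N)"
        by (rule ennreal_integral_le_nn_integral_norm)
      also have "\<dots> \<le> ?R1"
      proof (rule nn_integral_mono_AE)
        show "AE x in ?N. ennreal \<bar>b x (u x) (Du x) * v x\<bar>
          \<le> ennreal (\<Lambda> * (\<psi> x + \<bar>u x\<bar> powr (l - 1) + norm (Du x) powr (m * (l - 1) / l)) * max 0 (\<bar>u x\<bar> - k))"
          using str
        proof eventually_elim
          case (elim x)
          have "\<bar>v x\<bar> \<le> max 0 (\<bar>u x\<bar> - k)" unfolding v_def by (rule abs_trunc_le(1)[OF e k])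
          then show ?case unfolding abs_mult
            using elim \<psi>0[of x] \<Lambda> by (intro ennreal_leI mult_mono) auto
        qed
      qed
      finally show "ennreal (\<integral>x. X x \<partial>?N) \<le> ?R1" .
      show "(\<integral>\<^sup>+ x. ennreal (H x) \<partial>?N) \<le> ?R2"
      proof (intro nn_integral_mono ennreal_leI)
        fix x
        show "H x \<le> \<Lambda> * (\<bar>u x\<bar> powr l + \<phi> x powr (m/(m-1))) * indicator {t. \<bar>t\<bar> > k} (u x)"
          unfolding H_def using G[of x] \<Lambda> by (intro mult_left_mono) (auto simp: indicator_def)
      qed
    qed
    finally show ?thesis by (simp add: G_def)
  qed
  define t where "t = (\<lambda>j::nat. 1 / real (Suc j))"
  have t: "filterlim t (at_right 0) sequentially"
  proof -
    have "t \<longlonglongrightarrow> 0" unfolding t_def using LIMSEQ_inverse_real_of_nat by (simp add: inverse_eq_divide)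
    then show ?thesis by (auto simp: filterlim_at t_def)
  qed
  show ?thesis
  proof (rule nn_integral_Fatou_bound[where u="\<lambda>j x. ennreal (\<gamma> * (trunc' k (t j) (u x) * norm (Du x) powr m))"])
    show "(\<lambda>x. ennreal (\<gamma> * (trunc' k (t j) (u x) * norm (Du x) powr m))) \<in> borel_measurable ?N" for j
    proof -
      have [measurable]: "trunc' k (t j) \<in> borel_measurable borel"
        by (rule borel_measurable_continuous_onI[OF continuous_trunc']) (simp add: t_def)
      show ?thesis by measurable
    qed
    show "AE x in ?N. (\<lambda>j. ennreal (\<gamma> * (trunc' k (t j) (u x) * norm (Du x) powr m)))
        \<longlonglongrightarrow> ennreal (\<gamma> * (indicator {t. \<bar>t\<bar> > k} (u x) * norm (Du x) powr m))"
      by (intro AE_I2 tendsto_ennrealI tendsto_mult tendsto_const filterlim_compose[OF trunc_tendsto(2)[OF k] t])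
    show "(\<integral>\<^sup>+ x. ennreal (\<gamma> * (trunc' k (t j) (u x) * norm (Du x) powr m)) \<partial>?N) \<le> ?R1 + ?R2" for j
      by (rule eps) (simp add: t_def)
  qed
qed

text \<open>A weighted Young inequality, by a case split at
  \<open>t = \<delta> * y powr (m/l)\<close>. The exponents are critical in that
  \<open>m * (l - 1) / l + m / l = m\<close>; a small \<open>\<delta>\<close> makes the gradient
  part absorbable.\<close>

lemma mult_powr_le_threshold:
  fixes y t m l \<delta> :: real
  assumes "y \<ge> 0" "t \<ge> 0" "\<delta> > 0" "l > 1"
  shows "y powr (m * (l - 1) / l) * t \<le> \<delta> * y powr m + \<delta> powr (1 - l) * t powr l"
proof (cases "t \<le> \<delta> * y powr (m/l)")
  case True
  have "y powr (m * (l - 1) / l) * t \<le> y powr (m * (l - 1) / l) * (\<delta> * y powr (m/l))"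
    using True by (intro mult_left_mono) auto
  also have "\<dots> = \<delta> * y powr (m * (l - 1) / l + m / l)" by (simp add: powr_add)
  also have "m * (l - 1) / l + m / l = m" using assms by (simp add: field_simps)
  finally show ?thesis by (simp add: add_increasing2)
next
  case False
  then have yt: "y powr (m/l) \<le> t / \<delta>" using assms by (simp add: field_simps)
  have "y powr (m * (l - 1) / l) = (y powr (m/l)) powr (l - 1)" by (simp add: powr_powr)
  also have "\<dots> \<le> (t / \<delta>) powr (l - 1)" using yt assms by (intro powr_mono2) auto
  finally have "y powr (m * (l - 1) / l) * t \<le> (t / \<delta>) powr (l - 1) * t" using assms by (intro mult_right_mono) auto
  also have "\<dots> = \<delta> powr (1 - l) * t powr l"
    using assms by (cases "t = 0") (auto simp: powr_divide powr_diff)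
  finally show ?thesis using assms by (simp add: add_increasing)
qed

text \<open>The sharp truncation is never shown to belong to W10. The trace inequality is applied to
  \<open>trunc k \<epsilon>\<close>, whose energies are all bounded by the energy on the superlevel
  set, and the limit is taken by Fatou.\<close>

lemma trace_truncation:
  fixes D :: "(real^'n::finite) set"
  assumes D: "open D" "bounded D" and m: "m \<ge> 1" and s: "s > 0" and k: "k > 0"
    and u: "sobolev_W10 m D u Du"
    and w[measurable]: "w \<in> borel_measurable (lebesgue_on D)"
    and tr: "\<And>v Dv F. sobolev_W10 m D v Dv \<Longrightarrow> F \<ge> 0 \<Longrightarrow> (\<integral>\<^sup>+ x. ennreal (norm (Dv x) powr m) \<partial>lebesgue_on D) \<le> ennreal F
       \<Longrightarrow> (\<integral>\<^sup>+ x. ennreal (w x) * ennreal (\<bar>v x\<bar> powr s) \<partial>lebesgue_on D) \<le> ennreal (C * F powr (s/m))"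
    and f: "f \<ge> 0" "(\<integral>\<^sup>+ x. ennreal (indicator {t. \<bar>t\<bar> > k} (u x) * norm (Du x) powr m) \<partial>lebesgue_on D) \<le> ennreal f"
  shows "(\<integral>\<^sup>+ x. ennreal (w x) * ennreal (max 0 (\<bar>u x\<bar> - k) powr s) \<partial>lebesgue_on D) \<le> ennreal (C * f powr (s/m))"
proof -
  note [measurable] = sobolev_W10_measurable[OF u]
  define t where "t = (\<lambda>j::nat. 1 / real (Suc j))"
  have t0: "t j > 0" for j by (simp add: t_def)
  have t: "filterlim t (at_right 0) sequentially"
  proof -
    have "t \<longlonglongrightarrow> 0" unfolding t_def using LIMSEQ_inverse_real_of_nat by (simp add: inverse_eq_divide)
    then show ?thesis by (auto simp: filterlim_at t_def)
  qed
  have [measurable]: "trunc k (t j) \<in> borel_measurable borel" for j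
    using smooth_upto_trunc[OF t0, of 0 k] by (auto intro: borel_measurable_continuous_onI)
  show ?thesis
  proof (rule nn_integral_Fatou_bound[where u="\<lambda>j x. ennreal (w x) * ennreal (\<bar>trunc k (t j) (u x)\<bar> powr s)"])
    show "(\<lambda>x. ennreal (w x) * ennreal (\<bar>trunc k (t j) (u x)\<bar> powr s)) \<in> borel_measurable (lebesgue_on D)" for j
      by measurable
    show "AE x in lebesgue_on D. (\<lambda>j. ennreal (w x) * ennreal (\<bar>trunc k (t j) (u x)\<bar> powr s))
       \<longlonglongrightarrow> ennreal (w x) * ennreal (max 0 (\<bar>u x\<bar> - k) powr s)"
    proof (rule AE_I2)
      fix x
      have "(\<lambda>j. \<bar>trunc k (t j) (u x)\<bar>) \<longlonglongrightarrow> max 0 (\<bar>u x\<bar> - k)"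
        by (rule filterlim_compose[OF trunc_tendsto(1)[OF k] t])
      then have "(\<lambda>j. \<bar>trunc k (t j) (u x)\<bar> powr s) \<longlonglongrightarrow> max 0 (\<bar>u x\<bar> - k) powr s"
        using s by (intro tendsto_powr') auto
      then show "(\<lambda>j. ennreal (w x) * ennreal (\<bar>trunc k (t j) (u x)\<bar> powr s))
       \<longlonglongrightarrow> ennreal (w x) * ennreal (max 0 (\<bar>u x\<bar> - k) powr s)"
        by (intro tendsto_mult_ennreal tendsto_ennrealI tendsto_const) auto
    qed
    fix j
    show "(\<integral>\<^sup>+ x. ennreal (w x) * ennreal (\<bar>trunc k (t j) (u x)\<bar> powr s) \<partial>lebesgue_on D) \<le> ennreal (C * f powr (s/m))"
    proof (rule tr[OF sobolev_W10_trunc[OF u D m k t0] f(1)])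
      have "(\<integral>\<^sup>+ x. ennreal (norm (trunc' k (t j) (u x) *\<^sub>R Du x) powr m) \<partial>lebesgue_on D)
        \<le> (\<integral>\<^sup>+ x. ennreal (indicator {t. \<bar>t\<bar> > k} (u x) * norm (Du x) powr m) \<partial>lebesgue_on D)"
      proof (intro nn_integral_mono ennreal_leI)
        fix x
        note b = trunc'_bounds[OF t0[of j] k, of "u x"]
        show "norm (trunc' k (t j) (u x) *\<^sub>R Du x) powr m \<le> indicator {t. \<bar>t\<bar> > k} (u x) * norm (Du x) powr m"
        proof (cases "\<bar>u x\<bar> > k")
          case True
          have "norm (trunc' k (t j) (u x) *\<^sub>R Du x) \<le> norm (Du x)"
            using b by (simp add: mult_left_le_one_le)
          then show ?thesis using True m by (simp add: powr_mono2)
        qed (use b m in auto)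
      qed
      also note f(2)
      finally show "(\<integral>\<^sup>+ x. ennreal (norm (trunc' k (t j) (u x) *\<^sub>R Du x) powr m) \<partial>lebesgue_on D) \<le> ennreal f" .
    qed
  qed
qed

text \<open>\<open>\<phi>\<close> stands for the value of \<open>\<phi> x powr (m/(m-1))\<close>.
  The choice of \<open>\<delta>\<close> leaves the gradient term with half of the coercivity. On the
  superlevel set \<open>\<bar>U\<bar> = t + k\<close>, so each of the two critical powers of
  \<open>\<bar>U\<bar>\<close> costs \<open>2 powr l\<close> and splits into \<open>t powr l\<close>
  and \<open>k powr l\<close>; \<open>t \<le> t powr s + 1\<close> splits \<open>\<psi> * t\<close>
  into a trace term and plain mass.\<close>

lemma energy_pointwise:
  fixes U k y \<phi> \<psi> m l s \<gamma> \<Lambda> :: real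
  defines "\<delta> \<equiv> \<gamma> / (2 * \<Lambda>)"
  defines "c \<equiv> \<Lambda> * (2 powr (l + 1) + \<delta> powr (1 - l) + 1)"
  defines "t \<equiv> max 0 (\<bar>U\<bar> - k)"
  assumes k: "k > 0" and l: "l > 1" and s: "s \<ge> 1" and \<gamma>: "\<gamma> > 0" and \<Lambda>: "\<Lambda> > 0"
    and y: "y \<ge> 0" and \<phi>: "\<phi> \<ge> 0" and \<psi>: "\<psi> \<ge> 0"
  shows "\<Lambda> * (\<psi> + \<bar>U\<bar> powr (l - 1) + y powr (m * (l - 1) / l)) * t + \<Lambda> * (\<bar>U\<bar> powr l + \<phi>) * indicator {t. \<bar>t\<bar> > k} U
    \<le> \<gamma> / 2 * (indicator {t. \<bar>t\<bar> > k} U * y powr m) + c * ((\<phi> + \<psi>) * t powr s + t powr l + (k powr l + (\<phi> + \<psi>)) * indicator {t. \<bar>t\<bar> > k} U)"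
proof (cases "\<bar>U\<bar> > k")
  case False
  then have "t = 0" by (simp add: t_def)
  then show ?thesis using False l s by simp
next
  case True
  then have t: "t > 0" "\<bar>U\<bar> = t + k" by (auto simp: t_def)
  have \<delta>: "\<delta> > 0" using \<gamma> \<Lambda> by (simp add: \<delta>_def)
  have "t \<le> t powr s + 1"
  proof (cases "t \<le> 1")
    case False
    then have "t powr 1 \<le> t powr s" using s by (intro powr_mono) auto
    then show ?thesis using t by simp
  qed (simp add: add_increasing)
  then have 1: "\<psi> * t \<le> \<psi> * (t powr s + 1)" using \<psi> by (rule mult_left_mono)
  have Ul: "\<bar>U\<bar> powr l \<le> 2 powr l * (t powr l + k powr l)"
    unfolding t(2) using t k l by (intro powr_add_le_2) auto
  have "\<bar>U\<bar> powr (l - 1) * t \<le> \<bar>U\<bar> powr (l - 1) * \<bar>U\<bar>"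
    unfolding t(2) using t k by (intro mult_left_mono) auto
  also have "\<dots> = \<bar>U\<bar> powr l" using t k by (simp add: powr_diff)
  finally have 2: "\<bar>U\<bar> powr (l - 1) * t \<le> \<bar>U\<bar> powr l" .
  have 3: "y powr (m * (l - 1) / l) * t \<le> \<delta> * y powr m + \<delta> powr (1 - l) * t powr l"
    using y t \<delta> l by (intro mult_powr_le_threshold) auto
  define Z where "Z = \<psi> * (t powr s + 1) + 2 * (2 powr l * (t powr l + k powr l)) + \<delta> powr (1 - l) * t powr l + \<phi>"
  have "(\<psi> + \<bar>U\<bar> powr (l - 1) + y powr (m * (l - 1) / l)) * t + (\<bar>U\<bar> powr l + \<phi>) \<le> \<delta> * y powr m + Z"
    using 1 2 3 Ul unfolding Z_def by (simp add: distrib_right)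
  then have "\<Lambda> * ((\<psi> + \<bar>U\<bar> powr (l - 1) + y powr (m * (l - 1) / l)) * t + (\<bar>U\<bar> powr l + \<phi>)) \<le> \<Lambda> * (\<delta> * y powr m + Z)"
    using \<Lambda> by (intro mult_left_mono) auto
  moreover have "\<Lambda> * (\<delta> * y powr m) = \<gamma> / 2 * y powr m" using \<Lambda> by (simp add: \<delta>_def)
  moreover have "Z \<le> (2 powr (l + 1) + \<delta> powr (1 - l) + 1) * ((\<phi> + \<psi>) * t powr s + t powr l + (k powr l + (\<phi> + \<psi>)))"
  proof -
    define P where "P = (2::real) powr (l + 1)"
    define Q where "Q = \<delta> powr (1 - l)"
    have P: "P \<ge> 0" "2 * 2 powr l = P" by (auto simp: P_def powr_add)
    have Q: "Q \<ge> 0" by (simp add: Q_def)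
    define a b c where "a = t powr s" and "b = t powr l" and "c = k powr l"
    have abc: "a \<ge> 0" "b \<ge> 0" "c \<ge> 0" by (auto simp: a_def b_def c_def)
    have "Z = \<psi> * a + \<psi> + P * (b + c) + Q * b + \<phi>"
      unfolding Z_def P(2)[symmetric] Q_def a_def b_def c_def by (simp add: algebra_simps)
    also have "\<dots> \<le> 1 * ((\<phi> + \<psi>) * a + (\<phi> + \<psi>)) + P * (b + c) + Q * b"
      using \<phi> abc by (simp add: algebra_simps)
    also have "\<dots> \<le> (P + Q + 1) * ((\<phi> + \<psi>) * a + b + (c + (\<phi> + \<psi>)))"
    proof -
      have "0 \<le> P * ((\<phi> + \<psi>) * a + (\<phi> + \<psi>))" "0 \<le> Q * ((\<phi> + \<psi>) * a + c + (\<phi> + \<psi>))" 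
        using P Q \<phi> \<psi> abc by (auto intro!: mult_nonneg_nonneg add_nonneg_nonneg)
      then show ?thesis using abc by (simp add: algebra_simps)
    qed
    finally show ?thesis by (simp add: P_def Q_def a_def b_def c_def)
  qed
  then have "\<Lambda> * Z \<le> c * ((\<phi> + \<psi>) * t powr s + t powr l + (k powr l + (\<phi> + \<psi>)))"
    unfolding c_def mult.assoc using \<Lambda> by (intro mult_left_mono) auto
  ultimately show ?thesis using True by (simp add: algebra_simps)
qed

text \<open>\<open>energy_estimate\<close> combined with the integrated form of
  \<open>energy_pointwise\<close>. Half of the energy is cancelled on both sides in
  \<open>ennreal\<close>, which is legitimate because it is the finite number \<open>f\<close>; the
  other terms may be infinite.\<close>

lemma caccioppoli_estimate:
  fixes D :: "(real^'n::finite) set" and a :: "real^'n \<Rightarrow> real \<Rightarrow> real^'n \<Rightarrow> real^'n"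
  defines "W \<equiv> (\<lambda>\<phi> \<psi> (m::real) (x::real^'n). \<phi> x powr (m/(m-1)) + \<psi> x :: real)"
  assumes D: "open D" "bounded D" and m: "m > 1" and l: "l > 1" and s: "s \<ge> 1" and k: "k > 0" and \<gamma>: "\<gamma> > 0" and \<Lambda>: "\<Lambda> > 0"
    and sol: "weak_solution m D a b u Du" and car: "caratheodory D a"
    and \<phi>0: "\<And>x. \<phi> x \<ge> 0" and \<psi>0: "\<And>x. \<psi> x \<ge> 0"
    and \<phi>m[measurable]: "\<phi> \<in> borel_measurable (lebesgue_on D)" and \<psi>m[measurable]: "\<psi> \<in> borel_measurable (lebesgue_on D)"
    and str: "AE x in lebesgue_on D. \<forall>z \<xi>.
            norm (a x z \<xi>) \<le> \<Lambda> * (\<phi> x + \<bar>z\<bar> powr (l * (m - 1) / m) + norm \<xi> powr (m - 1))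
          \<and> \<bar>b x z \<xi>\<bar> \<le> \<Lambda> * (\<psi> x + \<bar>z\<bar> powr (l - 1) + norm \<xi> powr (m * (l - 1) / l))
          \<and> a x z \<xi> \<bullet> \<xi> \<ge> \<gamma> * norm \<xi> powr m - \<Lambda> * \<bar>z\<bar> powr l - \<Lambda> * \<phi> x powr (m / (m - 1))"
    and ufin: "(\<integral>\<^sup>+ x. ennreal (\<bar>u x\<bar> powr l) \<partial>lebesgue_on D) < \<infinity>"
    and \<phi>fin: "(\<integral>\<^sup>+ x. ennreal (\<phi> x powr (m/(m-1))) \<partial>lebesgue_on D) < \<infinity>"
    and f: "f \<ge> 0" "(\<integral>\<^sup>+ x. ennreal (indicator {t. \<bar>t\<bar> > k} (u x) * norm (Du x) powr m) \<partial>lebesgue_on D) = ennreal f"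
  shows "ennreal (\<gamma> / 2 * f) \<le> ennreal (\<Lambda> * (2 powr (l + 1) + (\<gamma> / (2 * \<Lambda>)) powr (1 - l) + 1)) *
     ((\<integral>\<^sup>+ x. ennreal (W \<phi> \<psi> m x) * ennreal (max 0 (\<bar>u x\<bar> - k) powr s) \<partial>lebesgue_on D)
      + (\<integral>\<^sup>+ x. ennreal (max 0 (\<bar>u x\<bar> - k) powr l) \<partial>lebesgue_on D)
      + (\<integral>\<^sup>+ x. ennreal ((k powr l + W \<phi> \<psi> m x) * indicator {t. \<bar>t\<bar> > k} (u x)) \<partial>lebesgue_on D))"
proof -
  let ?N = "lebesgue_on D"
  define c where "c = \<Lambda> * (2 powr (l + 1) + (\<gamma> / (2 * \<Lambda>)) powr (1 - l) + 1)"
  have c: "c \<ge> 0" using \<Lambda> by (simp add: c_def)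
  define w where "w = W \<phi> \<psi> m"
  have w0: "w x \<ge> 0" for x using \<psi>0[of x] by (simp add: w_def W_def)
  have [measurable]: "w \<in> borel_measurable ?N" unfolding w_def W_def by measurable
  have u: "sobolev_W10 m D u Du" using sol by (simp add: weak_solution_def)
  note [measurable] = sobolev_W10_measurable[OF u]
  define t where "t = (\<lambda>x. max 0 (\<bar>u x\<bar> - k))"
  define i where "i = (\<lambda>x. indicator {t. \<bar>t\<bar> > k} (u x) :: real)"
  have [measurable]: "t \<in> borel_measurable ?N" "i \<in> borel_measurable ?N" unfolding t_def i_def by measurable
  have ti0: "t x \<ge> 0" "i x \<ge> 0" for x by (auto simp: t_def i_def)
  define Q where "Q = (\<integral>\<^sup>+ x. ennreal (w x) * ennreal (t x powr s) \<partial>?N) + (\<integral>\<^sup>+ x. ennreal (t x powr l) \<partial>?N)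
      + (\<integral>\<^sup>+ x. ennreal ((k powr l + w x) * i x) \<partial>?N)"
  have "ennreal (\<gamma> * f) = ennreal \<gamma> * (\<integral>\<^sup>+ x. ennreal (i x * norm (Du x) powr m) \<partial>?N)"
    using f \<gamma> by (simp add: i_def ennreal_mult')
  also have "\<dots> = (\<integral>\<^sup>+ x. ennreal (\<gamma> * (i x * norm (Du x) powr m)) \<partial>?N)"
    using \<gamma> by (subst nn_integral_cmult[symmetric]) (auto simp: ennreal_mult'[symmetric])
  also have "\<dots> \<le> (\<integral>\<^sup>+ x. ennreal (\<Lambda> * (\<psi> x + \<bar>u x\<bar> powr (l - 1) + norm (Du x) powr (m * (l - 1) / l)) * t x) \<partial>?N)
      + (\<integral>\<^sup>+ x. ennreal (\<Lambda> * (\<bar>u x\<bar> powr l + \<phi> x powr (m/(m-1))) * i x) \<partial>?N)"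
    unfolding t_def i_def using l by (intro energy_estimate[OF D m _ k \<gamma> \<Lambda> sol car \<phi>0 \<psi>0 \<phi>m \<psi>m str ufin \<phi>fin]) simp
  also have "\<dots> = (\<integral>\<^sup>+ x. ennreal (\<Lambda> * (\<psi> x + \<bar>u x\<bar> powr (l - 1) + norm (Du x) powr (m * (l - 1) / l)) * t x)
      + ennreal (\<Lambda> * (\<bar>u x\<bar> powr l + \<phi> x powr (m/(m-1))) * i x) \<partial>?N)"
    by (rule nn_integral_add[symmetric]) measurable
  also have "\<dots> \<le> (\<integral>\<^sup>+ x. ennreal (\<gamma> / 2) * ennreal (i x * norm (Du x) powr m)
       + ennreal c * (ennreal (w x) * ennreal (t x powr s) + ennreal (t x powr l) + ennreal ((k powr l + w x) * i x)) \<partial>?N)"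
  proof (rule nn_integral_mono)
    fix x
    have "\<Lambda> * (\<psi> x + \<bar>u x\<bar> powr (l - 1) + norm (Du x) powr (m * (l - 1) / l)) * t x + \<Lambda> * (\<bar>u x\<bar> powr l + \<phi> x powr (m/(m-1))) * i x
      \<le> \<gamma> / 2 * (i x * norm (Du x) powr m) + c * (w x * t x powr s + t x powr l + (k powr l + w x) * i x)"
      unfolding t_def i_def c_def w_def W_def
      by (rule energy_pointwise[OF k l s \<gamma> \<Lambda> norm_ge_zero powr_ge_zero \<psi>0])
    then have "ennreal (\<Lambda> * (\<psi> x + \<bar>u x\<bar> powr (l - 1) + norm (Du x) powr (m * (l - 1) / l)) * t x + \<Lambda> * (\<bar>u x\<bar> powr l + \<phi> x powr (m/(m-1))) * i x)
      \<le> ennreal (\<gamma> / 2 * (i x * norm (Du x) powr m) + c * (w x * t x powr s + t x powr l + (k powr l + w x) * i x))"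
      by (rule ennreal_leI)
    then show "ennreal (\<Lambda> * (\<psi> x + \<bar>u x\<bar> powr (l - 1) + norm (Du x) powr (m * (l - 1) / l)) * t x)
      + ennreal (\<Lambda> * (\<bar>u x\<bar> powr l + \<phi> x powr (m/(m-1))) * i x)
      \<le> ennreal (\<gamma> / 2) * ennreal (i x * norm (Du x) powr m)
       + ennreal c * (ennreal (w x) * ennreal (t x powr s) + ennreal (t x powr l) + ennreal ((k powr l + w x) * i x))"
      using w0[of x] ti0[of x] c \<gamma> \<Lambda> \<psi>0[of x]
      by (simp add: ennreal_plus[symmetric] ennreal_mult'[symmetric] del: ennreal_plus)
  qed
  also have "\<dots> = ennreal (\<gamma> / 2) * (\<integral>\<^sup>+ x. ennreal (i x * norm (Du x) powr m) \<partial>?N) + ennreal c * Q"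
    unfolding Q_def by (simp add: nn_integral_add nn_integral_cmult)
  also have "(\<integral>\<^sup>+ x. ennreal (i x * norm (Du x) powr m) \<partial>?N) = ennreal f" using f by (simp add: i_def)
  also have "ennreal (\<gamma> / 2) * ennreal f = ennreal (\<gamma> / 2 * f)" using \<gamma> by (intro ennreal_mult'[symmetric]) simp
  finally have "ennreal (\<gamma> * f) \<le> ennreal (\<gamma> / 2 * f) + ennreal c * Q" .
  moreover have "ennreal (\<gamma> * f) = ennreal (\<gamma> / 2 * f) + ennreal (\<gamma> / 2 * f)"
    using \<gamma> f by (subst ennreal_plus[symmetric]) auto
  ultimately have "ennreal (\<gamma> / 2 * f) \<le> ennreal c * Q"
    by (simp add: ennreal_add_left_cancel_le)
  then show ?thesis by (simp add: c_def Q_def w_def t_def i_def)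
qed

subsection \<open>De Giorgi iteration\<close>

text \<open>The ratio is chosen so that its power \<open>\<alpha>\<close> is \<open>1 / B\<close>,
  which cancels the growth of the coefficient; \<open>small\<close> then provides one further factor
  of the ratio per step. The recursion is assumed only where \<open>F j \<le> \<eta>\<close>, and a
  ratio of at most 1 keeps the sequence there.\<close>

lemma fast_geometric_decay:
  fixes F :: "nat \<Rightarrow> real"
  assumes F0: "\<And>j. F j \<ge> 0" and C: "C \<ge> 0" and B: "B > 0" and \<alpha>: "\<alpha> > 0"
    and step: "\<And>j. F j \<le> \<eta> \<Longrightarrow> F (Suc j) \<le> C * B ^ j * F j powr (1 + \<alpha>)" and B1: "B \<ge> 1"
    and init: "F 0 \<le> \<eta>" and \<eta>: "\<eta> > 0" and small: "C * \<eta> powr \<alpha> \<le> B powr (- 1/\<alpha>)"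
  shows "F j \<le> \<eta> * (B powr (- 1/\<alpha>)) ^ j"
proof (induction j)
  case (Suc j)
  define \<sigma> where "\<sigma> = B powr (- 1/\<alpha>)"
  have "\<sigma> \<le> B powr 0" unfolding \<sigma>_def using B1 \<alpha> by (intro powr_mono) auto
  then have \<sigma>: "\<sigma> > 0" "\<sigma> \<le> 1" using B by (auto simp: \<sigma>_def)
  have IH: "F j \<le> \<eta> * \<sigma> ^ j" using Suc by (simp add: \<sigma>_def)
  also have "\<dots> \<le> \<eta> * 1" using \<sigma> \<eta> by (intro mult_left_mono power_le_one) auto
  finally have "F (Suc j) \<le> C * B ^ j * F j powr (1 + \<alpha>)" by (intro step) simp
  also have "\<dots> \<le> C * B ^ j * (\<eta> * \<sigma> ^ j) powr (1 + \<alpha>)"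
    using IH F0 C B \<alpha> by (intro mult_left_mono powr_mono2) auto
  also have "(\<eta> * \<sigma> ^ j) powr (1 + \<alpha>) = (\<eta> * \<sigma> ^ j) * (\<eta> powr \<alpha> * (\<sigma> powr \<alpha>) ^ j)"
    using \<eta> \<sigma> by (simp add: powr_add powr_mult powr_realpow[symmetric] powr_powr mult.commute)
  also have "\<sigma> powr \<alpha> = 1 / B" unfolding \<sigma>_def powr_powr using B \<alpha> by (simp add: powr_neg_one)
  also have "C * B ^ j * ((\<eta> * \<sigma> ^ j) * (\<eta> powr \<alpha> * (1 / B) ^ j)) = (\<eta> * \<sigma> ^ j) * (C * \<eta> powr \<alpha>)"
    using B by (simp add: power_one_over field_simps)
  also have "\<dots> \<le> (\<eta> * \<sigma> ^ j) * \<sigma>"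
    using small \<eta> \<sigma> by (intro mult_left_mono) (auto simp: \<sigma>_def)
  finally show ?case by (simp add: \<sigma>_def mult_ac)
qed (use init in simp)

text \<open>Where \<open>\<bar>u x\<bar> > h\<close>, the truncation at \<open>k\<close> is at least
  \<open>h - k\<close>. The level term \<open>h powr l\<close> turns into the scale-invariant factor
  \<open>(h / (h - k)) powr l\<close>, so a large level does no harm by itself.\<close>

lemma superlevel_bound:
  fixes u w :: "'a \<Rightarrow> real"
  assumes [measurable]: "u \<in> borel_measurable M" "w \<in> borel_measurable M" and w: "\<And>x. w x \<ge> 0"
    and kh: "0 < k" "k < h" and s: "s > 0" and l: "l > 0"
  shows "(\<integral>\<^sup>+ x. ennreal ((h powr l + w x) * indicator {t. \<bar>t\<bar> > h} (u x)) \<partial>M)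
    \<le> ennreal ((h / (h - k)) powr l) * (\<integral>\<^sup>+ x. ennreal (max 0 (\<bar>u x\<bar> - k) powr l) \<partial>M)
     + ennreal ((h - k) powr (- s)) * (\<integral>\<^sup>+ x. ennreal (w x) * ennreal (max 0 (\<bar>u x\<bar> - k) powr s) \<partial>M)"
proof -
  have "(\<integral>\<^sup>+ x. ennreal ((h powr l + w x) * indicator {t. \<bar>t\<bar> > h} (u x)) \<partial>M)
    \<le> (\<integral>\<^sup>+ x. ennreal ((h / (h - k)) powr l) * ennreal (max 0 (\<bar>u x\<bar> - k) powr l)
        + ennreal ((h - k) powr (- s)) * (ennreal (w x) * ennreal (max 0 (\<bar>u x\<bar> - k) powr s)) \<partial>M)"
  proof (rule nn_integral_mono)
    fix x
    define t where "t = max 0 (\<bar>u x\<bar> - k)"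
    have "(h powr l + w x) * indicator {t. \<bar>t\<bar> > h} (u x) \<le> (h / (h - k)) powr l * t powr l + (h - k) powr (- s) * (w x * t powr s)"
    proof (cases "\<bar>u x\<bar> > h")
      case True
      then have t: "t \<ge> h - k" by (simp add: t_def)
      have "h powr l = (h / (h - k)) powr l * (h - k) powr l" using kh by (simp add: powr_divide)
      also have "\<dots> \<le> (h / (h - k)) powr l * t powr l" using t kh l by (intro mult_left_mono powr_mono2) auto
      finally have 1: "h powr l \<le> (h / (h - k)) powr l * t powr l" .
      have "w x = (h - k) powr (- s) * (w x * (h - k) powr s)" using kh by (simp add: powr_minus)
      also have "\<dots> \<le> (h - k) powr (- s) * (w x * t powr s)"
        using t kh s w by (intro mult_left_mono powr_mono2) auto
      finally show ?thesis using 1 True by simp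
    qed (use w in auto)
    then show "ennreal ((h powr l + w x) * indicator {t. \<bar>t\<bar> > h} (u x))
      \<le> ennreal ((h / (h - k)) powr l) * ennreal (max 0 (\<bar>u x\<bar> - k) powr l)
        + ennreal ((h - k) powr (- s)) * (ennreal (w x) * ennreal (max 0 (\<bar>u x\<bar> - k) powr s))"
      unfolding t_def[symmetric] using w[of x]
      by (simp add: ennreal_plus[symmetric] ennreal_mult'[symmetric] ennreal_leI del: ennreal_plus)
  qed
  also have "\<dots> = ennreal ((h / (h - k)) powr l) * (\<integral>\<^sup>+ x. ennreal (max 0 (\<bar>u x\<bar> - k) powr l) \<partial>M)
     + ennreal ((h - k) powr (- s)) * (\<integral>\<^sup>+ x. ennreal (w x) * ennreal (max 0 (\<bar>u x\<bar> - k) powr s) \<partial>M)"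
    by (simp add: nn_integral_add nn_integral_cmult)
  finally show ?thesis .
qed

text \<open>The iteration runs on the truncated energies \<open>f\<close>. The term \<open>k powr l\<close> in the energy estimate has
  critical growth, but measured against \<open>max 0 (\<bar>u x\<bar> - k) powr l\<close> at the dyadic levels
  \<open>k0 * (2 - 1 / 2 ^ j)\<close> it only costs a factor \<open>2 powr (l * (j + 2))\<close>. Hence smallness of the
  initial energy suffices, with no prior gain of integrability.\<close>
lemma De_Giorgi_bound:
  fixes u w :: "'a \<Rightarrow> real" and f :: "real \<Rightarrow> real"
  assumes um[measurable]: "u \<in> borel_measurable M" and wm[measurable]: "w \<in> borel_measurable M" and w: "\<And>x. w x \<ge> 0"
    and m: "m > 0" "m < s" "s \<le> l" and C: "C > 0" and c: "c > 0" and \<gamma>: "\<gamma> > 0"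
    and f0: "\<And>k. f k \<ge> 0" and fmono: "\<And>k h. 0 < k \<Longrightarrow> k \<le> h \<Longrightarrow> f h \<le> f k"
    and X: "\<And>k. k > 0 \<Longrightarrow> (\<integral>\<^sup>+ x. ennreal (max 0 (\<bar>u x\<bar> - k) powr l) \<partial>M) \<le> ennreal (C * f k powr (l/m))"
    and Y: "\<And>k. k > 0 \<Longrightarrow> (\<integral>\<^sup>+ x. ennreal (w x) * ennreal (max 0 (\<bar>u x\<bar> - k) powr s) \<partial>M) \<le> ennreal (C * f k powr (s/m))"
    and E: "\<And>k. k > 0 \<Longrightarrow> ennreal (\<gamma> / 2 * f k) \<le> ennreal c *
       ((\<integral>\<^sup>+ x. ennreal (w x) * ennreal (max 0 (\<bar>u x\<bar> - k) powr s) \<partial>M)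
       + (\<integral>\<^sup>+ x. ennreal (max 0 (\<bar>u x\<bar> - k) powr l) \<partial>M)
       + (\<integral>\<^sup>+ x. ennreal ((k powr l + w x) * indicator {t. \<bar>t\<bar> > k} (u x)) \<partial>M))"
    and k0: "k0 \<ge> 1" and init: "f k0 \<le> \<eta>" and \<eta>: "0 < \<eta>" "\<eta> \<le> 1"
    and small1: "8 * C * c * \<eta> powr (s/m - 1) \<le> \<gamma>"
    and small2: "(4 * c / \<gamma> * (2 * C * 4 powr l)) * \<eta> powr (s/m - 1) \<le> (2 powr l) powr (- 1/(s/m - 1))"
  shows "AE x in M. \<bar>u x\<bar> \<le> 2 * k0"
proof -
  define \<alpha>' where "\<alpha>' = s/m - 1"
  have \<alpha>': "\<alpha>' > 0" using m by (simp add: \<alpha>'_def field_simps)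
  have l0: "l > 0" "s > 0" using m by auto
  define k where "k = (\<lambda>j::nat. k0 * (2 - 1 / 2 ^ j))"
  have kpos: "k j \<ge> k0" "k j < k (Suc j)" "k j < 2 * k0" for j
  proof -
    have "(1::real) / 2 ^ j \<le> 1" "(1::real) / 2 ^ j > 0" by auto
    then show "k j \<ge> k0" "k j < 2 * k0" using k0 by (auto simp: k_def)
    show "k j < k (Suc j)" using k0 by (simp add: k_def field_simps)
  qed
  have kdiff: "k (Suc j) - k j = k0 / 2 ^ (Suc j)" for j by (simp add: k_def field_simps)
  have kp: "k j > 0" for j using kpos(1)[of j] k0 by linarith
  \<comment> \<open>As \<open>\<eta> \<le> 1\<close> and \<open>s \<le> l\<close>, the Sobolev term
    is dominated by the same power \<open>s/m\<close> as the weighted term.\<close>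
  have le_s: "f h powr (l/m) \<le> f h powr (s/m)" if "f h \<le> \<eta>" for h
  proof (cases "f h = 0")
    case False
    then show ?thesis using f0[of h] that \<eta> m by (intro powr_mono') (auto simp: divide_right_mono)
  qed simp
  have step: "f (k (Suc j)) \<le> (4 * c / \<gamma> * (2 * C * 4 powr l)) * (2 powr l) ^ j * f (k j) powr (1 + \<alpha>')"
    if fj: "f (k j) \<le> \<eta>" for j
  proof -
    let ?h = "k (Suc j)" and ?k = "k j"
    define Fs where "Fs = f ?k powr (s/m)"
    have Fs: "Fs \<ge> 0" by (simp add: Fs_def)
    have fh: "f ?h \<le> f ?k" using kp kpos(2)[of j] by (intro fmono) auto
    with fj have fh\<eta>: "f ?h \<le> \<eta>" by simp
    have T: "(\<integral>\<^sup>+ x. ennreal ((?h powr l + w x) * indicator {t. \<bar>t\<bar> > ?h} (u x)) \<partial>M) \<le> ennreal ((2 * C * 4 powr l) * (2 powr l) ^ j * Fs)"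
    proof -
      \<comment> \<open>The gap is \<open>k0 / 2 ^ Suc j\<close> and \<open>?h < 2 * k0\<close>, so
        \<open>2 ^ (j + 2)\<close> bounds the ratio \<open>?h / (?h - ?k)\<close>; as
        \<open>k0 \<ge> 1\<close>, it also bounds \<open>1 / (?h - ?k)\<close>.\<close>
      define R where "R = (2::real) ^ (Suc (Suc j)) "
      have R1: "R \<ge> 1" unfolding R_def by (rule one_le_power) simp
      have "?h / (?h - ?k) \<le> R"
      proof -
        have "?h \<le> R * (?h - ?k)" using kpos(3)[of "Suc j"] unfolding kdiff R_def by (simp add: field_simps)
        then show ?thesis using kpos(2)[of j] by (simp add: pos_divide_le_eq)
      qed
      then have a: "(?h / (?h - ?k)) powr l \<le> R powr l"
        using kp kpos(2)[of j] l0 by (intro powr_mono2) (auto intro: less_imp_le)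
      have "(?h - ?k) powr (- s) \<le> (1 / R) powr (- s)"
      proof (rule powr_mono2')
        show "1 / R \<le> ?h - ?k" using k0 unfolding kdiff R_def by (simp add: field_simps)
      qed (use l0 R1 in auto)
      also have "\<dots> = R powr s" using R1 by (simp add: powr_minus powr_divide)
      also have "\<dots> \<le> R powr l" using R1 m by (intro powr_mono) auto
      finally have b: "(?h - ?k) powr (- s) \<le> R powr l" .
      have "(\<integral>\<^sup>+ x. ennreal ((?h powr l + w x) * indicator {t. \<bar>t\<bar> > ?h} (u x)) \<partial>M)
        \<le> ennreal ((?h / (?h - ?k)) powr l) * (\<integral>\<^sup>+ x. ennreal (max 0 (\<bar>u x\<bar> - ?k) powr l) \<partial>M)
         + ennreal ((?h - ?k) powr (- s)) * (\<integral>\<^sup>+ x. ennreal (w x) * ennreal (max 0 (\<bar>u x\<bar> - ?k) powr s) \<partial>M)"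
        by (rule superlevel_bound[OF um wm w kp kpos(2) l0(2) l0(1)])
      also have "\<dots> \<le> ennreal (R powr l) * ennreal (C * Fs) + ennreal (R powr l) * ennreal (C * Fs)"
      proof (intro add_mono mult_mono ennreal_leI a b)
        show "(\<integral>\<^sup>+ x. ennreal (max 0 (\<bar>u x\<bar> - ?k) powr l) \<partial>M) \<le> ennreal (C * Fs)"
          using X[OF kp[of j]] le_s[OF fj] C by (elim order_trans) (auto simp: Fs_def intro!: ennreal_leI)
        show "(\<integral>\<^sup>+ x. ennreal (w x) * ennreal (max 0 (\<bar>u x\<bar> - ?k) powr s) \<partial>M) \<le> ennreal (C * Fs)"
          unfolding Fs_def by (rule Y[OF kp])
      qed auto
      also have "\<dots> = ennreal (2 * C * R powr l * Fs)"
        using C Fs by (simp add: ennreal_mult'[symmetric] ennreal_plus[symmetric] mult_ac del: ennreal_plus)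
      also have "R powr l = 4 powr l * (2 powr l) ^ j"
        by (simp add: R_def powr_mult powr_realpow[symmetric] powr_powr mult.commute)
      finally show ?thesis by (simp add: mult_ac)
    qed
    define Th where "Th = (2 * C * 4 powr l) * (2 powr l) ^ j * Fs"
    have Th: "Th \<ge> 0" using C Fs by (simp add: Th_def)
    have hp: "?h > 0" by (rule kp)
    have "ennreal (\<gamma> / 2 * f ?h) \<le> ennreal c * (ennreal (C * f ?h powr (s/m)) + ennreal (C * f ?h powr (s/m)) + ennreal Th)"
    proof (rule order_trans[OF E[OF hp]], intro mult_left_mono add_mono Y[OF hp])
      show "(\<integral>\<^sup>+ x. ennreal (max 0 (\<bar>u x\<bar> - ?h) powr l) \<partial>M) \<le> ennreal (C * f ?h powr (s/m))"
        using X[OF hp] le_s[OF fh\<eta>] C by (elim order_trans) (auto intro!: ennreal_leI)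
    qed (use T in \<open>auto simp: Th_def\<close>)
    also have "\<dots> = ennreal (c * (2 * C * f ?h powr (s/m) + Th))"
      using c C Th by (simp add: ennreal_mult'[symmetric] ennreal_plus[symmetric] del: ennreal_plus)
    finally have "\<gamma> / 2 * f ?h \<le> c * (2 * C * f ?h powr (s/m) + Th)"
      using c C Th by (subst (asm) ennreal_le_iff) auto
    \<comment> \<open>Absorption: the two terms at level \<open>?h\<close> carry the power
      \<open>s/m > 1\<close> of an energy below \<open>\<eta>\<close>, so by \<open>small1\<close>
      they use up half of the left side. The superlevel term \<open>Th\<close>, controlled by the
      previous level, is what remains.\<close>
    moreover have "c * (2 * C * f ?h powr (s/m)) \<le> \<gamma> / 4 * f ?h"
    proof -
      have "f ?h powr (s/m) = f ?h * f ?h powr (s/m - 1)"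
        using f0[of ?h] by (cases "f ?h = 0") (auto simp: powr_diff)
      also have "\<dots> \<le> f ?h * \<eta> powr (s/m - 1)"
        using f0[of ?h] fh\<eta> \<alpha>' by (intro mult_left_mono powr_mono2) (auto simp: \<alpha>'_def)
      finally have "c * (2 * C * f ?h powr (s/m)) \<le> c * (2 * C * (f ?h * \<eta> powr (s/m - 1)))"
        using c C by (intro mult_left_mono) auto
      also have "\<dots> = f ?h / 4 * (8 * C * c * \<eta> powr (s/m - 1))" by (simp add: mult_ac)
      also have "\<dots> \<le> f ?h / 4 * \<gamma>" using f0[of ?h] by (intro mult_left_mono small1) auto
      finally show ?thesis by (simp add: mult_ac)
    qed
    ultimately have "\<gamma> / 4 * f ?h \<le> c * Th" by (simp add: distrib_left)
    then have "f ?h \<le> 4 * c / \<gamma> * Th" using \<gamma> by (simp add: field_simps)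
    also have "Fs = f ?k powr (1 + \<alpha>')" by (simp add: Fs_def \<alpha>'_def)
    then have "4 * c / \<gamma> * Th = (4 * c / \<gamma> * (2 * C * 4 powr l)) * (2 powr l) ^ j * f ?k powr (1 + \<alpha>')"
      by (simp add: Th_def mult_ac)
    finally show ?thesis .
  qed
  define \<sigma> where "\<sigma> = (2 powr l) powr (- 1/\<alpha>')"
  have \<sigma>: "0 < \<sigma>" "\<sigma> < 1"
  proof -
    show "0 < \<sigma>" by (simp add: \<sigma>_def)
    have "\<sigma> = 2 powr (- (l / \<alpha>'))" by (simp add: \<sigma>_def powr_powr)
    also have "\<dots> < 2 powr 0" using l0 \<alpha>' by (intro powr_less_mono) auto
    finally show "\<sigma> < 1" by simp
  qed
  have decay: "f (k j) \<le> \<eta> * \<sigma> ^ j" for j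
    unfolding \<sigma>_def
  proof (rule fast_geometric_decay[where C="4 * c / \<gamma> * (2 * C * 4 powr l)"])
    show "f (k 0) \<le> \<eta>" using init by (simp add: k_def)
    show "4 * c / \<gamma> * (2 * C * 4 powr l) * \<eta> powr \<alpha>' \<le> (2 powr l) powr (- 1/\<alpha>')"
      unfolding \<alpha>'_def by (rule small2)
  qed (use f0 C c \<gamma> \<alpha>' \<eta> step l0 in \<open>auto simp: ge_one_powr_ge_zero\<close>)
  \<comment> \<open>\<open>2 * k0\<close> lies above every \<open>k j\<close>, so its Sobolev term
    is bounded by those at the levels \<open>k j\<close>, which tend to 0.\<close>
  have bound: "(\<integral>\<^sup>+ x. ennreal (max 0 (\<bar>u x\<bar> - 2 * k0) powr l) \<partial>M) \<le> ennreal (C * (\<eta> * \<sigma> ^ j) powr (l/m))" for j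
  proof -
    have "(\<integral>\<^sup>+ x. ennreal (max 0 (\<bar>u x\<bar> - 2 * k0) powr l) \<partial>M) \<le> (\<integral>\<^sup>+ x. ennreal (max 0 (\<bar>u x\<bar> - k j) powr l) \<partial>M)"
      using kpos(3)[of j] l0 by (intro nn_integral_mono ennreal_leI powr_mono2) auto
    also have "\<dots> \<le> ennreal (C * f (k j) powr (l/m))" by (rule X[OF kp])
    also have "\<dots> \<le> ennreal (C * (\<eta> * \<sigma> ^ j) powr (l/m))"
      using decay f0 C l0 m by (intro ennreal_leI mult_left_mono powr_mono2) auto
    finally show ?thesis .
  qed
  have "(\<lambda>j. ennreal (C * (\<eta> * \<sigma> ^ j) powr (l/m))) \<longlonglongrightarrow> ennreal (C * (\<eta> * 0) powr (l/m))"
    using \<sigma> \<eta> l0 m by (intro tendsto_ennrealI tendsto_mult tendsto_const tendsto_powr' LIMSEQ_realpow_zero) auto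
  then have "(\<integral>\<^sup>+ x. ennreal (max 0 (\<bar>u x\<bar> - 2 * k0) powr l) \<partial>M) \<le> ennreal (C * (\<eta> * 0) powr (l/m))"
    by (rule tendsto_lowerbound) (use bound in auto)
  then have "(\<integral>\<^sup>+ x. ennreal (max 0 (\<bar>u x\<bar> - 2 * k0) powr l) \<partial>M) = 0" by simp
  then have "AE x in M. ennreal (max 0 (\<bar>u x\<bar> - 2 * k0) powr l) = 0"
    by (subst (asm) nn_integral_0_iff_AE) auto
  then show ?thesis
    by eventually_elim (auto simp: ennreal_eq_0_iff max_def split: if_splits)
qed

subsection \<open>Essential boundedness\<close>

text \<open>Dependence on the data is expressed by the order of quantifiers: \<open>M\<close>
  precedes domain, coefficients and solution, which are seen only through the exponents and
  constants, the bounds \<open>d\<close>, \<open>\<Phi>\<close>, \<open>\<Psi>\<close>,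
  \<open>K\<close> and the modulus \<open>\<omega>\<close> of uniform integrability.\<close>

theorem theorem1:
  fixes m l \<gamma> \<Lambda> p lam q \<mu> P A r0 :: real
    and \<Phi> \<Psi> d K :: real
    and \<omega> :: "real \<Rightarrow> real"
  defines "n \<equiv> real CARD('n::finite)"
  assumes n2: "CARD('n) \<ge> 2"
    and m: "1 < m" "m \<le> n"
    and ell: "(m < n \<and> l = n * m / (n - m)) \<or> (m = n \<and> l > n)"
    and P: "1 < P" "P < m"
    and A: "A > 0" and r0: "r0 > 0"
    and \<Lambda>: "\<Lambda> > 0" and \<gamma>: "\<gamma> > 0"
    and p: "p > m / (m - 1)" "0 < lam" "lam < n" "(m - 1) * p + lam > n"
    and q: "q > m * n / (m * n + m - n)" "0 < \<mu>" "\<mu> < n" "m * q + \<mu> > n"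
    and \<omega>: "(\<omega> \<longlongrightarrow> 0) (at_right 0)"
  shows "\<exists>M::real. \<forall>(\<Omega>::(real^'n) set) a b \<phi> \<psi> u Du.
     (open \<Omega> \<and> connected \<Omega> \<and> \<Omega> \<noteq> {} \<and> bounded \<Omega> \<and> diameter \<Omega> \<le> d
      \<and> (\<forall>x \<in> - \<Omega>. \<forall>r. 0 < r \<and> r < r0 \<longrightarrow>
            cap_compact P ((- \<Omega>) \<inter> cball x r) (ball x (2 * r))
              \<ge> ennreal A * cap_compact P (cball x r) (ball x (2 * r)))
      \<and> caratheodory \<Omega> a \<and> caratheodory \<Omega> b
      \<and> (\<forall>x. \<phi> x \<ge> 0) \<and> in_morrey p lam \<Omega> \<phi> \<and> morrey_norm p lam \<Omega> \<phi> \<le> \<Phi>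
      \<and> (\<forall>x. \<psi> x \<ge> 0) \<and> in_morrey q \<mu> \<Omega> \<psi> \<and> morrey_norm q \<mu> \<Omega> \<psi> \<le> \<Psi>
      \<and> (AE x in lebesgue_on \<Omega>. \<forall>z \<xi>.
            norm (a x z \<xi>) \<le> \<Lambda> * (\<phi> x + \<bar>z\<bar> powr (l * (m - 1) / m) + norm \<xi> powr (m - 1))
          \<and> \<bar>b x z \<xi>\<bar> \<le> \<Lambda> * (\<psi> x + \<bar>z\<bar> powr (l - 1) + norm \<xi> powr (m * (l - 1) / l))
          \<and> a x z \<xi> \<bullet> \<xi> \<ge> \<gamma> * norm \<xi> powr m - \<Lambda> * \<bar>z\<bar> powr l - \<Lambda> * \<phi> x powr (m / (m - 1)))
      \<and> weak_solution m \<Omega> a b u Du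
      \<and> (\<integral>\<^sup>+ x\<in>\<Omega>. ennreal (norm (Du x) powr m) \<partial>lebesgue) \<le> ennreal K
      \<and> (\<forall>E. E \<in> sets lebesgue \<and> E \<subseteq> \<Omega> \<longrightarrow>
            (\<integral>\<^sup>+ x\<in>E. ennreal (norm (Du x) powr m) \<partial>lebesgue) \<le> ennreal (\<omega> (measure lebesgue E))))
     \<longrightarrow> (AE x in lebesgue_on \<Omega>. \<bar>u x\<bar> \<le> M)"
proof -
  define m' where "m' = m / (m - 1)"
  have m': "m' > 1" using m by (simp add: m'_def field_simps)
  have n2': "2 \<le> n" using n2 by (simp add: n_def)
  have n0: "n > 0" using n2' by simp
  have l: "l > 1" "l > m"
  proof -
    show "l > m" using ell
    proof
      assume h: "m < n \<and> l = n * m / (n - m)"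
      then have "m * (n - m) < n * m" using m by (simp add: algebra_simps)
      then show "l > m" using h by (simp add: pos_less_divide_eq)
    qed (use m in auto)
    then show "l > 1" using m by simp
  qed
  have q1: "q > 1"
  proof -
    have "0 < n * (m - 1) + m" using n0 m by (simp add: add_pos_pos)
    then have "m * n + m - n > 0" by (simp add: algebra_simps)
    then have "1 \<le> m * n / (m * n + m - n)" using m by (simp add: pos_le_divide_eq)
    with q show ?thesis by simp
  qed
  have pm: "p \<ge> m'" "p > 0" using p m' by (auto simp: m'_def)
  \<comment> \<open>Growth exponents of \<open>\<phi> x powr m'\<close> and \<open>\<psi>\<close>,
    that is \<open>in_morrey_lower_growth\<close> with \<open>t = m'\<close> and
    \<open>t = 1\<close>. The Morrey conditions are equivalent to both exceeding
    \<open>n - m\<close>.\<close>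
  define \<beta>1 where "\<beta>1 = n - (n - lam) * m' / p"
  define \<beta>2 where "\<beta>2 = n - (n - \<mu>) * 1 / q"
  have \<beta>1: "n - m < \<beta>1" "\<beta>1 \<le> n"
  proof -
    have "n - lam < (m - 1) * p" using p by simp
    then have "(n - lam) * m' < (m - 1) * p * m'" using m' by (intro mult_strict_right_mono) auto
    also have "(m - 1) * p * m' = m * p" using m by (simp add: m'_def)
    finally show "n - m < \<beta>1" using pm by (simp add: \<beta>1_def pos_divide_less_eq)
    show "\<beta>1 \<le> n" using p m' pm by (simp add: \<beta>1_def)
  qed
  have \<beta>2: "n - m < \<beta>2" "\<beta>2 \<le> n"
    using q q1 by (auto simp: \<beta>2_def pos_divide_less_eq)
  \<comment> \<open>One exponent has to serve both weights, hence the smaller trace exponent; it is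
    at most \<open>l\<close> because \<open>\<beta>1\<close> and \<open>\<beta>2\<close> are at most
    \<open>n\<close>. For \<open>m = n\<close> there is no upper limit and \<open>l\<close> itself
    is taken.\<close>
  define s where "s = (if m < n then min (m * \<beta>1 / (n - m)) (m * \<beta>2 / (n - m)) else l)"
  have s: "m < s" "s \<le> l" "m < n \<Longrightarrow> s \<le> m * \<beta>1 / (n - m)" "m < n \<Longrightarrow> s \<le> m * \<beta>2 / (n - m)"
  proof -
    show "m < s"
    proof (cases "m < n")
      case True
      have "m * (n - m) < m * \<beta>1" "m * (n - m) < m * \<beta>2" using \<beta>1 \<beta>2 m by simp_all
      then show ?thesis using True by (simp add: s_def pos_less_divide_eq)
    qed (use l in \<open>simp add: s_def\<close>)
    show "s \<le> l"
    proof (cases "m < n")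
      case True
      then have "m * \<beta>1 / (n - m) \<le> m * n / (n - m)" using \<beta>1 m by (intro divide_right_mono mult_left_mono) auto
      then show ?thesis using True ell by (auto simp: s_def mult.commute)
    qed (simp add: s_def)
  qed (auto simp: s_def)
  have ln: "m < n \<Longrightarrow> l \<le> m * n / (n - m)" using ell by (auto simp: mult.commute)
  define V where "V = unit_ball_vol n"
  have V: "V \<ge> 0" using n0 by (simp add: V_def)
  define C1 where "C1 = \<bar>\<Phi>\<bar> powr m' * V powr (1 - m'/p)"
  define C2 where "C2 = \<bar>\<Psi>\<bar> powr 1 * V powr (1 - 1/q)"
  have C12: "C1 \<ge> 0" "C2 \<ge> 0" by (auto simp: C1_def C2_def)
  obtain CA where CA: "CA \<ge> 0" "\<And>(D::(real^'n) set) w v Dv F. open D \<Longrightarrow> bounded D \<Longrightarrow> diameter D \<le> d \<Longrightarrow> lower_growth V n D w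
     \<Longrightarrow> sobolev_W10 m D v Dv \<Longrightarrow> F \<ge> 0 \<Longrightarrow> (\<integral>\<^sup>+ x. ennreal (norm (Dv x) powr m) \<partial>lebesgue_on D) \<le> ennreal F
     \<Longrightarrow> (\<integral>\<^sup>+ x. ennreal (w x) * ennreal (\<bar>v x\<bar> powr l) \<partial>lebesgue_on D) \<le> ennreal (CA * F powr (l/m))"
    using sobolev_W10_Morrey_trace[where 'n='n, of m n l V d] n2' m l ln V unfolding n_def by auto
  obtain CB where CB: "CB \<ge> 0" "\<And>(D::(real^'n) set) w v Dv F. open D \<Longrightarrow> bounded D \<Longrightarrow> diameter D \<le> d \<Longrightarrow> lower_growth C1 \<beta>1 D w
     \<Longrightarrow> sobolev_W10 m D v Dv \<Longrightarrow> F \<ge> 0 \<Longrightarrow> (\<integral>\<^sup>+ x. ennreal (norm (Dv x) powr m) \<partial>lebesgue_on D) \<le> ennreal F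
     \<Longrightarrow> (\<integral>\<^sup>+ x. ennreal (w x) * ennreal (\<bar>v x\<bar> powr s) \<partial>lebesgue_on D) \<le> ennreal (CB * F powr (s/m))"
    using sobolev_W10_Morrey_trace[where 'n='n, of m \<beta>1 s C1 d] n2' m \<beta>1 s C12 unfolding n_def by auto
  obtain CC where CC: "CC \<ge> 0" "\<And>(D::(real^'n) set) w v Dv F. open D \<Longrightarrow> bounded D \<Longrightarrow> diameter D \<le> d \<Longrightarrow> lower_growth C2 \<beta>2 D w
     \<Longrightarrow> sobolev_W10 m D v Dv \<Longrightarrow> F \<ge> 0 \<Longrightarrow> (\<integral>\<^sup>+ x. ennreal (norm (Dv x) powr m) \<partial>lebesgue_on D) \<le> ennreal F
     \<Longrightarrow> (\<integral>\<^sup>+ x. ennreal (w x) * ennreal (\<bar>v x\<bar> powr s) \<partial>lebesgue_on D) \<le> ennreal (CC * F powr (s/m))"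
    using sobolev_W10_Morrey_trace[where 'n='n, of m \<beta>2 s C2 d] n2' m \<beta>2 s C12 unfolding n_def by auto
  define C where "C = CA + CB + CC + 1"
  have C: "C > 0" "CA \<le> C" "CB + CC \<le> C" using CA(1) CB(1) CC(1) by (auto simp: C_def)
  define \<alpha> where "\<alpha> = s/m - 1"
  have \<alpha>: "\<alpha> > 0" using s m by (simp add: \<alpha>_def)
  define c where "c = \<Lambda> * (2 powr (l + 1) + (\<gamma> / (2 * \<Lambda>)) powr (1 - l) + 1)"
  have c: "c > 0" using \<Lambda> by (auto simp: c_def intro!: mult_pos_pos add_nonneg_pos)
  define C5 where "C5 = 4 * c / \<gamma> * (2 * C * 4 powr l)"
  have C5: "C5 > 0" using c \<gamma> C by (simp add: C5_def)
  \<comment> \<open>\<open>z\<close> is the largest value of \<open>\<eta> powr \<alpha>\<close> for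
    which both smallness conditions of \<open>De_Giorgi_bound\<close> hold. It is determined by the
    constants alone; \<open>\<omega>\<close> is consulted only once \<open>\<eta>\<close> is
    known.\<close>
  define z where "z = min (\<gamma> / (8 * C * c)) ((2 powr l) powr (- 1/\<alpha>) / C5)"
  have z: "z > 0" using \<gamma> C c C5 by (simp add: z_def)
  define \<eta> where "\<eta> = min 1 (z powr (1/\<alpha>))"
  have \<eta>: "0 < \<eta>" "\<eta> \<le> 1" using z by (auto simp: \<eta>_def)
  have "\<eta> powr \<alpha> \<le> (z powr (1/\<alpha>)) powr \<alpha>" using \<eta> \<alpha> by (intro powr_mono2) (auto simp: \<eta>_def)
  also have "\<dots> = z" using z \<alpha> by (simp add: powr_powr)
  finally have \<eta>z: "\<eta> powr \<alpha> \<le> z" .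
  have small1: "8 * C * c * \<eta> powr (s/m - 1) \<le> \<gamma>"
  proof -
    have "\<eta> powr \<alpha> \<le> \<gamma> / (8 * C * c)" using \<eta>z by (simp add: z_def)
    then show ?thesis using C c unfolding \<alpha>_def by (simp add: pos_le_divide_eq mult.commute)
  qed
  have small2: "(4 * c / \<gamma> * (2 * C * 4 powr l)) * \<eta> powr (s/m - 1) \<le> (2 powr l) powr (- 1/(s/m - 1))"
  proof -
    have "\<eta> powr \<alpha> \<le> (2 powr l) powr (- 1/\<alpha>) / C5" using \<eta>z by (simp add: z_def)
    then have "C5 * \<eta> powr \<alpha> \<le> (2 powr l) powr (- 1/\<alpha>)" using C5 by (simp add: pos_le_divide_eq mult.commute)
    then show ?thesis unfolding C5_def \<alpha>_def .
  qed
  have "\<forall>\<^sub>F t in at_right 0. \<omega> t < \<eta>" using \<omega> \<eta>(1) by (rule order_tendstoD)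
  then obtain \<delta> where \<delta>: "\<delta> > 0" "\<And>t. 0 < t \<Longrightarrow> t < \<delta> \<Longrightarrow> \<omega> t < \<eta>"
    by (auto simp: eventually_at_right_field)
  define K' where "K' = max K 0"
  define Q where "Q = C * K' powr (l/m)"
  have Q: "Q \<ge> 0" using C by (simp add: Q_def)
  \<comment> \<open>By Chebyshev and the Sobolev bound \<open>Q\<close>, \<open>k0 powr l\<close>
    times the measure of the superlevel set is at most \<open>Q\<close>, so this choice forces the
    measure below \<open>\<delta>\<close>. The added 1 makes the inequality strict and ensures
    \<open>k0 \<ge> 1\<close>.\<close>
  define k0 where "k0 = (Q / \<delta> + 1) powr (1/l)"
  have k0: "k0 \<ge> 1" using Q \<delta> l by (auto simp: k0_def intro!: ge_one_powr_ge_zero)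
  have k0l: "k0 powr l = Q / \<delta> + 1" using Q \<delta> l by (simp add: k0_def powr_powr)
  show ?thesis
  proof (intro exI[of _ "2 * k0"] allI impI, elim conjE)
    fix \<Omega> :: "(real^'n) set" and a b \<phi> \<psi> u Du
    assume D: "open \<Omega>" "bounded \<Omega>" "diameter \<Omega> \<le> d" and car: "caratheodory \<Omega> a"
      and \<phi>0: "\<forall>x. \<phi> x \<ge> 0" and \<phi>: "in_morrey p lam \<Omega> \<phi>" "morrey_norm p lam \<Omega> \<phi> \<le> \<Phi>"
      and \<psi>0: "\<forall>x. \<psi> x \<ge> 0" and \<psi>: "in_morrey q \<mu> \<Omega> \<psi>" "morrey_norm q \<mu> \<Omega> \<psi> \<le> \<Psi>"
      and str: "AE x in lebesgue_on \<Omega>. \<forall>z \<xi>.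
            norm (a x z \<xi>) \<le> \<Lambda> * (\<phi> x + \<bar>z\<bar> powr (l * (m - 1) / m) + norm \<xi> powr (m - 1))
          \<and> \<bar>b x z \<xi>\<bar> \<le> \<Lambda> * (\<psi> x + \<bar>z\<bar> powr (l - 1) + norm \<xi> powr (m * (l - 1) / l))
          \<and> a x z \<xi> \<bullet> \<xi> \<ge> \<gamma> * norm \<xi> powr m - \<Lambda> * \<bar>z\<bar> powr l - \<Lambda> * \<phi> x powr (m / (m - 1))"
      and sol: "weak_solution m \<Omega> a b u Du"
      and K: "(\<integral>\<^sup>+ x\<in>\<Omega>. ennreal (norm (Du x) powr m) \<partial>lebesgue) \<le> ennreal K"
      and ui: "\<forall>E. E \<in> sets lebesgue \<and> E \<subseteq> \<Omega> \<longrightarrow>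
            (\<integral>\<^sup>+ x\<in>E. ennreal (norm (Du x) powr m) \<partial>lebesgue) \<le> ennreal (\<omega> (measure lebesgue E))"
    let ?N = "lebesgue_on \<Omega>"
    have Ds: "\<Omega> \<in> sets lebesgue" using D(1) by simp
    have u: "sobolev_W10 m \<Omega> u Du" using sol by (simp add: weak_solution_def)
    note um[measurable] = sobolev_W10_measurable[OF u]
    have \<phi>m[measurable]: "\<phi> \<in> borel_measurable ?N" using \<phi> by (auto simp: in_morrey_def lp_on_def)
    have \<psi>m[measurable]: "\<psi> \<in> borel_measurable ?N" using \<psi> by (auto simp: in_morrey_def lp_on_def)
    have g0: "lower_growth V n \<Omega> (\<lambda>_. 1)" unfolding V_def n_def by (rule one_lower_growth[OF D(1)])
    have g1: "lower_growth C1 \<beta>1 \<Omega> (\<lambda>x. \<phi> x powr m')"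
      unfolding C1_def \<beta>1_def V_def n_def using \<phi>0 m' pm by (intro in_morrey_lower_growth[OF \<phi>]  D(1)) auto
    have g2: "lower_growth C2 \<beta>2 \<Omega> \<psi>"
    proof -
      have "lower_growth C2 \<beta>2 \<Omega> (\<lambda>x. \<psi> x powr 1)"
        unfolding C2_def \<beta>2_def V_def n_def using \<psi>0 q1 by (intro in_morrey_lower_growth[OF \<psi>] D(1)) auto
      then show ?thesis using \<psi>0 by simp
    qed
    define w where "w = (\<lambda>x. \<phi> x powr m' + \<psi> x)"
    have w0: "w x \<ge> 0" for x using \<psi>0 by (simp add: w_def)
    have wm[measurable]: "w \<in> borel_measurable ?N" unfolding w_def by measurable
    have K': "K' \<ge> 0" "(\<integral>\<^sup>+ x. ennreal (norm (Du x) powr m) \<partial>?N) \<le> ennreal K'"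
      using K unfolding nn_set_integral_eq_lebesgue_on[OF Ds] by (auto simp: K'_def max_def ennreal_neg)
    have trA: "(\<integral>\<^sup>+ x. ennreal 1 * ennreal (\<bar>v x\<bar> powr l) \<partial>?N) \<le> ennreal (C * F powr (l/m))"
      if "sobolev_W10 m \<Omega> v Dv" "F \<ge> 0" "(\<integral>\<^sup>+ x. ennreal (norm (Dv x) powr m) \<partial>?N) \<le> ennreal F" for v Dv F
      by (rule order_trans[OF CA(2)[OF D g0 that]]) (use C in \<open>auto intro!: ennreal_leI mult_right_mono\<close>)
    have trB: "(\<integral>\<^sup>+ x. ennreal (w x) * ennreal (\<bar>v x\<bar> powr s) \<partial>?N) \<le> ennreal (C * F powr (s/m))"
      if v: "sobolev_W10 m \<Omega> v Dv" "F \<ge> 0" "(\<integral>\<^sup>+ x. ennreal (norm (Dv x) powr m) \<partial>?N) \<le> ennreal F" for v Dv F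
    proof -
      note [measurable] = sobolev_W10_measurable(1)[OF v(1)]
      have "(\<integral>\<^sup>+ x. ennreal (w x) * ennreal (\<bar>v x\<bar> powr s) \<partial>?N)
        = (\<integral>\<^sup>+ x. ennreal (\<phi> x powr m') * ennreal (\<bar>v x\<bar> powr s) + ennreal (\<psi> x) * ennreal (\<bar>v x\<bar> powr s) \<partial>?N)"
        using \<psi>0 by (intro nn_integral_cong) (simp add: w_def distrib_right)
      also have "\<dots> = (\<integral>\<^sup>+ x. ennreal (\<phi> x powr m') * ennreal (\<bar>v x\<bar> powr s) \<partial>?N) + (\<integral>\<^sup>+ x. ennreal (\<psi> x) * ennreal (\<bar>v x\<bar> powr s) \<partial>?N)"
        by (rule nn_integral_add) measurable
      also have "\<dots> \<le> ennreal (CB * F powr (s/m)) + ennreal (CC * F powr (s/m))"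
        by (intro add_mono CB(2)[OF D g1 v] CC(2)[OF D g2 v])
      also have "\<dots> = ennreal ((CB + CC) * F powr (s/m))"
        using CB(1) CC(1) by (simp add: ennreal_plus[symmetric] distrib_right del: ennreal_plus)
      also have "\<dots> \<le> ennreal (C * F powr (s/m))" using C by (intro ennreal_leI mult_right_mono) auto
      finally show ?thesis .
    qed
    have uQ: "(\<integral>\<^sup>+ x. ennreal (\<bar>u x\<bar> powr l) \<partial>?N) \<le> ennreal Q"
      using trA[OF u K'] by (simp add: Q_def)
    have ufin: "(\<integral>\<^sup>+ x. ennreal (\<bar>u x\<bar> powr l) \<partial>?N) < \<infinity>"
      using order.strict_trans1[OF uQ] by simp
    have \<phi>fin: "(\<integral>\<^sup>+ x. ennreal (\<phi> x powr (m/(m-1))) \<partial>?N) < \<infinity>"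
    proof (cases "\<Omega> = {}")
      case False
      then obtain x0 where x0: "x0 \<in> \<Omega>" by auto
      have "(\<integral>\<^sup>+ x. ennreal (\<phi> x powr (m/(m-1))) \<partial>?N) = (\<integral>\<^sup>+ x. ennreal (\<phi> x powr m') * indicator (ball x0 (\<bar>d\<bar> + 1)) x \<partial>?N)"
        using subset_ball_diameter[OF D(2,3) x0] by (intro nn_integral_cong) (auto simp: m'_def indicator_def)
      also have "\<dots> \<le> ennreal (C1 * (\<bar>d\<bar> + 1) powr \<beta>1)"
        using g1 x0 unfolding lower_growth_def by auto
      finally show ?thesis by (rule order.strict_trans1) simp
    qed (simp add: nn_integral_empty)
    define f where "f = (\<lambda>k. enn2real (\<integral>\<^sup>+ x. ennreal (indicator {t. \<bar>t\<bar> > k} (u x) * norm (Du x) powr m) \<partial>?N))"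
    have fle: "(\<integral>\<^sup>+ x. ennreal (indicator {t. \<bar>t\<bar> > k} (u x) * norm (Du x) powr m) \<partial>?N) \<le> ennreal K'" for k
      by (rule order_trans[OF nn_integral_mono K'(2)]) (auto simp: indicator_def)
    have f: "(\<integral>\<^sup>+ x. ennreal (indicator {t. \<bar>t\<bar> > k} (u x) * norm (Du x) powr m) \<partial>?N) = ennreal (f k)" for k
      unfolding f_def using fle[of k] by (intro ennreal_enn2real[symmetric]) (rule order.strict_trans1, auto)
    have f0: "f k \<ge> 0" for k by (simp add: f_def)
    have fmono: "f h \<le> f k" if "0 < k" "k \<le> h" for k h
    proof -
      have "ennreal (f h) \<le> ennreal (f k)"
        unfolding f[symmetric] using that by (intro nn_integral_mono ennreal_leI) (auto simp: indicator_def)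
      then show ?thesis using f0 by simp
    qed
    have init: "f k0 \<le> \<eta>"
    proof -
      define E where "E = {x \<in> \<Omega>. \<bar>u x\<bar> > k0}"
      have "{x \<in> space ?N. \<bar>u x\<bar> > k0} \<in> sets ?N" by measurable
      then have Es: "E \<in> sets lebesgue" "E \<in> sets ?N" using Ds by (auto simp: E_def sets_restrict_space_iff)
      have fE: "ennreal (f k0) = (\<integral>\<^sup>+ x\<in>E. ennreal (norm (Du x) powr m) \<partial>lebesgue)"
      proof -
        have "ennreal (f k0) = (\<integral>\<^sup>+ x. ennreal (indicator {t. \<bar>t\<bar> > k0} (u x) * norm (Du x) powr m) * indicator \<Omega> x \<partial>lebesgue)"
          unfolding f[symmetric] nn_set_integral_eq_lebesgue_on[OF Ds, symmetric] ..
        also have "\<dots> = (\<integral>\<^sup>+ x\<in>E. ennreal (norm (Du x) powr m) \<partial>lebesgue)"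
          by (intro nn_integral_cong) (auto simp: E_def indicator_def)
        finally show ?thesis .
      qed
      have "ennreal (k0 powr l) * emeasure lebesgue E = (\<integral>\<^sup>+ x. ennreal (k0 powr l) * indicator E x \<partial>?N)"
      proof -
        have "emeasure ?N E = emeasure lebesgue E" using Ds by (intro emeasure_restrict_space) (auto simp: E_def)
        then show ?thesis using Es(2) by (simp add: nn_integral_cmult_indicator)
      qed
      also have "\<dots> \<le> (\<integral>\<^sup>+ x. ennreal (\<bar>u x\<bar> powr l) \<partial>?N)"
        using k0 l by (intro nn_integral_mono) (auto simp: E_def indicator_def intro!: ennreal_leI powr_mono2)
      also have "\<dots> \<le> ennreal Q" by (rule uQ)
      finally have cheb: "ennreal (k0 powr l) * emeasure lebesgue E \<le> ennreal Q" .
      have Efin: "emeasure lebesgue E = ennreal (measure lebesgue E)"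
      proof -
        have "emeasure lebesgue E \<le> emeasure lebesgue \<Omega>" using Ds by (intro emeasure_mono) (auto simp: E_def)
        also have "\<dots> < \<infinity>" by (rule emeasure_bounded_finite_lebesgue[OF D(2,1)])
        finally show ?thesis by (intro emeasure_eq_ennreal_measure) simp
      qed
      have "k0 powr l * measure lebesgue E \<le> Q"
        using cheb Q unfolding Efin by (simp add: ennreal_mult'[symmetric])
      then have "(Q / \<delta> + 1) * measure lebesgue E \<le> Q" by (simp add: k0l)
      moreover have "(Q / \<delta> + 1) * \<delta> > Q" using \<delta> by (simp add: field_simps)
      ultimately have E\<delta>: "measure lebesgue E < \<delta>"
        using Q \<delta> by (smt (verit, best) divide_nonneg_pos mult_left_mono)
      show ?thesis
      \<comment> \<open>A limit at \<open>at_right 0\<close> says nothing about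
        \<open>\<omega> 0\<close>, so a null superlevel set is treated directly.\<close>
      proof (cases "measure lebesgue E = 0")
        case True
        then have "E \<in> null_sets lebesgue" using Efin Es by (auto simp: null_sets_def)
        then have "(\<integral>\<^sup>+ x\<in>E. ennreal (norm (Du x) powr m) \<partial>lebesgue) = 0"
          by (rule nn_integral_null_set)
        then show ?thesis using fE \<eta> f0[of k0] by (simp add: ennreal_eq_0_iff)
      next
        case False
        then have "measure lebesgue E > 0" by (simp add: zero_less_measure_iff)
        with E\<delta> have "\<omega> (measure lebesgue E) < \<eta>" by (intro \<delta>(2))
        moreover have "ennreal (f k0) \<le> ennreal (\<omega> (measure lebesgue E))"
          unfolding fE using ui Es by (auto simp: E_def)
        ultimately have "ennreal (f k0) \<le> ennreal \<eta>" by (meson ennreal_leI less_imp_le order_trans)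
        then show ?thesis using \<eta> by simp
      qed
    qed
    have m1: "m \<ge> 1" and s1: "s \<ge> 1" "s > 0" and l0: "l > 0" using m s l by auto
    show "AE x in ?N. \<bar>u x\<bar> \<le> 2 * k0"
    proof (rule De_Giorgi_bound[where f=f and w=w and m=m and s=s and l=l and C=C and c=c and \<gamma>=\<gamma> and \<eta>=\<eta>])
      show "f h \<le> f k" if "0 < k" "k \<le> h" for k h using that by (rule fmono)
      fix k :: real assume k: "k > 0"
      show "(\<integral>\<^sup>+ x. ennreal (max 0 (\<bar>u x\<bar> - k) powr l) \<partial>?N) \<le> ennreal (C * f k powr (l/m))"
        using trace_truncation[OF D(1,2) m1 l0 k u _ trA f0[of k] order_eq_refl[OF f]] by simp
      show "(\<integral>\<^sup>+ x. ennreal (w x) * ennreal (max 0 (\<bar>u x\<bar> - k) powr s) \<partial>?N) \<le> ennreal (C * f k powr (s/m))"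
        by (rule trace_truncation[OF D(1,2) m1 s1(2) k u wm trB f0[of k] order_eq_refl[OF f]])
      show "ennreal (\<gamma> / 2 * f k) \<le> ennreal c *
         ((\<integral>\<^sup>+ x. ennreal (w x) * ennreal (max 0 (\<bar>u x\<bar> - k) powr s) \<partial>?N)
         + (\<integral>\<^sup>+ x. ennreal (max 0 (\<bar>u x\<bar> - k) powr l) \<partial>?N)
         + (\<integral>\<^sup>+ x. ennreal ((k powr l + w x) * indicator {t. \<bar>t\<bar> > k} (u x)) \<partial>?N))"
        unfolding c_def w_def m'_def
        by (rule caccioppoli_estimate[OF D(1,2) m(1) l(1) s1(1) k \<gamma> \<Lambda> sol car \<phi>0[rule_format] \<psi>0[rule_format] \<phi>m \<psi>m str ufin \<phi>fin f0 f])
    qed (rule um(1) wm w0 s(1,2) C(1) c \<gamma> f0 k0 init \<eta> small1 small2 | use m in simp)+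
  qed
qed

end
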